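(* Let $K\ge1$ be fixed and let $\boldsymbol{\beta}_0=(\beta_{1,0},\dots,\beta_{k_0,0},0,\dots,0)^t\in\mathbb{R}^K$ with $\beta_{1,0},\dots,\beta_{k_0,0}$ all nonzero, $1\le k_0\le K$. For each $n>K$ let the $n\times K$ design matrix $\mathbf{X}$ with rows $\mathbf{x}_i$ satisfy: (i) $\sum_{i=1}^n x_{i,k}=0$ and $\sum_{i=1}^n x_{i,k}^2=n$ for each $k$; (ii) $\max_i\|\mathbf{x}_i\|/\sqrt n\to0$; (iii) $\mathbf{X}^t\mathbf{X}$ positive definite; (iv) $\mathbf{X}^t\mathbf{X}/n\to\boldsymbol{\Sigma}_0$ positive definite. Suppose $Y_i=\mathbf{x}_i^t\boldsymbol{\beta}_0+\varepsilon_i$ with $\varepsilon_i$ independent, $\mathbb{E}(\varepsilon_i)=0$, $\mathbb{E}(\varepsilon_i^2)=\sigma_0^2>0$, $\mathbb{E}(\varepsilon_i^4)\le M<\infty$. Fix $\alpha_1,\dots,\alpha_K\in(0,1)$ and set $\alpha_{K+1}=0$. Then for each $1\le k\le K$, as $n\to\infty$: (a) $\mathbb{P}\{\hat k_B=k\}\to 0$ if $k<k_0$; $\to(1-\alpha_{k_0+1})\cdots(1-\alpha_K)$ if $k=k_0$; $\to\alpha_k(1-\alpha_{k+1})\cdots(1-\alpha_K)$ if $k>k_0$. Moreover, if $\mathbf{X}^t\mathbf{X}/n=\boldsymbol{\Sigma}_0=\mathbf{I}$ for all $n$: (b) $\mathbb{P}\{\hat k_F=k\}\to0$ if $k<k_0$;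 $\to 1-\alpha_{k_0+1}$ if $k=k_0$; $\to(1-\alpha_{k+1})\alpha_{k_0+1}\cdots\alpha_k$ if $k>k_0$; (c) $\mathbb{P}\{\hat k_O=k\}\to0$ if $k<k_0$; $\to\mathbb{P}\{B_{k_0+1}+\cdots+B_K=k-k_0\}$ if $k\ge k_0$, where $B_{k_0+1},\dots,B_K$ are independent with $B_j\sim\mathrm{Bernoulli}(\alpha_j)$. (Empty products equal $1$.)
   Context: $\mathbf{Y}=(Y_1,\dots,Y_n)^t$, OLS $\widehat{\boldsymbol{\beta}}_n^\circ=(\mathbf{X}^t\mathbf{X})^{-1}\mathbf{X}^t\mathbf{Y}=(\widehat\beta_{1,n}^\circ,\dots,\widehat\beta_{K,n}^\circ)^t$, $\widehat\sigma_n^2=\|\mathbf{Y}-\mathbf{X}\widehat{\boldsymbol{\beta}}_n^\circ\|^2/(n-K)$; $z_{a}$ denotes the $100(1-a)$ percentile of $N(0,1)$, with $z_0=+\infty$. For $1\le k\le K$ let $\mathbf{X}[k]$ be the first $k$ columns of $\mathbf{X}$, $\widehat{\boldsymbol{\beta}}^\circ[k]=(\mathbf{X}[k]^t\mathbf{X}[k])^{-1}\mathbf{X}[k]^t\mathbf{Y}$ with last coordinate $\widehat\beta_k^\circ[k]$, $s_{kk}[k]$ the $k$th diagonal entry of $(\mathbf{X}[k]^t\mathbf{X}[k]/n)^{-1}$, and $\tilde Z_{k,n}=n^{1/2}\widehat\beta_k^\circ[k]/(\widehat\sigma_n s_{kk}[k]^{1/2})$; set $\tilde Z_{0,n}=0$,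 $z_{\alpha_0/2}=0$, $\tilde Z_{K+1,n}=0$. Backward estimator: $\hat k_B=\max\{k\in\{0,\dots,K\}:|\tilde Z_{k,n}|\ge z_{\alpha_k/2}\}$. Forward estimator: $\hat k_F=\min\{k-1: k\in\{1,\dots,K+1\},\ |\tilde Z_{k,n}|<z_{\alpha_k/2}\}$. OLS-hard estimator: with $s_{kk}$ the $k$th diagonal entry of $(\mathbf{X}^t\mathbf{X}/n)^{-1}$ and $\widehat Z_{k,n}=n^{1/2}\widehat\beta_{k,n}^\circ/(\widehat\sigma_n s_{kk}^{1/2})$, $\hat k_O=\#\{k\le K:|\widehat Z_{k,n}|\ge z_{\alpha_k/2}\}$. *)

theory Defs
  imports "HOL-Probability.Probability" "Jordan_Normal_Form.Matrix"
begin

definition Phi :: "real \<Rightarrow> real" where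
  "Phi x = measure (density lborel std_normal_density) {..x}"

definition zq :: "real \<Rightarrow> ereal" where
  "zq a = (if a = 0 then \<infinity> else ereal (THE z. Phi z = 1 - a))"

definition minv :: "real mat \<Rightarrow> real mat" where
  "minv A = (THE B. B \<in> carrier_mat (dim_row A) (dim_row A) \<and> A * B = 1\<^sub>m (dim_row A))"

definition pos_def_mat :: "real mat \<Rightarrow> bool" where
  "pos_def_mat A \<longleftrightarrow> A \<in> carrier_mat (dim_row A) (dim_row A) \<and> transpose_mat A = A \<and>
     (\<forall>v \<in> carrier_vec (dim_row A). v \<noteq> 0\<^sub>v (dim_row A) \<longrightarrow> scalar_prod v (A *\<^sub>v v) > 0)"

definition first_cols :: "real mat \<Rightarrow> nat \<Rightarrow> real mat" where
  "first_cols X k = mat (dim_row X) k (\<lambda>(i,j). index_mat X (i,j))"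

definition ols :: "real mat \<Rightarrow> real vec \<Rightarrow> real vec" where
  "ols X y = minv (transpose_mat X * X) *\<^sub>v (transpose_mat X *\<^sub>v y)"

definition sigma_hat :: "real mat \<Rightarrow> real vec \<Rightarrow> real" where
  "sigma_hat X y = sqrt ((\<Sum>i<dim_row X. (vec_index (y - X *\<^sub>v ols X y) i)\<^sup>2)
                         / real (dim_row X - dim_col X))"

(* Columns / coefficients are indexed 1..K as in the paper; column k is JNF index k-1. *)

definition s_sub :: "real mat \<Rightarrow> nat \<Rightarrow> real" where
  "s_sub X k = index_mat (minv ((1 / real (dim_row X)) \<cdot>\<^sub>m
       (transpose_mat (first_cols X k) * first_cols X k))) (k - 1, k - 1)"

definition Z_tilde :: "real mat \<Rightarrow> real vec \<Rightarrow> nat \<Rightarrow> real" where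
  "Z_tilde X y k = (if k = 0 \<or> k > dim_col X then 0 else
     sqrt (real (dim_row X)) * vec_index (ols (first_cols X k) y) (k - 1)
       / (sigma_hat X y * sqrt (s_sub X k)))"

definition s_full :: "real mat \<Rightarrow> nat \<Rightarrow> real" where
  "s_full X k = index_mat (minv ((1 / real (dim_row X)) \<cdot>\<^sub>m (transpose_mat X * X))) (k - 1, k - 1)"

definition Z_hat :: "real mat \<Rightarrow> real vec \<Rightarrow> nat \<Rightarrow> real" where
  "Z_hat X y k = sqrt (real (dim_row X)) * vec_index (ols X y) (k - 1)
       / (sigma_hat X y * sqrt (s_full X k))"

definition thr :: "(nat \<Rightarrow> real) \<Rightarrow> nat \<Rightarrow> ereal" where
  "thr \<alpha> k = (if k = 0 then 0 else zq (\<alpha> k / 2))"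

definition k_B :: "(nat \<Rightarrow> real) \<Rightarrow> real mat \<Rightarrow> real vec \<Rightarrow> nat" where
  "k_B \<alpha> X y = Max {k \<in> {0..dim_col X}. ereal \<bar>Z_tilde X y k\<bar> \<ge> thr \<alpha> k}"

definition k_F :: "(nat \<Rightarrow> real) \<Rightarrow> real mat \<Rightarrow> real vec \<Rightarrow> nat" where
  "k_F \<alpha> X y = Min {k - 1 | k. k \<in> {1..dim_col X + 1} \<and> ereal \<bar>Z_tilde X y k\<bar> < thr \<alpha> k}"

definition k_O :: "(nat \<Rightarrow> real) \<Rightarrow> real mat \<Rightarrow> real vec \<Rightarrow> nat" where
  "k_O \<alpha> X y = card {k \<in> {1..dim_col X}. ereal \<bar>Z_hat X y k\<bar> \<ge> thr \<alpha> k}"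

end

theory Submission
  imports Defs "Jordan_Normal_Form.Determinant" "HOL-Real_Asymp.Real_Asymp"
begin

text \<open>
  Let \<^emph>\<open>c\<close> be the last row of the inverse Gram matrix of the first \<^emph>\<open>k\<close> columns, applied to those columns:
  it lies in their span and is orthogonal to the first \<^emph>\<open>k - 1\<close> of them. Normalising it to a unit vector
  \<^emph>\<open>q_k\<close>, the statistic is \<^emph>\<open><q_k, Y> / sigma_hat\<close>, and the \<^emph>\<open>q_k\<close> are orthonormal. For \<^emph>\<open>k > k0\<close> the
  regression mean is orthogonal to \<^emph>\<open>q_k\<close>, so only noise remains; at \<^emph>\<open>k = k0\<close> (and for an orthonormal design at
  every \<^emph>\<open>k \<le> k0\<close>) the mean contributes a drift of order \<^emph>\<open>sqrt n\<close>, so the null hypothesis is rejected with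
  probability tending to 1. Since \<^emph>\<open>max_i |x_i| / sqrt n\<close> tends to 0, the coordinates of the \<^emph>\<open>q_k\<close> are uniformly
  small and the joint characteristic function of the studentized noise terms tends to that of independent standard
  normals, the consistency of \<^emph>\<open>sigma_hat\<close> being absorbed at the level of characteristic functions. The limits of
  the three estimators are then probabilities of independent rejections.

  No multivariate continuity theorem is needed to pass from characteristic functions to probabilities of boxes:
  the exponential factors are replaced by indicators one coordinate at a time, applying Levy's one-dimensional
  theorem to the measures with density \<^emph>\<open>2 + Re G\<close> and \<^emph>\<open>2 + Im G\<close>, where \<^emph>\<open>G\<close> is the product of the other factors.
\<close>

text \<open>For \<open>k < k0\<close> the coefficients omitted from the regression on
  \<open>k\<close> columns enter the drift of \<open>q_k\<close> and may cancel it, so no rejection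
  can be claimed there for a general design. The backward search is indifferent to this: selecting
  \<open>k < k0\<close> already requires a failure to reject at \<open>k0\<close>. The other two
  estimators need rejections at every \<open>k \<le> k0\<close>.

  The estimated standard deviation is shared by all coordinates and depends on the same errors, so
  independence appears only in the limit. It is treated as a common random factor tending to 1,
  which needs only bounded second moments of the linear statistic.

  One quantitative fact about the design is used three times: for large \<open>n\<close> the Gram
  matrix dominates \<open>n * \<kappa>\<close> times the identity. This bounds the coefficients,
  hence the coordinates, of the \<open>q_k\<close>; it bounds the drift at \<open>k0\<close> from
  below; and it controls the part of the errors absorbed by the fit. Fourth moments serve twice: for
  the cubic remainder of the characteristic functions and for the law of large numbers of the
  squared errors.\<close>

unbundle no vec_syntax

section \<open>Joint convergence from characteristic functions\<close>

text \<open>Dividing \<open>h n\<close> by its mean gives a density, and \<open>\<nu> n\<close> is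
  the law of \<open>W n\<close> under the reweighted measure \<open>Q n\<close>; the one-dimensional
  continuity theorem applies to \<open>\<nu>\<close>. The hypothesis at \<open>t = 0\<close> says
  that the means of \<open>h n\<close> tend to \<open>c\<close>, and the lower bound 1 keeps them
  and \<open>c\<close> away from 0, so the normalisation can be undone in the limit.\<close>

lemma (in prob_space) weighted_levy_continuity:
  fixes h W :: "nat \<Rightarrow> 'a \<Rightarrow> real" and \<mu> :: "real measure" and c :: real
  assumes h_meas [measurable]: "\<And>n. h n \<in> borel_measurable M"
    and W_meas [measurable]: "\<And>n. W n \<in> borel_measurable M"
    and h: "\<And>n \<omega>. 1 \<le> h n \<omega>" "\<And>n \<omega>. h n \<omega> \<le> B"
    and \<mu>: "real_distribution \<mu>"
    and lim: "\<And>t. (\<lambda>n. expectation (\<lambda>\<omega>. complex_of_real (h n \<omega>) * iexp (t * W n \<omega>)))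
                \<longlonglongrightarrow> complex_of_real c * char \<mu> t"
    and A [measurable]: "A \<in> sets borel" and front: "emeasure \<mu> (frontier A) = 0"
  shows "(\<lambda>n. expectation (\<lambda>\<omega>. h n \<omega> * indicator A (W n \<omega>))) \<longlonglongrightarrow> c * measure \<mu> A"
proof -
  interpret \<mu>: real_distribution \<mu> by fact
  have int_h [simp]: "integrable M (h n)" for n
  proof (rule integrable_const_bound[where B=B])
    have "norm (h n \<omega>) \<le> B" for \<omega> using h(1)[of n \<omega>] h(2)[of n \<omega>] by simp
    then show "AE \<omega> in M. norm (h n \<omega>) \<le> B" by simp
  qed simp
  define e where "e n = expectation (h n)" for n
  have e1: "1 \<le> e n" for n
  proof -
    have "expectation (\<lambda>_. 1) \<le> expectation (h n)"
      by (rule integral_mono) (use h in auto)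
    then show ?thesis by (simp add: prob_space e_def)
  qed
  have e0: "e n > 0" for n using e1[of n] by linarith
  have e_lim: "e \<longlonglongrightarrow> c"
  proof -
    have "(\<lambda>n. complex_of_real (e n)) \<longlonglongrightarrow> complex_of_real c"
      using lim[of 0] by (simp add: e_def \<mu>.char_zero)
    then show ?thesis by (simp only: tendsto_of_real_iff)
  qed
  have c: "c \<ge> 1" using LIMSEQ_le_const[OF e_lim] e1 by blast
  define Q where "Q n = density M (\<lambda>\<omega>. ennreal (h n \<omega> / e n))" for n
  have hn: "0 \<le> h n \<omega> / e n" for n \<omega>
    using h(1)[of n \<omega>] e0[of n] by simp
  have Q_prob: "prob_space (Q n)" for n
  proof (rule prob_spaceI)
    have "(\<integral>\<^sup>+\<omega>. ennreal (h n \<omega> / e n) \<partial>M) = ennreal (\<integral>\<omega>. h n \<omega> / e n \<partial>M)"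
      by (rule nn_integral_eq_integral) (use hn in auto)
    also have "(\<integral>\<omega>. h n \<omega> / e n \<partial>M) = 1"
      using e0[of n] by (simp add: e_def)
    finally show "emeasure (Q n) (space (Q n)) = 1"
      by (simp add: Q_def emeasure_density cong: nn_integral_cong)
  qed
  have WQ [measurable]: "W n \<in> borel_measurable (Q n)" for n
    by (simp add: Q_def)
  define \<nu> where "\<nu> n = distr (Q n) borel (W n)" for n
  have \<nu>: "real_distribution (\<nu> n)" for n
    unfolding \<nu>_def by (intro prob_space.real_distribution_distr Q_prob WQ)
  have char\<nu>: "char (\<nu> n) t = expectation (\<lambda>\<omega>. complex_of_real (h n \<omega>) * iexp (t * W n \<omega>)) / complex_of_real (e n)" for n t
  proof -
    have "char (\<nu> n) t = (\<integral>\<omega>. iexp (t * W n \<omega>) \<partial>Q n)"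
      by (simp add: char_def \<nu>_def integral_distr)
    also have "\<dots> = (\<integral>\<omega>. (h n \<omega> / e n) *\<^sub>R iexp (t * W n \<omega>) \<partial>M)"
      unfolding Q_def by (subst integral_density) (use hn in auto)
    also have "\<dots> = (\<integral>\<omega>. complex_of_real (h n \<omega>) * iexp (t * W n \<omega>) / complex_of_real (e n) \<partial>M)"
      by (intro Bochner_Integration.integral_cong) (auto simp: scaleR_conv_of_real)
    finally show ?thesis by simp
  qed
  have "weak_conv_m \<nu> \<mu>"
  proof (rule levy_continuity[OF \<nu> \<mu>])
    fix t
    have "(\<lambda>n. char (\<nu> n) t) \<longlonglongrightarrow> (complex_of_real c * char \<mu> t) / complex_of_real c"
      unfolding char\<nu> by (intro tendsto_divide lim tendsto_of_real e_lim) (use c in auto)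
    then show "(\<lambda>n. char (\<nu> n) t) \<longlonglongrightarrow> char \<mu> t" using c by simp
  qed
  then have "(\<lambda>n. measure (\<nu> n) A) \<longlonglongrightarrow> measure \<mu> A"
    by (rule weak_conv_imp_continuity_set_conv[OF \<nu> \<mu> _ A front])
  then have L: "(\<lambda>n. e n * measure (\<nu> n) A) \<longlonglongrightarrow> c * measure \<mu> A"
    by (intro tendsto_mult e_lim)
  have "e n * measure (\<nu> n) A = expectation (\<lambda>\<omega>. h n \<omega> * indicator A (W n \<omega>))" for n
  proof -
    interpret Q: prob_space "Q n" by (rule Q_prob)
    have "measure (\<nu> n) A = (\<integral>x. indicator A x \<partial>\<nu> n)"
      by (simp add: \<nu>_def)
    also have "\<dots> = (\<integral>\<omega>. indicator A (W n \<omega>) \<partial>Q n)"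
      unfolding \<nu>_def by (subst integral_distr) auto
    also have "\<dots> = (\<integral>\<omega>. (h n \<omega> / e n) *\<^sub>R indicator A (W n \<omega>) \<partial>M)"
      unfolding Q_def by (subst integral_density) (use hn in auto)
    also have "\<dots> = (\<integral>\<omega>. h n \<omega> * indicator A (W n \<omega>) / e n \<partial>M)"
      by (intro Bochner_Integration.integral_cong) auto
    also have "\<dots> = expectation (\<lambda>\<omega>. h n \<omega> * indicator A (W n \<omega>)) / e n" by simp
    finally show ?thesis using e0[of n] by simp
  qed
  with L show ?thesis by simp
qed

lemma char_uminus: "char \<mu> (- t) = cnj (char \<mu> t)"
proof -
  have "cnj (char \<mu> t) = (CLINT x|\<mu>. cnj (iexp (t * x)))"
    unfolding char_def by simp
  also have "\<dots> = char \<mu> (- t)"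
    unfolding char_def by (intro Bochner_Integration.integral_cong refl) (simp add: exp_cnj)
  finally show ?thesis ..
qed

text \<open>A complex \<open>G\<close> is no density, but \<open>2 + Re G\<close> and
  \<open>2 + Im G\<close> lie in [1, 3]. Their transforms need the limit for
  \<open>cnj (G n)\<close>, obtained by conjugating \<open>limG\<close> at \<open>- t\<close>. The
  shift by 2 adds an unweighted term; this is why \<open>lim\<close> is assumed separately and why
  twice the unweighted limit is subtracted at the end.\<close>

lemma (in prob_space) complex_weighted_levy_continuity:
  fixes W :: "nat \<Rightarrow> 'a \<Rightarrow> real" and G :: "nat \<Rightarrow> 'a \<Rightarrow> complex" and \<mu> :: "real measure" and c :: complex
  assumes G_meas [measurable]: "\<And>n. G n \<in> borel_measurable M"
    and W_meas [measurable]: "\<And>n. W n \<in> borel_measurable M"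
    and G: "\<And>n \<omega>. cmod (G n \<omega>) \<le> 1"
    and \<mu>: "real_distribution \<mu>"
    and limG: "\<And>t. (\<lambda>n. expectation (\<lambda>\<omega>. G n \<omega> * iexp (t * W n \<omega>))) \<longlonglongrightarrow> c * char \<mu> t"
    and lim: "\<And>t. (\<lambda>n. expectation (\<lambda>\<omega>. iexp (t * W n \<omega>))) \<longlonglongrightarrow> char \<mu> t"
    and A [measurable]: "A \<in> sets borel" and front: "emeasure \<mu> (frontier A) = 0"
  shows "(\<lambda>n. expectation (\<lambda>\<omega>. G n \<omega> * complex_of_real (indicator A (W n \<omega>)))) \<longlonglongrightarrow> c * complex_of_real (measure \<mu> A)"
proof -
  have iG: "integrable M (\<lambda>\<omega>. G n \<omega> * iexp (t * W n \<omega>))" for n t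
    by (rule integrable_const_bound[where B=1]) (use G in \<open>auto simp: norm_mult\<close>)
  have iE: "integrable M (\<lambda>\<omega>. iexp (t * W n \<omega>))" for n t
    by (rule integrable_const_bound[where B=1]) auto
  have [measurable]: "cnj \<in> borel_measurable borel"
    by (intro borel_measurable_continuous_onI continuous_intros)
  have icG: "integrable M (\<lambda>\<omega>. cnj (G n \<omega>) * iexp (t * W n \<omega>))" for n t
    by (rule integrable_const_bound[where B=1]) (use G in \<open>auto simp: norm_mult\<close>)
  have limcG: "(\<lambda>n. expectation (\<lambda>\<omega>. cnj (G n \<omega>) * iexp (t * W n \<omega>))) \<longlonglongrightarrow> cnj c * char \<mu> t" for t
  proof -
    have "(\<lambda>n. cnj (expectation (\<lambda>\<omega>. G n \<omega> * iexp ((-t) * W n \<omega>)))) \<longlonglongrightarrow> cnj (c * char \<mu> (-t))"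
      by (intro tendsto_cnj limG)
    moreover have "cnj (expectation (\<lambda>\<omega>. G n \<omega> * iexp ((-t) * W n \<omega>))) = expectation (\<lambda>\<omega>. cnj (G n \<omega>) * iexp (t * W n \<omega>))" for n
      by (subst Bochner_Integration.integral_cnj[symmetric]) (simp add: exp_cnj)
    ultimately show ?thesis by (simp add: char_uminus)
  qed
  have absRe: "\<bar>Re (G n \<omega>)\<bar> \<le> 1" for n \<omega> using abs_Re_le_cmod[of "G n \<omega>"] G[of n \<omega>] by linarith
  have absIm: "\<bar>Im (G n \<omega>)\<bar> \<le> 1" for n \<omega> using abs_Im_le_cmod[of "G n \<omega>"] G[of n \<omega>] by linarith
  have base: "(\<lambda>n. expectation (\<lambda>\<omega>. indicator A (W n \<omega>) :: real)) \<longlonglongrightarrow> measure \<mu> A"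
    using weighted_levy_continuity[of "\<lambda>_ _. 1" W 1 \<mu> 1 A] lim \<mu> front by simp
  have re: "(\<lambda>n. expectation (\<lambda>\<omega>. (2 + Re (G n \<omega>)) * indicator A (W n \<omega>))) \<longlonglongrightarrow> (2 + Re c) * measure \<mu> A"
  proof (rule weighted_levy_continuity[where B=3])
    fix t
    have eq: "expectation (\<lambda>\<omega>. complex_of_real (2 + Re (G n \<omega>)) * iexp (t * W n \<omega>)) =
       2 * expectation (\<lambda>\<omega>. iexp (t * W n \<omega>)) + (expectation (\<lambda>\<omega>. G n \<omega> * iexp (t * W n \<omega>)) + expectation (\<lambda>\<omega>. cnj (G n \<omega>) * iexp (t * W n \<omega>))) / 2" for n
    proof -
      have "complex_of_real (2 + Re (G n \<omega>)) * iexp (t * W n \<omega>) = 2 * iexp (t * W n \<omega>) + (G n \<omega> * iexp (t * W n \<omega>) + cnj (G n \<omega>) * iexp (t * W n \<omega>)) / 2" for \<omega>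
        by (simp add: ring_distribs(2)[symmetric] complex_add_cnj del: ring_distribs)
      then show ?thesis using iG iE icG by simp
    qed
    have "(\<lambda>n. expectation (\<lambda>\<omega>. complex_of_real (2 + Re (G n \<omega>)) * iexp (t * W n \<omega>))) \<longlonglongrightarrow> 2 * char \<mu> t + (c * char \<mu> t + cnj c * char \<mu> t) / 2"
      unfolding eq by (intro tendsto_intros limG limcG lim) auto
    also have "2 * char \<mu> t + (c * char \<mu> t + cnj c * char \<mu> t) / 2 = complex_of_real (2 + Re c) * char \<mu> t"
      by (simp add: ring_distribs(2)[symmetric] complex_add_cnj del: ring_distribs)
    finally show "(\<lambda>n. expectation (\<lambda>\<omega>. complex_of_real (2 + Re (G n \<omega>)) * iexp (t * W n \<omega>))) \<longlonglongrightarrow> complex_of_real (2 + Re c) * char \<mu> t" .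
  next
    fix n \<omega> show "1 \<le> 2 + Re (G n \<omega>)" "2 + Re (G n \<omega>) \<le> 3" using absRe[of n \<omega>] by auto
  qed (use \<mu> front in auto)
  have im: "(\<lambda>n. expectation (\<lambda>\<omega>. (2 + Im (G n \<omega>)) * indicator A (W n \<omega>))) \<longlonglongrightarrow> (2 + Im c) * measure \<mu> A"
  proof (rule weighted_levy_continuity[where B=3])
    fix t
    have i2: "(z - cnj z) * w / (2 * \<i>) = complex_of_real (Im z) * w" for z w
      by (simp add: complex_diff_cnj) (metis (no_types, opaque_lifting) i_squared minus_minus mult.assoc mult.commute mult_minus1)
    have eq: "expectation (\<lambda>\<omega>. complex_of_real (2 + Im (G n \<omega>)) * iexp (t * W n \<omega>)) =
       2 * expectation (\<lambda>\<omega>. iexp (t * W n \<omega>)) + (expectation (\<lambda>\<omega>. G n \<omega> * iexp (t * W n \<omega>)) - expectation (\<lambda>\<omega>. cnj (G n \<omega>) * iexp (t * W n \<omega>))) / (2 * \<i>)" for n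
    proof -
      have "complex_of_real (2 + Im (G n \<omega>)) * iexp (t * W n \<omega>) = 2 * iexp (t * W n \<omega>) + (G n \<omega> * iexp (t * W n \<omega>) - cnj (G n \<omega>) * iexp (t * W n \<omega>)) / (2 * \<i>)" for \<omega>
        using i2[of "G n \<omega>" "iexp (t * W n \<omega>)"] by (simp add: left_diff_distrib distrib_right)
      then show ?thesis using iG iE icG by simp
    qed
    have "(\<lambda>n. expectation (\<lambda>\<omega>. complex_of_real (2 + Im (G n \<omega>)) * iexp (t * W n \<omega>))) \<longlonglongrightarrow> 2 * char \<mu> t + (c * char \<mu> t - cnj c * char \<mu> t) / (2 * \<i>)"
      unfolding eq by (intro tendsto_intros limG limcG lim) auto
    also have "2 * char \<mu> t + (c * char \<mu> t - cnj c * char \<mu> t) / (2 * \<i>) = complex_of_real (2 + Im c) * char \<mu> t"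
      using i2[of c "char \<mu> t"] by (simp add: left_diff_distrib distrib_right)
    finally show "(\<lambda>n. expectation (\<lambda>\<omega>. complex_of_real (2 + Im (G n \<omega>)) * iexp (t * W n \<omega>))) \<longlonglongrightarrow> complex_of_real (2 + Im c) * char \<mu> t" .
  next
    fix n \<omega> show "1 \<le> 2 + Im (G n \<omega>)" "2 + Im (G n \<omega>) \<le> 3" using absIm[of n \<omega>] by auto
  qed (use \<mu> front in auto)
  have iR: "integrable M (\<lambda>\<omega>. Re (G n \<omega>) * indicator A (W n \<omega>))"
    "integrable M (\<lambda>\<omega>. Im (G n \<omega>) * indicator A (W n \<omega>))"
    "integrable M (\<lambda>\<omega>. indicator A (W n \<omega>) :: real)" for n
    by (rule integrable_const_bound[where B=1]; use absRe absIm in \<open>auto split: split_indicator\<close>)+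
  have "expectation (\<lambda>\<omega>. G n \<omega> * complex_of_real (indicator A (W n \<omega>))) =
     complex_of_real (expectation (\<lambda>\<omega>. (2 + Re (G n \<omega>)) * indicator A (W n \<omega>)) - 2 * expectation (\<lambda>\<omega>. indicator A (W n \<omega>)))
     + \<i> * complex_of_real (expectation (\<lambda>\<omega>. (2 + Im (G n \<omega>)) * indicator A (W n \<omega>)) - 2 * expectation (\<lambda>\<omega>. indicator A (W n \<omega>)))" for n
  proof -
    have "expectation (\<lambda>\<omega>. G n \<omega> * complex_of_real (indicator A (W n \<omega>))) =
      expectation (\<lambda>\<omega>. complex_of_real (Re (G n \<omega>) * indicator A (W n \<omega>)) + \<i> * complex_of_real (Im (G n \<omega>) * indicator A (W n \<omega>)))"
      by (intro Bochner_Integration.integral_cong refl) (auto simp: complex_eq_iff)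
    also have "\<dots> = complex_of_real (expectation (\<lambda>\<omega>. Re (G n \<omega>) * indicator A (W n \<omega>))) + \<i> * complex_of_real (expectation (\<lambda>\<omega>. Im (G n \<omega>) * indicator A (W n \<omega>)))"
      using iR by (subst Bochner_Integration.integral_add) (auto simp del: of_real_mult)
    finally show ?thesis using iR by (simp add: distrib_right)
  qed
  moreover have "(\<lambda>n. complex_of_real (expectation (\<lambda>\<omega>. (2 + Re (G n \<omega>)) * indicator A (W n \<omega>)) - 2 * expectation (\<lambda>\<omega>. indicator A (W n \<omega>)))
     + \<i> * complex_of_real (expectation (\<lambda>\<omega>. (2 + Im (G n \<omega>)) * indicator A (W n \<omega>)) - 2 * expectation (\<lambda>\<omega>. indicator A (W n \<omega>))))
     \<longlonglongrightarrow> complex_of_real ((2 + Re c) * measure \<mu> A - 2 * measure \<mu> A) + \<i> * complex_of_real ((2 + Im c) * measure \<mu> A - 2 * measure \<mu> A)"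
    by (intro tendsto_intros re im base)
  moreover have "complex_of_real ((2 + Re c) * measure \<mu> A - 2 * measure \<mu> A) + \<i> * complex_of_real ((2 + Im c) * measure \<mu> A - 2 * measure \<mu> A) = c * complex_of_real (measure \<mu> A)"
    by (auto simp: complex_eq_iff algebra_simps)
  ultimately show ?thesis by simp
qed

text \<open>Induction on the set \<open>I\<close> of coordinates whose exponential has already been
  replaced by an indicator. The frequencies \<open>t\<close> stay arbitrary: moving \<open>m\<close>
  into \<open>I\<close> needs the induction hypothesis for all values of \<open>t m\<close> at once,
  since these form the characteristic function of \<open>Z n m\<close> weighted by the remaining
  factors.\<close>

lemma (in prob_space) joint_convergence_of_char:
  fixes Z :: "nat \<Rightarrow> 'j \<Rightarrow> 'a \<Rightarrow> real" and \<mu> :: "real measure"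
  assumes J: "finite J"
    and Z_meas [measurable]: "\<And>n j. Z n j \<in> borel_measurable M"
    and \<mu>: "real_distribution \<mu>"
    and lim: "\<And>t. (\<lambda>n. expectation (\<lambda>\<omega>. iexp (\<Sum>j\<in>J. t j * Z n j \<omega>))) \<longlonglongrightarrow> (\<Prod>j\<in>J. char \<mu> (t j))"
    and A [measurable]: "\<And>j. A j \<in> sets borel" and front: "\<And>j. j \<in> J \<Longrightarrow> emeasure \<mu> (frontier (A j)) = 0"
  shows "(\<lambda>n. prob {\<omega>\<in>space M. \<forall>j\<in>J. Z n j \<omega> \<in> A j}) \<longlonglongrightarrow> (\<Prod>j\<in>J. measure \<mu> (A j))"
proof -
  have main: "(\<lambda>n. expectation (\<lambda>\<omega>. complex_of_real (\<Prod>j\<in>I. indicator (A j) (Z n j \<omega>)) * iexp (\<Sum>j\<in>J-I. t j * Z n j \<omega>)))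
     \<longlonglongrightarrow> complex_of_real (\<Prod>j\<in>I. measure \<mu> (A j)) * (\<Prod>j\<in>J-I. char \<mu> (t j))"
    if "finite I" "I \<subseteq> J" for I t
    using that
  proof (induction I arbitrary: t rule: finite_induct)
    case empty
    then show ?case using lim by simp
  next
    case (insert m I)
    have m: "m \<in> J - I" "finite (J - I)" and sub: "I \<subseteq> J" and mI: "m \<notin> I" and mJ: "m \<in> J"
      using insert J by auto
    have JI: "J - insert m I = (J - I) - {m}" by auto
    have split: "(\<Sum>j\<in>J-I. s j * Z n j \<omega>) = s m * Z n m \<omega> + (\<Sum>j\<in>J - insert m I. s j * Z n j \<omega>)" for s :: "'j \<Rightarrow> real" and n \<omega>
      unfolding JI by (rule sum.remove) (use m in auto)
    have split': "(\<Prod>j\<in>J-I. char \<mu> (s j)) = char \<mu> (s m) * (\<Prod>j\<in>J - insert m I. char \<mu> (s j))" for s :: "'j \<Rightarrow> real"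
      unfolding JI by (rule prod.remove) (use m in auto)
    define G where "G n \<omega> = complex_of_real (\<Prod>j\<in>I. indicator (A j) (Z n j \<omega>)) * iexp (\<Sum>j\<in>J - insert m I. t j * Z n j \<omega>)" for n \<omega>
    have ind_le: "\<bar>\<Prod>j\<in>I. indicator (A j) (Z n j \<omega>) :: real\<bar> \<le> 1" for n \<omega>
      unfolding abs_prod by (rule prod_le_1) (auto split: split_indicator)
    have "(\<lambda>n. expectation (\<lambda>\<omega>. G n \<omega> * complex_of_real (indicator (A m) (Z n m \<omega>)))) \<longlonglongrightarrow>
        (complex_of_real (\<Prod>j\<in>I. measure \<mu> (A j)) * (\<Prod>j\<in>J-insert m I. char \<mu> (t j))) * complex_of_real (measure \<mu> (A m))"
    proof (rule complex_weighted_levy_continuity[OF _ _ _ \<mu>])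
      show "G n \<in> borel_measurable M" for n unfolding G_def by measurable
      show "cmod (G n \<omega>) \<le> 1" for n \<omega>
        using ind_le[of n \<omega>] by (simp add: G_def norm_mult del: of_real_prod of_real_sum)
      fix s
      \<comment> \<open>\<open>G\<close> has no factor at \<open>m\<close>, so changing the
        frequency there leaves it intact and lets \<open>s\<close> range freely.\<close>
      define t' where "t' = t(m := s)"
      have t': "(\<Sum>j\<in>J-insert m I. t' j * Z n j \<omega>) = (\<Sum>j\<in>J-insert m I. t j * Z n j \<omega>)" for n \<omega>
        by (rule sum.cong) (auto simp: t'_def)
      have t'': "(\<Prod>j\<in>J-insert m I. char \<mu> (t' j)) = (\<Prod>j\<in>J-insert m I. char \<mu> (t j))"
        by (rule prod.cong) (auto simp: t'_def)
      have t'm: "t' m = s" by (simp add: t'_def)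
      show "(\<lambda>n. expectation (\<lambda>\<omega>. G n \<omega> * iexp (s * Z n m \<omega>))) \<longlonglongrightarrow>
          complex_of_real (\<Prod>j\<in>I. measure \<mu> (A j)) * (\<Prod>j\<in>J-insert m I. char \<mu> (t j)) * char \<mu> s"
        using insert.IH[OF sub, of t'] unfolding split split' t' t'' t'm G_def
        by (simp add: exp_add distrib_left mult_ac del: of_real_prod of_real_sum)
      \<comment> \<open>Frequencies vanishing off \<open>m\<close> turn the joint limit into the
        marginal one needed for the unweighted term.\<close>
      define s' where "s' j = (if j = m then s else 0)" for j
      have "(\<Sum>j\<in>J. s' j * Z n j \<omega>) = s * Z n m \<omega>" for n \<omega>
        using J mJ by (simp add: s'_def if_distrib[of "\<lambda>x. x * _"] sum.delta cong: if_cong)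
      moreover have "(\<Prod>j\<in>J. char \<mu> (s' j)) = char \<mu> s"
      proof -
        have "(\<Prod>j\<in>J. char \<mu> (s' j)) = (\<Prod>j\<in>J. if j = m then char \<mu> s else 1)"
          by (rule prod.cong) (auto simp: s'_def real_distribution.char_zero[OF \<mu>])
        then show ?thesis using J mJ by simp
      qed
      ultimately show "(\<lambda>n. expectation (\<lambda>\<omega>. iexp (s * Z n m \<omega>))) \<longlonglongrightarrow> char \<mu> s"
        using lim[of s'] by simp
    qed (use front mJ in auto)
    then show ?case
      using insert.hyps by (simp add: G_def mult_ac del: of_real_sum)
  qed
  have "expectation (\<lambda>\<omega>. complex_of_real (\<Prod>j\<in>J. indicator (A j) (Z n j \<omega>))) = complex_of_real (prob {\<omega>\<in>space M. \<forall>j\<in>J. Z n j \<omega> \<in> A j})" for n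
  proof -
    have "expectation (\<lambda>\<omega>. complex_of_real (\<Prod>j\<in>J. indicator (A j) (Z n j \<omega>))) = complex_of_real (expectation (\<lambda>\<omega>. \<Prod>j\<in>J. indicator (A j) (Z n j \<omega>)))"
      by (rule integral_complex_of_real)
    also have "expectation (\<lambda>\<omega>. \<Prod>j\<in>J. indicator (A j) (Z n j \<omega>) :: real) = expectation (indicator {\<omega>\<in>space M. \<forall>j\<in>J. Z n j \<omega> \<in> A j})"
    proof (intro Bochner_Integration.integral_cong refl)
      fix \<omega> assume \<omega>: "\<omega> \<in> space M"
      show "(\<Prod>j\<in>J. indicator (A j) (Z n j \<omega>)) = (indicator {\<omega>\<in>space M. \<forall>j\<in>J. Z n j \<omega> \<in> A j} \<omega> :: real)"
      proof (cases "\<forall>j\<in>J. Z n j \<omega> \<in> A j")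
        case True
        then show ?thesis using \<omega> by simp
      next
        case False
        then have "\<exists>j\<in>J. indicator (A j) (Z n j \<omega>) = (0::real)" by (auto simp: indicator_def)
        then have "(\<Prod>j\<in>J. indicator (A j) (Z n j \<omega>)) = (0::real)" by (rule prod_zero[OF J])
        then show ?thesis using False by simp
      qed
    qed
    also have "\<dots> = prob {\<omega>\<in>space M. \<forall>j\<in>J. Z n j \<omega> \<in> A j}"
      using J by (subst Bochner_Integration.integral_indicator) (auto intro!: arg_cong[where f=prob])
    finally show ?thesis .
  qed
  then have "(\<lambda>n. complex_of_real (prob {\<omega>\<in>space M. \<forall>j\<in>J. Z n j \<omega> \<in> A j})) \<longlonglongrightarrow> complex_of_real (\<Prod>j\<in>J. measure \<mu> (A j))"
    using main[OF J order_refl] by (simp del: of_real_prod)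
  then show ?thesis by (simp only: tendsto_of_real_iff)
qed

section \<open>Linear statistics of independent errors\<close>

lemma (in prob_space) square_sum_indep:
  fixes \<xi> :: "'i \<Rightarrow> 'a \<Rightarrow> real"
  assumes I: "finite I"
    and indep: "indep_vars (\<lambda>_. borel) \<xi> UNIV"
    and sq: "\<And>i. integrable M (\<lambda>\<omega>. (\<xi> i \<omega>)\<^sup>2)"
    and mean: "\<And>i. expectation (\<xi> i) = 0"
  shows integrable_square_sum_indep: "integrable M (\<lambda>\<omega>. (\<Sum>i\<in>I. a i * \<xi> i \<omega>)\<^sup>2)"
    and expectation_square_sum_indep:
      "expectation (\<lambda>\<omega>. (\<Sum>i\<in>I. a i * \<xi> i \<omega>)\<^sup>2) = (\<Sum>i\<in>I. (a i)\<^sup>2 * expectation (\<lambda>\<omega>. (\<xi> i \<omega>)\<^sup>2))"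
proof -
  have rv [measurable]: "\<xi> i \<in> borel_measurable M" for i
    using indep unfolding indep_vars_def2 by simp
  have int: "integrable M (\<xi> i)" for i
    by (rule square_integrable_imp_integrable[OF _ sq]) simp
  have prod: "integrable M (\<lambda>\<omega>. \<xi> i \<omega> * \<xi> j \<omega>) \<and>
      expectation (\<lambda>\<omega>. \<xi> i \<omega> * \<xi> j \<omega>) = (if i = j then expectation (\<lambda>\<omega>. (\<xi> i \<omega>)\<^sup>2) else 0)" for i j
  proof (cases "i = j")
    case True
    then show ?thesis using sq[of i] by (simp add: power2_eq_square)
  next
    case False
    have ind: "indep_vars (\<lambda>_. borel) \<xi> {i, j}"
      by (rule indep_vars_subset[OF indep]) auto
    show ?thesis
      using indep_vars_integrable[OF _ ind] indep_vars_lebesgue_integral[OF _ ind] int False mean by simp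
  qed
  have expand: "(\<Sum>i\<in>I. a i * \<xi> i \<omega>)\<^sup>2 = (\<Sum>i\<in>I. \<Sum>j\<in>I. a i * a j * (\<xi> i \<omega> * \<xi> j \<omega>))" for \<omega>
    by (simp add: power2_eq_square sum_product mult_ac)
  show "integrable M (\<lambda>\<omega>. (\<Sum>i\<in>I. a i * \<xi> i \<omega>)\<^sup>2)"
    unfolding expand using prod by (intro Bochner_Integration.integrable_sum integrable_mult_right) blast
  have "expectation (\<lambda>\<omega>. (\<Sum>i\<in>I. a i * \<xi> i \<omega>)\<^sup>2) = (\<Sum>i\<in>I. \<Sum>j\<in>I. a i * a j * expectation (\<lambda>\<omega>. \<xi> i \<omega> * \<xi> j \<omega>))"
    unfolding expand using prod by (simp add: Bochner_Integration.integral_sum)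
  also have "\<dots> = (\<Sum>i\<in>I. \<Sum>j\<in>I. if i = j then a i * a j * expectation (\<lambda>\<omega>. (\<xi> i \<omega>)\<^sup>2) else 0)"
    using prod by (intro sum.cong refl) auto
  also have "\<dots> = (\<Sum>i\<in>I. (a i)\<^sup>2 * expectation (\<lambda>\<omega>. (\<xi> i \<omega>)\<^sup>2))"
    using I by (simp add: power2_eq_square)
  finally show "expectation (\<lambda>\<omega>. (\<Sum>i\<in>I. a i * \<xi> i \<omega>)\<^sup>2) = (\<Sum>i\<in>I. (a i)\<^sup>2 * expectation (\<lambda>\<omega>. (\<xi> i \<omega>)\<^sup>2))" .
qed

text \<open>Turns the Taylor polynomial of a characteristic function into a Gaussian factor. The
  upper bound goes through \<open>exp (- x) \<le> 1 / (1 + x)\<close> and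
  \<open>(1 - x + x^2) (1 + x) = 1 + x^3\<close>.\<close>

lemma exp_minus_approx:
  fixes x :: real
  assumes "0 \<le> x"
  shows "\<bar>(1 - x) - exp (- x)\<bar> \<le> x\<^sup>2"
proof -
  have "1 - x \<le> exp (- x)" using exp_ge_add_one_self[of "-x"] by simp
  moreover have "exp (- x) \<le> 1 - x + x\<^sup>2"
  proof -
    have "exp (- x) \<le> 1 / (1 + x)"
      using exp_ge_add_one_self[of x] assms by (simp add: exp_minus field_simps)
    also have "\<dots> \<le> 1 - x + x\<^sup>2"
    proof -
      have "1 \<le> 1 + x ^ 3" using assms by simp
      also have "\<dots> = (1 - x + x\<^sup>2) * (1 + x)" by (simp add: algebra_simps power2_eq_square power3_eq_cube)
      finally show ?thesis using assms by (simp add: divide_le_eq)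
    qed
    finally show ?thesis .
  qed
  ultimately show ?thesis by simp
qed

text \<open>The difference is \<open>x^2 (x^2 - |x| + 1)\<close>, whose last factor is positive. It
  controls a third absolute moment by the second and fourth ones.\<close>

lemma cube_le_square_plus_fourth: "\<bar>x\<bar> ^ 3 \<le> x\<^sup>2 + (x::real) ^ 4"
proof -
  have "0 \<le> x\<^sup>2 * ((\<bar>x\<bar> - 1/2)\<^sup>2 + 3/4)" by simp
  also have "\<dots> = x\<^sup>2 + x ^ 4 - \<bar>x\<bar> ^ 3"
    by (cases "x \<ge> 0") (simp_all add: algebra_simps power2_eq_square power3_eq_cube power4_eq_xxxx)
  finally show ?thesis by simp
qed

text \<open>A Lyapunov-type central limit theorem. Each factor of the product of characteristic
  functions is compared with its own Gaussian factor; all factors have modulus at most 1, so the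
  errors add. The error at \<open>i\<close> is at most \<open>(a n i)^2\<close> times a quantity
  that tends to 0 with \<open>m n\<close>, while the squares have a bounded sum. The
  \<open>\<epsilon> i\<close> need not be identically distributed because \<open>\<sigma>2\<close>
  and \<open>C\<close> are uniform in \<open>i\<close>.\<close>

lemma (in prob_space) linear_statistic_char_limit:
  fixes \<epsilon> :: "nat \<Rightarrow> 'a \<Rightarrow> real" and a :: "nat \<Rightarrow> nat \<Rightarrow> real"
  assumes indep: "indep_vars (\<lambda>_. borel) \<epsilon> UNIV"
    and fourth: "\<And>i. integrable M (\<lambda>\<omega>. (\<epsilon> i \<omega>) ^ 4)" "\<And>i. expectation (\<lambda>\<omega>. (\<epsilon> i \<omega>) ^ 4) \<le> C"
    and sq: "\<And>i. integrable M (\<lambda>\<omega>. (\<epsilon> i \<omega>)\<^sup>2)" "\<And>i. expectation (\<lambda>\<omega>. (\<epsilon> i \<omega>)\<^sup>2) = \<sigma>2"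
    and mean: "\<And>i. expectation (\<epsilon> i) = 0"
    and a_sq: "(\<lambda>n. \<Sum>i<n. (a n i)\<^sup>2) \<longlonglongrightarrow> v"
    and a_max: "\<forall>\<^sub>F n in sequentially. \<forall>i<n. \<bar>a n i\<bar> \<le> m n" and m: "m \<longlonglongrightarrow> 0"
  shows "(\<lambda>n. expectation (\<lambda>\<omega>. iexp (\<Sum>i<n. a n i * \<epsilon> i \<omega>))) \<longlonglongrightarrow> complex_of_real (exp (- (\<sigma>2 * v / 2)))"
proof -
  have rv [measurable]: "\<epsilon> i \<in> borel_measurable M" for i
    using indep unfolding indep_vars_def2 by simp
  have int: "integrable M (\<epsilon> i)" for i
    by (rule square_integrable_imp_integrable[OF _ sq(1)]) simp
  have \<sigma>2: "\<sigma>2 \<ge> 0"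
    unfolding sq(2)[of 0, symmetric] by simp
  have C: "C \<ge> 0"
    using fourth(2)[of 0] by (rule order_trans[rotated]) simp
  have step: "cmod (char (distr M borel (\<epsilon> i)) t - exp (- (\<sigma>2 * t\<^sup>2 / 2))) \<le> t\<^sup>2 * (\<bar>t\<bar> * (\<sigma>2 + C) + t\<^sup>2 * \<sigma>2\<^sup>2)" for i t
  proof -
    have "cmod (char (distr M borel (\<epsilon> i)) t - (1 - t\<^sup>2 * \<sigma>2 / 2)) \<le> (t\<^sup>2 / 6) * expectation (\<lambda>x. min (6 * (\<epsilon> i x)\<^sup>2) (\<bar>t\<bar> * \<bar>\<epsilon> i x\<bar> ^ 3))"
      by (rule char_approx3') (use int sq mean in auto)
    \<comment> \<open>The quadratic alternative in the minimum is dropped: the fourth moment makes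
      the cubic bound integrable.\<close>
    also have "expectation (\<lambda>x. min (6 * (\<epsilon> i x)\<^sup>2) (\<bar>t\<bar> * \<bar>\<epsilon> i x\<bar> ^ 3)) \<le> expectation (\<lambda>x. \<bar>t\<bar> * ((\<epsilon> i x)\<^sup>2 + (\<epsilon> i x) ^ 4))"
    proof (rule integral_mono)
      show "integrable M (\<lambda>x. min (6 * (\<epsilon> i x)\<^sup>2) (\<bar>t\<bar> * \<bar>\<epsilon> i x\<bar> ^ 3))"
        by (rule Bochner_Integration.integrable_bound[where f="\<lambda>x. 6 * (\<epsilon> i x)\<^sup>2"]) (use sq in auto)
      show "integrable M (\<lambda>x. \<bar>t\<bar> * ((\<epsilon> i x)\<^sup>2 + (\<epsilon> i x) ^ 4))" using sq fourth by simp
      fix x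
      have "\<bar>t\<bar> * \<bar>\<epsilon> i x\<bar> ^ 3 \<le> \<bar>t\<bar> * ((\<epsilon> i x)\<^sup>2 + (\<epsilon> i x) ^ 4)"
        by (intro mult_left_mono cube_le_square_plus_fourth) simp
      then show "min (6 * (\<epsilon> i x)\<^sup>2) (\<bar>t\<bar> * \<bar>\<epsilon> i x\<bar> ^ 3) \<le> \<bar>t\<bar> * ((\<epsilon> i x)\<^sup>2 + (\<epsilon> i x) ^ 4)" by simp
    qed
    also have "\<dots> = \<bar>t\<bar> * (\<sigma>2 + expectation (\<lambda>x. (\<epsilon> i x) ^ 4))" using sq fourth by simp
    also have "\<dots> \<le> \<bar>t\<bar> * (\<sigma>2 + C)" using fourth(2)[of i] by (intro mult_left_mono add_left_mono) auto
    finally have 1: "cmod (char (distr M borel (\<epsilon> i)) t - (1 - t\<^sup>2 * \<sigma>2 / 2)) \<le> t\<^sup>2 / 6 * (\<bar>t\<bar> * (\<sigma>2 + C))"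
      by (simp add: mult_left_mono)
    have 2: "cmod (complex_of_real (1 - t\<^sup>2 * \<sigma>2 / 2) - complex_of_real (exp (- (\<sigma>2 * t\<^sup>2 / 2)))) \<le> (\<sigma>2 * t\<^sup>2 / 2)\<^sup>2"
      using exp_minus_approx[of "\<sigma>2 * t\<^sup>2 / 2"] \<sigma>2
      unfolding of_real_diff[symmetric] norm_of_real by (simp add: mult_ac)
    have "cmod (char (distr M borel (\<epsilon> i)) t - exp (- (\<sigma>2 * t\<^sup>2 / 2))) \<le>
      cmod (char (distr M borel (\<epsilon> i)) t - (1 - t\<^sup>2 * \<sigma>2 / 2)) + cmod (complex_of_real (1 - t\<^sup>2 * \<sigma>2 / 2) - complex_of_real (exp (- (\<sigma>2 * t\<^sup>2 / 2))))"
      by (rule order_trans[OF _ norm_triangle_ineq]) simp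
    also have "\<dots> \<le> t\<^sup>2 / 6 * (\<bar>t\<bar> * (\<sigma>2 + C)) + (\<sigma>2 * t\<^sup>2 / 2)\<^sup>2" using 1 2 by linarith
    also have "\<dots> \<le> t\<^sup>2 * (\<bar>t\<bar> * (\<sigma>2 + C)) + t\<^sup>2 * (t\<^sup>2 * \<sigma>2\<^sup>2)"
    proof (rule add_mono)
      show "t\<^sup>2 / 6 * (\<bar>t\<bar> * (\<sigma>2 + C)) \<le> t\<^sup>2 * (\<bar>t\<bar> * (\<sigma>2 + C))"
        using \<sigma>2 C by (intro mult_right_mono) auto
      have "(\<sigma>2 * t\<^sup>2 / 2)\<^sup>2 = (t\<^sup>2 * (t\<^sup>2 * \<sigma>2\<^sup>2)) / 4" by (simp add: power2_eq_square)
      moreover have "0 \<le> t\<^sup>2 * (t\<^sup>2 * \<sigma>2\<^sup>2)" by simp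
      ultimately show "(\<sigma>2 * t\<^sup>2 / 2)\<^sup>2 \<le> t\<^sup>2 * (t\<^sup>2 * \<sigma>2\<^sup>2)" by linarith
    qed
    finally show ?thesis by (simp add: distrib_left)
  qed
  have fact: "expectation (\<lambda>\<omega>. iexp (\<Sum>i<n. a n i * \<epsilon> i \<omega>)) = (\<Prod>i<n. char (distr M borel (\<epsilon> i)) (a n i))" for n
  proof -
    have "expectation (\<lambda>\<omega>. iexp (\<Sum>i<n. a n i * \<epsilon> i \<omega>)) = char (distr M borel (\<lambda>\<omega>. \<Sum>i<n. a n i * \<epsilon> i \<omega>)) 1"
      unfolding char_def by (subst integral_distr) auto
    also have "\<dots> = (\<Prod>i<n. char (distr M borel (\<lambda>\<omega>. a n i * \<epsilon> i \<omega>)) 1)"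
    proof (rule char_distr_sum)
      have "indep_vars (\<lambda>_. borel) \<epsilon> {..<n}" by (rule indep_vars_subset[OF indep]) auto
      then show "indep_vars (\<lambda>i. borel) (\<lambda>i \<omega>. a n i * \<epsilon> i \<omega>) {..<n}"
        by (rule indep_vars_compose2[where Y="\<lambda>i x. a n i * x"]) auto
    qed
    also have "\<dots> = (\<Prod>i<n. char (distr M borel (\<epsilon> i)) (a n i))"
      unfolding char_def by (simp add: integral_distr)
    finally show ?thesis .
  qed
  let ?L = "\<lambda>n. complex_of_real (exp (- (\<sigma>2 * (\<Sum>i<n. (a n i)\<^sup>2) / 2)))"
  have bound: "\<forall>\<^sub>F n in sequentially. cmod (expectation (\<lambda>\<omega>. iexp (\<Sum>i<n. a n i * \<epsilon> i \<omega>)) - ?L n) \<le>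
      (\<Sum>i<n. (a n i)\<^sup>2) * (m n * (\<sigma>2 + C) + (m n)\<^sup>2 * \<sigma>2\<^sup>2)"
    using a_max
  proof eventually_elim
    case (elim n)
    \<comment> \<open>The Gaussian factors multiply exactly, so only the sum of the squared weights
      matters.\<close>
    have L: "?L n = (\<Prod>i<n. complex_of_real (exp (- (\<sigma>2 * (a n i)\<^sup>2 / 2))))"
    proof -
      have "- (\<sigma>2 * (\<Sum>i<n. (a n i)\<^sup>2) / 2) = (\<Sum>i<n. - (\<sigma>2 * (a n i)\<^sup>2 / 2))"
        unfolding sum_negf sum_divide_distrib[symmetric] sum_distrib_left[symmetric] ..
      then show ?thesis by (simp only: exp_sum[OF finite_lessThan] of_real_prod)
    qed
    have "cmod (expectation (\<lambda>\<omega>. iexp (\<Sum>i<n. a n i * \<epsilon> i \<omega>)) - ?L n) \<le>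
       (\<Sum>i<n. cmod (char (distr M borel (\<epsilon> i)) (a n i) - complex_of_real (exp (- (\<sigma>2 * (a n i)\<^sup>2 / 2)))))"
      unfolding fact L
    proof (rule norm_prod_diff)
      show "cmod (char (distr M borel (\<epsilon> i)) (a n i)) \<le> 1" for i
        by (intro real_distribution.cmod_char_le_1 real_distribution_distr rv)
      show "cmod (complex_of_real (exp (- (\<sigma>2 * (a n i)\<^sup>2 / 2)))) \<le> 1" for i
        unfolding norm_of_real using \<sigma>2 by simp
    qed
    also have "\<dots> \<le> (\<Sum>i<n. (a n i)\<^sup>2 * (m n * (\<sigma>2 + C) + (m n)\<^sup>2 * \<sigma>2\<^sup>2))"
    proof (rule sum_mono)
      fix i assume i: "i \<in> {..<n}"
      have am: "\<bar>a n i\<bar> \<le> m n" using elim i by auto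
      have "(a n i)\<^sup>2 \<le> (m n)\<^sup>2" using am by (metis abs_ge_zero power2_abs power_mono)
      then have "\<bar>a n i\<bar> * (\<sigma>2 + C) + (a n i)\<^sup>2 * \<sigma>2\<^sup>2 \<le> m n * (\<sigma>2 + C) + (m n)\<^sup>2 * \<sigma>2\<^sup>2"
        using am \<sigma>2 C by (intro add_mono mult_right_mono) auto
      then have "(a n i)\<^sup>2 * (\<bar>a n i\<bar> * (\<sigma>2 + C) + (a n i)\<^sup>2 * \<sigma>2\<^sup>2) \<le> (a n i)\<^sup>2 * (m n * (\<sigma>2 + C) + (m n)\<^sup>2 * \<sigma>2\<^sup>2)"
        by (intro mult_left_mono) auto
      then show "cmod (char (distr M borel (\<epsilon> i)) (a n i) - complex_of_real (exp (- (\<sigma>2 * (a n i)\<^sup>2 / 2)))) \<le> (a n i)\<^sup>2 * (m n * (\<sigma>2 + C) + (m n)\<^sup>2 * \<sigma>2\<^sup>2)"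
        using step[of i "a n i"] by linarith
    qed
    also have "\<dots> = (\<Sum>i<n. (a n i)\<^sup>2) * (m n * (\<sigma>2 + C) + (m n)\<^sup>2 * \<sigma>2\<^sup>2)"
      by (simp add: sum_distrib_right)
    finally show ?case .
  qed
  have "(\<lambda>n. (\<Sum>i<n. (a n i)\<^sup>2) * (m n * (\<sigma>2 + C) + (m n)\<^sup>2 * \<sigma>2\<^sup>2)) \<longlonglongrightarrow> v * (0 * (\<sigma>2 + C) + 0\<^sup>2 * \<sigma>2\<^sup>2)"
    by (intro tendsto_intros a_sq m)
  then have diff: "(\<lambda>n. expectation (\<lambda>\<omega>. iexp (\<Sum>i<n. a n i * \<epsilon> i \<omega>)) - ?L n) \<longlonglongrightarrow> 0"
    by (intro Lim_null_comparison[OF bound]) simp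
  have "?L \<longlonglongrightarrow> complex_of_real (exp (- (\<sigma>2 * v / 2)))"
    by (intro tendsto_intros a_sq) auto
  with diff show ?thesis
    by (rule Lim_transform[rotated])
qed

lemma cmod_iexp_diff_le: "cmod (iexp x - iexp y) \<le> \<bar>x - y\<bar>"
proof -
  have "iexp x - iexp y = iexp y * (iexp (x - y) - 1)"
    by (simp add: algebra_simps exp_add[symmetric])
  then have "cmod (iexp x - iexp y) = cmod (iexp (x - y) - 1)"
    by (simp add: norm_mult del: of_real_diff)
  also have "\<dots> \<le> \<bar>x - y\<bar>" using iexp_approx1[of "x - y" 0] by simp
  finally show ?thesis .
qed

text \<open>No independence of \<open>r n\<close> and \<open>S n\<close> is used. Where
  \<open>r n\<close> is within \<open>\<delta>\<close> of 1 the exponentials differ by at most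
  \<open>\<delta> * |S n|\<close>, hence by at most \<open>\<delta> * (1 + (S n)^2)\<close>, whose
  mean is controlled; elsewhere they differ by at most 2.\<close>

lemma (in prob_space) char_limit_slutsky:
  fixes S r :: "nat \<Rightarrow> 'a \<Rightarrow> real"
  assumes [measurable]: "\<And>n. S n \<in> borel_measurable M" "\<And>n. r n \<in> borel_measurable M"
    and S: "\<forall>\<^sub>F n in sequentially. integrable M (\<lambda>\<omega>. (S n \<omega>)\<^sup>2) \<and> expectation (\<lambda>\<omega>. (S n \<omega>)\<^sup>2) \<le> B"
    and r: "\<And>\<delta>. \<delta> > 0 \<Longrightarrow> (\<lambda>n. prob {\<omega>\<in>space M. \<bar>r n \<omega> - 1\<bar> \<ge> \<delta>}) \<longlonglongrightarrow> 0"
    and lim: "(\<lambda>n. expectation (\<lambda>\<omega>. iexp (S n \<omega>))) \<longlonglongrightarrow> L"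
  shows "(\<lambda>n. expectation (\<lambda>\<omega>. iexp (r n \<omega> * S n \<omega>))) \<longlonglongrightarrow> L"
proof -
  have int: "integrable M (\<lambda>\<omega>. iexp (f \<omega>))" if [measurable]: "f \<in> borel_measurable M" for f
    by (rule integrable_const_bound[where B=1]) auto
  let ?A = "\<lambda>n \<delta>. {\<omega>\<in>space M. \<bar>r n \<omega> - 1\<bar> \<ge> \<delta>}"
  have bound: "cmod (expectation (\<lambda>\<omega>. iexp (r n \<omega> * S n \<omega>)) - expectation (\<lambda>\<omega>. iexp (S n \<omega>))) \<le> \<delta> * (1 + \<bar>B\<bar>) + 2 * prob (?A n \<delta>)"
    if S: "integrable M (\<lambda>\<omega>. (S n \<omega>)\<^sup>2)" "expectation (\<lambda>\<omega>. (S n \<omega>)\<^sup>2) \<le> B" and \<delta>: "\<delta> > 0" for n \<delta>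
  proof -
    have iA: "integrable M (indicator (?A n \<delta>) :: 'a \<Rightarrow> real)"
      by (rule integrable_real_indicator) (auto simp: emeasure_eq_measure)
    have eA: "expectation (indicator (?A n \<delta>)) = prob (?A n \<delta>)"
      by (subst Bochner_Integration.integral_indicator) (auto intro!: arg_cong[where f=prob])
    have "expectation (\<lambda>\<omega>. iexp (r n \<omega> * S n \<omega>)) - expectation (\<lambda>\<omega>. iexp (S n \<omega>)) = expectation (\<lambda>\<omega>. iexp (r n \<omega> * S n \<omega>) - iexp (S n \<omega>))"
      by (subst Bochner_Integration.integral_diff) (auto intro!: int simp del: of_real_mult)
    also have "cmod \<dots> \<le> expectation (\<lambda>\<omega>. cmod (iexp (r n \<omega> * S n \<omega>) - iexp (S n \<omega>)))"
      by (rule integral_norm_bound)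
    also have "\<dots> \<le> expectation (\<lambda>\<omega>. \<delta> * (1 + (S n \<omega>)\<^sup>2) + 2 * indicator (?A n \<delta>) \<omega>)"
    proof (rule integral_mono)
      show "integrable M (\<lambda>\<omega>. cmod (iexp (r n \<omega> * S n \<omega>) - iexp (S n \<omega>)))"
        by (intro integrable_norm Bochner_Integration.integrable_diff int) auto
      show "integrable M (\<lambda>\<omega>. \<delta> * (1 + (S n \<omega>)\<^sup>2) + 2 * indicator (?A n \<delta>) \<omega>)"
        using S iA by (intro Bochner_Integration.integrable_add integrable_mult_right) auto
      fix \<omega> assume \<omega>: "\<omega> \<in> space M"
      show "cmod (iexp (r n \<omega> * S n \<omega>) - iexp (S n \<omega>)) \<le> \<delta> * (1 + (S n \<omega>)\<^sup>2) + 2 * indicator (?A n \<delta>) \<omega>"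
      proof (cases "\<bar>r n \<omega> - 1\<bar> \<ge> \<delta>")
        case True
        have "cmod (iexp (r n \<omega> * S n \<omega>) - iexp (S n \<omega>)) \<le> cmod (iexp (r n \<omega> * S n \<omega>)) + cmod (iexp (S n \<omega>))"
          by (rule norm_triangle_ineq4)
        also have "\<dots> = 2" by (simp del: of_real_mult)
        also have "\<dots> \<le> \<delta> * (1 + (S n \<omega>)\<^sup>2) + 2" using \<delta> by simp
        finally show ?thesis using True \<omega> by simp
      next
        case False
        have "cmod (iexp (r n \<omega> * S n \<omega>) - iexp (S n \<omega>)) \<le> \<bar>r n \<omega> * S n \<omega> - S n \<omega>\<bar>"
          by (rule cmod_iexp_diff_le)
        also have "\<dots> = \<bar>r n \<omega> - 1\<bar> * \<bar>S n \<omega>\<bar>" by (simp add: abs_mult[symmetric] algebra_simps)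
        also have "\<dots> \<le> \<delta> * (1 + (S n \<omega>)\<^sup>2)"
        proof (rule mult_mono)
          have "(\<bar>S n \<omega>\<bar> - 1/2)\<^sup>2 = (S n \<omega>)\<^sup>2 - \<bar>S n \<omega>\<bar> + 1/4"
            by (simp add: power2_diff power_divide)
          then show "\<bar>S n \<omega>\<bar> \<le> 1 + (S n \<omega>)\<^sup>2"
            using zero_le_power2[of "\<bar>S n \<omega>\<bar> - 1/2"] by linarith
        qed (use False \<delta> in auto)
        finally show ?thesis using False by simp
      qed
    qed
    also have "\<dots> = expectation (\<lambda>\<omega>. \<delta> * (1 + (S n \<omega>)\<^sup>2)) + 2 * expectation (indicator (?A n \<delta>))"
      using S iA by (subst Bochner_Integration.integral_add) auto
    also have "\<dots> = \<delta> * (1 + expectation (\<lambda>\<omega>. (S n \<omega>)\<^sup>2)) + 2 * prob (?A n \<delta>)"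
      using S eA by (simp add: prob_space)
    also have "\<dots> \<le> \<delta> * (1 + \<bar>B\<bar>) + 2 * prob (?A n \<delta>)"
      using S \<delta> by (intro add_right_mono mult_left_mono) auto
    finally show ?thesis .
  qed
  have "(\<lambda>n. expectation (\<lambda>\<omega>. iexp (r n \<omega> * S n \<omega>)) - expectation (\<lambda>\<omega>. iexp (S n \<omega>))) \<longlonglongrightarrow> 0"
  proof (rule tendstoI)
    fix e :: real assume e: "e > 0"
    \<comment> \<open>Half of \<open>e\<close> is reserved for the term with small deviation; the
      exceptional event, of probability below \<open>e / 4\<close>, enters with the factor
      2.\<close>
    define \<delta> where "\<delta> = e / 2 / (1 + \<bar>B\<bar>)"
    have \<delta>: "\<delta> > 0" "\<delta> * (1 + \<bar>B\<bar>) = e / 2" using e by (auto simp: \<delta>_def add_pos_nonneg field_simps)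
    have "\<forall>\<^sub>F n in sequentially. prob (?A n \<delta>) < e / 4"
      using order_tendstoD(2)[OF r[OF \<delta>(1)], of "e/4"] e by simp
    with S show "\<forall>\<^sub>F n in sequentially. dist (expectation (\<lambda>\<omega>. iexp (r n \<omega> * S n \<omega>)) - expectation (\<lambda>\<omega>. iexp (S n \<omega>))) 0 < e"
    proof eventually_elim
      case (elim n)
      then show ?case using bound[of n \<delta>] \<delta> by (simp add: dist_norm)
    qed
  qed
  with lim show ?thesis by (rule Lim_transform)
qed

section \<open>Standard normal quantiles\<close>

lemma emeasure_std_normal_singleton: "emeasure std_normal_distribution {x} = 0"
proof -
  have "AE y in lborel. y \<noteq> x" by (rule AE_lborel_singleton)
  then have "AE y in lborel. ennreal (std_normal_density y) * indicator {x} y = 0"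
    by (rule eventually_mono) (auto split: split_indicator)
  then have "(\<integral>\<^sup>+y. ennreal (std_normal_density y) * indicator {x} y \<partial>lborel) = 0"
    by (subst nn_integral_0_iff_AE) auto
  then show ?thesis by (simp add: emeasure_density)
qed

lemma emeasure_std_normal_finite:
  assumes "finite F" shows "emeasure std_normal_distribution F = 0"
  using assms
proof (induction F rule: finite_induct)
  case (insert x F)
  have "emeasure std_normal_distribution ({x} \<union> F) \<le> emeasure std_normal_distribution {x} + emeasure std_normal_distribution F"
    by (rule emeasure_subadditive) (use insert in \<open>auto intro: borel_closed finite_imp_closed\<close>)
  then show ?case using insert emeasure_std_normal_singleton[of x] by simp
qed simp

lemma Phi_eq_cdf: "Phi = cdf std_normal_distribution"
  by (rule ext) (simp add: Phi_def cdf_def2)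

text \<open>Strictness makes the quantile unique and hence determines the \<open>THE\<close> in
  \<open>zq\<close>.\<close>

lemma Phi_strict_mono: "x < y \<Longrightarrow> Phi x < Phi y"
proof -
  assume xy: "x < y"
  interpret N: real_distribution std_normal_distribution by (rule real_dist_normal_dist)
  have "Phi y = Phi x + measure std_normal_distribution {x<..y}"
    unfolding Phi_def using xy
    by (subst N.finite_measure_Union[symmetric]) (auto intro!: arg_cong[where f="measure std_normal_distribution"])
  moreover have "emeasure std_normal_distribution {x<..y} \<noteq> 0"
  proof
    assume "emeasure std_normal_distribution {x<..y} = 0"
    then have "(\<integral>\<^sup>+w. ennreal (std_normal_density w) * indicator {x<..y} w \<partial>lborel) = 0"
      by (simp add: emeasure_density)
    then have "emeasure lborel {w \<in> space lborel. ennreal (std_normal_density w) * indicator {x<..y} w \<noteq> 0} = 0"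
      by (subst (asm) nn_integral_0_iff) auto
    moreover have "{w \<in> space lborel. ennreal (std_normal_density w) * indicator {x<..y} w \<noteq> 0} = {x<..y}"
      using normal_density_pos[of 1 0] by (auto split: split_indicator simp: not_le less_imp_neq[symmetric])
    ultimately show False using xy by simp
  qed
  ultimately show ?thesis
    by (simp add: N.emeasure_eq_measure zero_less_measure_iff)
qed

lemma std_normal_symmetric: "measure std_normal_distribution {..-z} = measure std_normal_distribution {z..}"
proof -
  have "emeasure std_normal_distribution {..-z} = (\<integral>\<^sup>+w. ennreal (std_normal_density w) * indicator {..-z} w \<partial>lborel)"
    by (simp add: emeasure_density)
  also have "\<dots> = (\<integral>\<^sup>+w. ennreal (std_normal_density (-w)) * indicator {..-z} (-w) \<partial>lborel)"
    by (subst nn_integral_real_affine[where c="-1" and t=0]) auto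
  also have "\<dots> = (\<integral>\<^sup>+w. ennreal (std_normal_density w) * indicator {z..} w \<partial>lborel)"
    by (intro nn_integral_cong) (auto simp: std_normal_density_def split: split_indicator)
  also have "\<dots> = emeasure std_normal_distribution {z..}"
    by (simp add: emeasure_density)
  finally show ?thesis by (simp add: measure_def)
qed

text \<open>By symmetry \<open>Phi 0 = 1 / 2\<close>, which is below \<open>1 - a / 2\<close>, so
  the intermediate value theorem gives a positive quantile, and strict monotonicity makes it the
  only one. Each of the two tails beyond it has mass \<open>a / 2\<close>.\<close>

lemma zq_half:
  assumes a: "0 < a" "a < 1"
  obtains z where "z > 0" "zq (a / 2) = ereal z"
    "measure std_normal_distribution {w. z \<le> \<bar>w\<bar>} = a"
    "measure std_normal_distribution {w. \<bar>w\<bar> < z} = 1 - a"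
proof -
  interpret N: real_distribution std_normal_distribution by (rule real_dist_normal_dist)
  have meas0: "measure std_normal_distribution {x} = 0" for x
    using emeasure_std_normal_singleton[of x] by (simp add: measure_def)
  have upper: "measure std_normal_distribution {z..} = 1 - Phi z" for z
  proof -
    have "measure std_normal_distribution ({..z} \<union> {z<..}) = Phi z + measure std_normal_distribution {z<..}"
      unfolding Phi_def by (rule N.finite_measure_Union) auto
    moreover have "{..z} \<union> {z<..} = space std_normal_distribution" by auto
    moreover have "measure std_normal_distribution ({z} \<union> {z<..}) = measure std_normal_distribution {z} + measure std_normal_distribution {z<..}"
      by (rule N.finite_measure_Union) auto
    moreover have "{z} \<union> {z<..} = {z..}" by auto
    ultimately show ?thesis using N.prob_space meas0 by simp
  qed
  have Phi0: "Phi 0 = 1 / 2"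
    using upper[of 0] std_normal_symmetric[of 0] by (simp add: Phi_def)
  have cont: "isCont Phi x" for x
    unfolding Phi_eq_cdf N.isCont_cdf by (rule meas0)
  have "(Phi \<longlongrightarrow> 1) at_top"
    unfolding Phi_eq_cdf by (rule N.cdf_lim_at_top_prob)
  then have "\<forall>\<^sub>F b in at_top. 1 - a / 2 < Phi b"
    by (rule order_tendstoD) (use a in auto)
  then obtain b0 where b0: "\<And>b. b \<ge> b0 \<Longrightarrow> 1 - a / 2 < Phi b"
    unfolding eventually_at_top_linorder by auto
  define b where "b = max 0 b0"
  have "\<exists>z\<ge>0. z \<le> b \<and> Phi z = 1 - a / 2"
    by (rule IVT) (use cont Phi0 a b0[of b] in \<open>auto simp: b_def\<close>)
  then obtain z where z: "z \<ge> 0" "Phi z = 1 - a / 2" by auto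
  have "z \<noteq> 0" using z a Phi0 by auto
  then have zpos: "z > 0" using z by simp
  have uniq: "x = z" if "Phi x = 1 - a / 2" for x
    using Phi_strict_mono[of x z] Phi_strict_mono[of z x] that z by (cases x z rule: linorder_cases) auto
  have zq: "zq (a / 2) = ereal z"
  proof -
    have "(THE x. Phi x = 1 - a / 2) = z" by (rule the_equality[of "\<lambda>x. Phi x = 1 - a / 2", OF z(2) uniq])
    then show ?thesis unfolding zq_def using a by simp
  qed
  have eq: "{w. z \<le> \<bar>w\<bar>} = {..-z} \<union> {z..}" by (auto simp: abs_if)
  have "measure std_normal_distribution ({..-z} \<union> {z..}) = measure std_normal_distribution {..-z} + measure std_normal_distribution {z..}"
    by (rule N.finite_measure_Union) (use zpos in auto)
  then have out: "measure std_normal_distribution {w. z \<le> \<bar>w\<bar>} = a"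
    unfolding eq std_normal_symmetric upper using z by simp
  have "measure std_normal_distribution (space std_normal_distribution - {w. z \<le> \<bar>w\<bar>}) = 1 - a"
    using N.prob_compl[of "{w. z \<le> \<bar>w\<bar>}"] out unfolding eq by simp
  moreover have "space std_normal_distribution - {w. z \<le> \<bar>w\<bar>} = {w. \<bar>w\<bar> < z}" by auto
  ultimately show ?thesis using that[OF zpos zq out] by simp
qed

lemma frontier_abs_less: "frontier {w::real. \<bar>w\<bar> < z} \<subseteq> {-z, z}"
proof -
  have eq: "{w::real. \<bar>w\<bar> < z} = {-z<..<z}" by auto
  have "closure {-z<..<z} \<subseteq> {-z..z}" by (rule closure_minimal) auto
  then show ?thesis unfolding eq frontier_def by (auto simp: interior_open)
qed

lemma frontier_abs_ge: "frontier {w::real. z \<le> \<bar>w\<bar>} \<subseteq> {-z, z}"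
proof -
  have "{w::real. z \<le> \<bar>w\<bar>} = - {w. \<bar>w\<bar> < z}" by auto
  then show ?thesis using frontier_abs_less[of z] by (simp add: frontier_complement)
qed


section \<open>Least squares\<close>

text \<open>For square matrices a right inverse is also a left inverse, hence unique; this gives the
  \<open>THE\<close> in \<open>minv\<close> its value.\<close>

lemma minv_eqI:
  assumes A: "A \<in> carrier_mat k k" and B: "B \<in> carrier_mat k k" and AB: "A * B = 1\<^sub>m k"
  shows "minv A = B"
  unfolding minv_def
proof (rule the_equality)
  show "B \<in> carrier_mat (dim_row A) (dim_row A) \<and> A * B = 1\<^sub>m (dim_row A)" using A B AB by auto
  fix C assume C: "C \<in> carrier_mat (dim_row A) (dim_row A) \<and> A * C = 1\<^sub>m (dim_row A)"
  then have C': "C \<in> carrier_mat k k" "A * C = 1\<^sub>m k" using A by auto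
  have BA: "B * A = 1\<^sub>m k" by (rule mat_mult_left_right_inverse[OF A B AB])
  have "C = (B * A) * C" unfolding BA using C' by simp
  also have "\<dots> = B * (A * C)" by (rule assoc_mult_mat[OF B A C'(1)])
  also have "\<dots> = B" unfolding C'(2) using B by simp
  finally show "C = B" .
qed

text \<open>A nonzero kernel vector \<open>v\<close> would make the form \<open>v A v\<close>
  vanish, so the determinant is nonzero.\<close>

lemma minv_pos_def:
  assumes A: "A \<in> carrier_mat k k" and pd: "pos_def_mat A"
  shows "minv A \<in> carrier_mat k k" "A * minv A = 1\<^sub>m k" "minv A * A = 1\<^sub>m k"
proof -
  have "det A \<noteq> 0"
  proof
    assume "det A = 0"
    then obtain v where v: "v \<in> carrier_vec k" "v \<noteq> 0\<^sub>v k" "A *\<^sub>v v = 0\<^sub>v k"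
      using det_0_iff_vec_prod_zero[OF A] by auto
    then have "scalar_prod v (A *\<^sub>v v) > 0" using pd A unfolding pos_def_mat_def by auto
    then show False using v by simp
  qed
  from det_non_zero_imp_unit[OF A this, of "()"]
  obtain B where B: "B \<in> carrier_mat k k" "A * B = 1\<^sub>m k" "B * A = 1\<^sub>m k"
    unfolding Units_def ring_mat_def by auto
  have "minv A = B" by (rule minv_eqI[OF A B(1,2)])
  then show "minv A \<in> carrier_mat k k" "A * minv A = 1\<^sub>m k" "minv A * A = 1\<^sub>m k" using B by auto
qed

lemma minv_smult:
  assumes A: "A \<in> carrier_mat k k" and pd: "pos_def_mat A" and c: "c \<noteq> 0"
  shows "minv (c \<cdot>\<^sub>m A) = (1 / c) \<cdot>\<^sub>m minv A"
proof (rule minv_eqI)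
  note B = minv_pos_def[OF A pd]
  have "(c \<cdot>\<^sub>m A) * ((1 / c) \<cdot>\<^sub>m minv A) = c \<cdot>\<^sub>m ((1 / c) \<cdot>\<^sub>m (A * minv A))"
    using mult_smult_assoc_mat[OF A smult_carrier_mat[OF B(1)], of c "1 / c"] mult_smult_distrib[OF A B(1), of "1 / c"] by simp
  also have "\<dots> = 1\<^sub>m k" unfolding B(2) using c by (intro eq_matI) auto
  finally show "(c \<cdot>\<^sub>m A) * ((1 / c) \<cdot>\<^sub>m minv A) = 1\<^sub>m k" .
qed (use A minv_pos_def[OF A pd] in auto)

lemma gram_index:
  assumes X: "X \<in> carrier_mat n K" and "i < K" "j < K"
  shows "(transpose_mat X * X) $$ (i, j) = (\<Sum>l<n. X $$ (l, i) * X $$ (l, j))"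
  using assms by (simp add: scalar_prod_def atLeast0LessThan)

text \<open>The identity \<open>|x v|^2 = v (x^t x) v\<close>, kept free of matrices because it is
  applied to the columns of a design as well as to a family of contrasts.\<close>

lemma sum_swap_gram:
  fixes x :: "'i \<Rightarrow> 'j \<Rightarrow> real"
  shows "(\<Sum>i\<in>I. (\<Sum>j\<in>J. x i j * v j)\<^sup>2) = (\<Sum>j\<in>J. v j * (\<Sum>l\<in>J. (\<Sum>i\<in>I. x i j * x i l) * v l))"
proof -
  have "(\<Sum>i\<in>I. (\<Sum>j\<in>J. x i j * v j)\<^sup>2) = (\<Sum>i\<in>I. \<Sum>j\<in>J. \<Sum>l\<in>J. v j * (x i j * x i l * v l))"
    by (simp add: power2_eq_square sum_product mult_ac)
  also have "\<dots> = (\<Sum>j\<in>J. \<Sum>i\<in>I. \<Sum>l\<in>J. v j * (x i j * x i l * v l))" by (rule sum.swap)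
  also have "\<dots> = (\<Sum>j\<in>J. \<Sum>l\<in>J. \<Sum>i\<in>I. v j * (x i j * x i l * v l))"
    by (intro sum.cong refl sum.swap)
  also have "\<dots> = (\<Sum>j\<in>J. v j * (\<Sum>l\<in>J. (\<Sum>i\<in>I. x i j * x i l) * v l))"
    by (simp add: sum_distrib_left sum_distrib_right)
  finally show ?thesis .
qed

lemma quadratic_form_vec:
  assumes A: "A \<in> carrier_mat k k"
  shows "scalar_prod (Matrix.vec k v) (A *\<^sub>v Matrix.vec k v) = (\<Sum>i<k. v i * (\<Sum>j<k. A $$ (i, j) * v j))"
  using A by (simp add: scalar_prod_def atLeast0LessThan)

text \<open>Vectors become functions of which only the values below \<open>k\<close> count, so that
  later arguments can pad, rescale and subtract without carrier conditions.\<close>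

lemma pos_def_mat_iff:
  assumes A: "A \<in> carrier_mat k k"
  shows "pos_def_mat A \<longleftrightarrow> transpose_mat A = A \<and>
    (\<forall>v. (\<exists>j<k. v j \<noteq> 0) \<longrightarrow> 0 < (\<Sum>i<k. v i * (\<Sum>j<k. A $$ (i, j) * v j)))"
proof -
  have "(\<forall>v \<in> carrier_vec k. v \<noteq> 0\<^sub>v k \<longrightarrow> scalar_prod v (A *\<^sub>v v) > 0) \<longleftrightarrow>
    (\<forall>v. (\<exists>j<k. v j \<noteq> 0) \<longrightarrow> 0 < (\<Sum>i<k. v i * (\<Sum>j<k. A $$ (i, j) * v j)))" (is "?L = ?R")
  proof
    assume L: ?L
    show ?R
    proof (intro allI impI)
      fix v :: "nat \<Rightarrow> real" assume "\<exists>j<k. v j \<noteq> 0"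
      then have "Matrix.vec k v \<noteq> 0\<^sub>v k" by (metis index_vec index_zero_vec(1))
      then show "0 < (\<Sum>i<k. v i * (\<Sum>j<k. A $$ (i, j) * v j))"
        using L quadratic_form_vec[OF A, of v] by auto
    qed
  next
    assume R: ?R
    show ?L
    proof (intro ballI impI)
      fix v :: "real Matrix.vec" assume v: "v \<in> carrier_vec k" "v \<noteq> 0\<^sub>v k"
      have "\<exists>j<k. v $ j \<noteq> 0"
      proof (rule ccontr)
        assume "\<not> (\<exists>j<k. v $ j \<noteq> 0)"
        then have "v = 0\<^sub>v k" using v(1) by (intro eq_vecI) auto
        then show False using v by simp
      qed
      then have "0 < (\<Sum>i<k. v $ i * (\<Sum>j<k. A $$ (i, j) * v $ j))" using R by blast
      moreover have "Matrix.vec k (\<lambda>i. v $ i) = v" using v(1) by (intro eq_vecI) auto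
      ultimately show "scalar_prod v (A *\<^sub>v v) > 0" using quadratic_form_vec[OF A, of "\<lambda>i. v $ i"] by simp
    qed
  qed
  then show ?thesis using A unfolding pos_def_mat_def by auto
qed

lemma pos_def_gram_iff:
  assumes X: "X \<in> carrier_mat n K"
  shows "pos_def_mat (transpose_mat X * X) \<longleftrightarrow>
    (\<forall>v. (\<exists>j<K. v j \<noteq> 0) \<longrightarrow> 0 < (\<Sum>i<n. (\<Sum>j<K. X $$ (i, j) * v j)\<^sup>2))"
proof -
  have G: "transpose_mat X * X \<in> carrier_mat K K" using X by simp
  have sym: "transpose_mat (transpose_mat X * X) = transpose_mat X * X"
    using X by (simp add: transpose_mult[of _ K n _ K])
  have "(\<Sum>i<K. v i * (\<Sum>j<K. (transpose_mat X * X) $$ (i, j) * v j)) = (\<Sum>i<n. (\<Sum>j<K. X $$ (i, j) * v j)\<^sup>2)" for v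
    unfolding sum_swap_gram using gram_index[OF X] by simp
  then show ?thesis unfolding pos_def_mat_iff[OF G] using sym by simp
qed

lemma first_cols_carrier: "X \<in> carrier_mat n K \<Longrightarrow> first_cols X k \<in> carrier_mat n k"
  by (simp add: first_cols_def)

lemma first_cols_index: "X \<in> carrier_mat n K \<Longrightarrow> i < n \<Longrightarrow> j < k \<Longrightarrow> first_cols X k $$ (i, j) = X $$ (i, j)"
  by (simp add: first_cols_def)

text \<open>Coefficients on the first \<open>k\<close> columns are padded with zeros to coefficients
  on all columns.\<close>

lemma pos_def_first_cols:
  assumes X: "X \<in> carrier_mat n K" and pd: "pos_def_mat (transpose_mat X * X)" and k: "k \<le> K"
  shows "pos_def_mat (transpose_mat (first_cols X k) * first_cols X k)"
  unfolding pos_def_gram_iff[OF first_cols_carrier[OF X]]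
proof (intro allI impI)
  fix v :: "nat \<Rightarrow> real" assume v: "\<exists>j<k. v j \<noteq> 0"
  define v' where "v' j = (if j < k then v j else 0)" for j
  have "\<exists>j<K. v' j \<noteq> 0" using v k unfolding v'_def by (metis order_less_le_trans)
  then have "0 < (\<Sum>i<n. (\<Sum>j<K. X $$ (i, j) * v' j)\<^sup>2)"
    using pd unfolding pos_def_gram_iff[OF X] by blast
  also have "\<dots> = (\<Sum>i<n. (\<Sum>j<k. first_cols X k $$ (i, j) * v j)\<^sup>2)"
  proof (rule sum.cong[OF refl])
    fix i assume i: "i \<in> {..<n}"
    have "(\<Sum>j<K. X $$ (i, j) * v' j) = (\<Sum>j<k. X $$ (i, j) * v' j)"
      by (rule sum.mono_neutral_right) (use k in \<open>auto simp: v'_def\<close>)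
    also have "\<dots> = (\<Sum>j<k. first_cols X k $$ (i, j) * v j)"
      using i by (intro sum.cong refl) (auto simp: v'_def first_cols_index[OF X])
    finally show "(\<Sum>j<K. X $$ (i, j) * v' j)\<^sup>2 = (\<Sum>j<k. first_cols X k $$ (i, j) * v j)\<^sup>2" by simp
  qed
  finally show "0 < (\<Sum>i<n. (\<Sum>j<k. first_cols X k $$ (i, j) * v j)\<^sup>2)" .
qed

section \<open>Coordinates of the least squares estimators and contrasts\<close>

lemma ols_carrier:
  assumes X: "X \<in> carrier_mat n K" and pd: "pos_def_mat (transpose_mat X * X)"
  shows "ols X y \<in> carrier_vec K"
proof -
  have G: "transpose_mat X * X \<in> carrier_mat K K" using X by simp
  show ?thesis unfolding ols_def carrier_vec_def using minv_pos_def(1)[OF G pd] by simp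
qed

lemma ols_index:
  assumes X: "X \<in> carrier_mat n K" and pd: "pos_def_mat (transpose_mat X * X)"
    and y: "y \<in> carrier_vec n" and k: "k < K"
  shows "ols X y $ k = (\<Sum>i<n. (\<Sum>j<K. minv (transpose_mat X * X) $$ (k, j) * X $$ (i, j)) * y $ i)"
proof -
  have G: "transpose_mat X * X \<in> carrier_mat K K" using X by simp
  note B = minv_pos_def(1)[OF G pd]
  have "ols X y $ k = (\<Sum>j<K. minv (transpose_mat X * X) $$ (k, j) * (\<Sum>i<n. X $$ (i, j) * y $ i))"
    unfolding ols_def using X y B k by (simp add: scalar_prod_def atLeast0LessThan)
  also have "\<dots> = (\<Sum>j<K. \<Sum>i<n. minv (transpose_mat X * X) $$ (k, j) * X $$ (i, j) * y $ i)"
    by (simp add: sum_distrib_left mult_ac)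
  also have "\<dots> = (\<Sum>i<n. \<Sum>j<K. minv (transpose_mat X * X) $$ (k, j) * X $$ (i, j) * y $ i)"
    by (rule sum.swap)
  finally show ?thesis by (simp add: sum_distrib_right)
qed

lemma ols_normal_equations:
  assumes X: "X \<in> carrier_mat n K" and pd: "pos_def_mat (transpose_mat X * X)"
    and y: "y \<in> carrier_vec n" and k: "k < K"
  shows "(\<Sum>i<n. X $$ (i, k) * (y $ i - (X *\<^sub>v ols X y) $ i)) = 0"
proof -
  have G: "transpose_mat X * X \<in> carrier_mat K K" using X by simp
  note B = minv_pos_def[OF G pd]
  have b: "ols X y \<in> carrier_vec K" by (rule ols_carrier[OF X pd])
  have Xt: "transpose_mat X \<in> carrier_mat K n" using X by simp
  have Xy: "transpose_mat X *\<^sub>v y \<in> carrier_vec K" by (rule mult_mat_vec_carrier[OF Xt y])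
  have "transpose_mat X *\<^sub>v (X *\<^sub>v ols X y) = (transpose_mat X * X) *\<^sub>v ols X y"
    by (rule assoc_mult_mat_vec[OF Xt X b, symmetric])
  also have "\<dots> = ((transpose_mat X * X) * minv (transpose_mat X * X)) *\<^sub>v (transpose_mat X *\<^sub>v y)"
    unfolding ols_def by (rule assoc_mult_mat_vec[OF G B(1) Xy, symmetric])
  also have "\<dots> = transpose_mat X *\<^sub>v y" unfolding B(2) using Xy by simp
  finally have "(transpose_mat X *\<^sub>v (X *\<^sub>v ols X y)) $ k = (transpose_mat X *\<^sub>v y) $ k" by simp
  then have "(\<Sum>i<n. X $$ (i, k) * (X *\<^sub>v ols X y) $ i) = (\<Sum>i<n. X $$ (i, k) * y $ i)"
    using X y k by (simp add: scalar_prod_def atLeast0LessThan)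
  then show ?thesis by (simp add: right_diff_distrib sum_subtractf)
qed

text \<open>Before normalisation, the diagonal entry \<open>b (k - 1)\<close> of the inverse Gram
  matrix has three roles: it is the squared norm of \<open>c\<close>, the coefficient of the last
  column in \<open>c\<close>, and, up to the factor \<open>n\<close>, the quantity
  \<open>s_sub X k\<close>. Dividing \<open>c\<close> by \<open>s = sqrt (b (k - 1))\<close>
  therefore cancels both \<open>sqrt n\<close> and \<open>sqrt (s_sub X k)\<close> in
  \<open>Z_tilde\<close>. The fourth conclusion ties the coefficient of the last column to its inner
  product with \<open>q\<close>: an upper bound on the coefficients becomes a lower bound on the
  drift.\<close>

lemma Z_tilde_contrast:
  assumes X: "X \<in> carrier_mat n K" and pd: "pos_def_mat (transpose_mat X * X)" and n: "n > 0"
    and k: "1 \<le> k" "k \<le> K"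
  obtains q b where "\<And>i. i < n \<Longrightarrow> q i = (\<Sum>j<k. b j * X $$ (i, j))"
    "(\<Sum>i<n. (q i)\<^sup>2) = 1"
    "\<And>j. j < k - 1 \<Longrightarrow> (\<Sum>i<n. q i * X $$ (i, j)) = 0"
    "b (k - 1) * (\<Sum>i<n. q i * X $$ (i, k - 1)) = 1"
    "\<And>y. y \<in> carrier_vec n \<Longrightarrow> Z_tilde X y k = (\<Sum>i<n. q i * y $ i) / sigma_hat X y"
proof -
  define V where "V = first_cols X k"
  have V: "V \<in> carrier_mat n k" unfolding V_def by (rule first_cols_carrier[OF X])
  have Vi: "V $$ (i, j) = X $$ (i, j)" if "i < n" "j < k" for i j
    unfolding V_def using first_cols_index[OF X] that by simp
  define G where "G = transpose_mat V * V"
  have G: "G \<in> carrier_mat k k" using V by (simp add: G_def)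
  have pdG: "pos_def_mat G" unfolding G_def V_def by (rule pos_def_first_cols[OF X pd k(2)])
  note B = minv_pos_def[OF G pdG]
  define b where "b j = minv G $$ (k - 1, j)" for j
  define c where "c i = (\<Sum>j<k. b j * X $$ (i, j))" for i
  \<comment> \<open>This is row \<open>k - 1\<close> of the product of the inverse Gram matrix with
    the Gram matrix.\<close>
  have cX: "(\<Sum>i<n. c i * X $$ (i, j)) = (if j = k - 1 then 1 else 0)" if j: "j < k" for j
  proof -
    have "(\<Sum>i<n. c i * X $$ (i, j)) = (\<Sum>i<n. \<Sum>l<k. b l * (X $$ (i, l) * X $$ (i, j)))"
      unfolding c_def sum_distrib_right by (simp add: mult_ac)
    also have "\<dots> = (\<Sum>l<k. \<Sum>i<n. b l * (X $$ (i, l) * X $$ (i, j)))" by (rule sum.swap)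
    also have "\<dots> = (\<Sum>l<k. b l * G $$ (l, j))"
      unfolding G_def using j by (intro sum.cong refl) (simp add: gram_index[OF V] sum_distrib_left Vi)
    also have "\<dots> = (minv G * G) $$ (k - 1, j)"
      using G B(1) j k by (simp add: b_def scalar_prod_def atLeast0LessThan)
    also have "\<dots> = (if j = k - 1 then 1 else 0)" unfolding B(3) using j k by auto
    finally show ?thesis .
  qed
  \<comment> \<open>When one factor is expanded in the columns, only the last column has a nonzero
    product with \<open>c\<close>.\<close>
  have cc: "(\<Sum>i<n. (c i)\<^sup>2) = b (k - 1)"
  proof -
    have "(\<Sum>i<n. (c i)\<^sup>2) = (\<Sum>i<n. \<Sum>j<k. b j * (c i * X $$ (i, j)))"
    proof (rule sum.cong)
      fix i
      have "(c i)\<^sup>2 = c i * (\<Sum>j<k. b j * X $$ (i, j))" by (simp add: power2_eq_square c_def)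
      then show "(c i)\<^sup>2 = (\<Sum>j<k. b j * (c i * X $$ (i, j)))" by (simp add: sum_distrib_left mult_ac)
    qed simp
    also have "\<dots> = (\<Sum>j<k. b j * (\<Sum>i<n. c i * X $$ (i, j)))"
      unfolding sum_distrib_left by (rule sum.swap)
    also have "\<dots> = (\<Sum>j<k. if j = k - 1 then b j else 0)"
      by (intro sum.cong refl) (auto simp: cX)
    also have "\<dots> = b (k - 1)" using k by simp
    finally show ?thesis .
  qed
  have bpos: "b (k - 1) > 0"
  proof (rule ccontr)
    assume "\<not> b (k - 1) > 0"
    then have "(\<Sum>i<n. (c i)\<^sup>2) = 0" using cc sum_nonneg[of "{..<n}" "\<lambda>i. (c i)\<^sup>2"] by auto
    then have "\<forall>i<n. c i = 0" by (simp add: sum_nonneg_eq_0_iff)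
    then have "(\<Sum>i<n. c i * X $$ (i, k - 1)) = 0" by simp
    then show False using cX[of "k - 1"] k by simp
  qed
  define s where "s = sqrt (b (k - 1))"
  have s: "s > 0" "s\<^sup>2 = b (k - 1)" using bpos by (auto simp: s_def)
  show ?thesis
  proof (rule that[of "\<lambda>i. c i / s" "\<lambda>j. b j / s"])
    show "c i / s = (\<Sum>j<k. b j / s * X $$ (i, j))" if "i < n" for i
      by (simp add: c_def sum_divide_distrib)
    show "(\<Sum>i<n. (c i / s)\<^sup>2) = 1"
      using bpos by (simp add: power_divide s(2) sum_divide_distrib[symmetric] cc)
    show "(\<Sum>i<n. c i / s * X $$ (i, j)) = 0" if "j < k - 1" for j
      using cX[of j] that by (simp add: sum_divide_distrib[symmetric])
    have "(\<Sum>i<n. c i / s * X $$ (i, k - 1)) = 1 / s"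
      using cX[of "k - 1"] k by (simp add: sum_divide_distrib[symmetric])
    then show "b (k - 1) / s * (\<Sum>i<n. c i / s * X $$ (i, k - 1)) = 1"
      using s bpos by (simp add: power2_eq_square)
    fix y :: "real Matrix.vec" assume y: "y \<in> carrier_vec n"
    have o: "ols V y $ (k - 1) = (\<Sum>i<n. c i * y $ i)"
      using ols_index[OF V _ y, of "k - 1"] pdG k unfolding G_def c_def b_def by (simp add: Vi)
    have dims: "dim_row X = n" "dim_col X = K" using X by auto
    have ss: "s_sub X k = real n * s\<^sup>2"
      unfolding s_sub_def V_def[symmetric] dims G_def[symmetric]
      using minv_smult[OF G pdG, of "1 / real n"] n B(1) k by (simp add: s(2) b_def)
    have "Z_tilde X y k = sqrt (real n) * (\<Sum>i<n. c i * y $ i) / (sigma_hat X y * (sqrt (real n) * s))"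
      unfolding Z_tilde_def dims ss V_def[symmetric] o using k s(1) by (simp add: real_sqrt_mult)
    also have "\<dots> = (\<Sum>i<n. c i / s * y $ i) / sigma_hat X y"
      using n s by (simp add: sum_divide_distrib[symmetric])
    finally show "Z_tilde X y k = (\<Sum>i<n. c i / s * y $ i) / sigma_hat X y" .
  qed
qed

lemma orthonormal_design:
  assumes X: "X \<in> carrier_mat n K" and n: "n > 0"
    and I: "(1 / real n) \<cdot>\<^sub>m (transpose_mat X * X) = 1\<^sub>m K"
    and y: "y \<in> carrier_vec n" and k: "k < K"
  shows "ols X y $ k = (\<Sum>i<n. X $$ (i, k) * y $ i) / real n"
    and "minv ((1 / real n) \<cdot>\<^sub>m (transpose_mat X * X)) $$ (k, k) = 1"
proof -
  have G: "transpose_mat X * X \<in> carrier_mat K K" using X by simp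
  have id: "minv (1\<^sub>m K) = 1\<^sub>m K" by (rule minv_eqI[of _ K]) auto
  then show "minv ((1 / real n) \<cdot>\<^sub>m (transpose_mat X * X)) $$ (k, k) = 1" unfolding I using k by simp
  have "minv (transpose_mat X * X) = (1 / real n) \<cdot>\<^sub>m 1\<^sub>m K"
  proof (rule minv_eqI[OF G])
    show "transpose_mat X * X * ((1 / real n) \<cdot>\<^sub>m 1\<^sub>m K) = 1\<^sub>m K"
      using I right_mult_one_mat[OF G] mult_smult_distrib[OF G one_carrier_mat[of K], of "1 / real n"] by simp
  qed simp
  then have "ols X y = ((1 / real n) \<cdot>\<^sub>m 1\<^sub>m K) *\<^sub>v (transpose_mat X *\<^sub>v y)" by (simp add: ols_def)
  then have "ols X y $ k = (\<Sum>j<K. (if j = k then 1 / real n * (\<Sum>i<n. X $$ (i, j) * y $ i) else 0))"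
    using X y k by (simp add: scalar_prod_def atLeast0LessThan if_distrib[of "\<lambda>x. x * _"] if_distrib[of "\<lambda>x. x / _"] cong: if_cong)
  then show "ols X y $ k = (\<Sum>i<n. X $$ (i, k) * y $ i) / real n" using k by simp
qed

text \<open>The Gram matrix of the first \<open>k\<close> columns is a leading block of the same
  multiple of the identity, so dropping later regressors changes neither the \<open>k\<close>th
  coefficient nor its variance factor, which is 1 in both fits. Hence the forward and the counting
  estimator rest on the same statistics.\<close>

lemma Z_orthonormal:
  assumes X: "X \<in> carrier_mat n K" and n: "n > 0"
    and I: "(1 / real n) \<cdot>\<^sub>m (transpose_mat X * X) = 1\<^sub>m K"
    and y: "y \<in> carrier_vec n" and k: "1 \<le> k" "k \<le> K"
  shows "Z_tilde X y k = (\<Sum>i<n. X $$ (i, k - 1) / sqrt (real n) * y $ i) / sigma_hat X y"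
    and "Z_hat X y k = Z_tilde X y k"
proof -
  have dims: "dim_row X = n" "dim_col X = K" using X by auto
  have V: "first_cols X k \<in> carrier_mat n k" by (rule first_cols_carrier[OF X])
  have IV: "(1 / real n) \<cdot>\<^sub>m (transpose_mat (first_cols X k) * first_cols X k) = 1\<^sub>m k"
  proof (rule eq_matI)
    fix i j assume ij: "i < dim_row (1\<^sub>m k :: real mat)" "j < dim_col (1\<^sub>m k :: real mat)"
    have "((1 / real n) \<cdot>\<^sub>m (transpose_mat (first_cols X k) * first_cols X k)) $$ (i, j)
        = (1 / real n) * (\<Sum>l<n. first_cols X k $$ (l, i) * first_cols X k $$ (l, j))"
      using ij V gram_index[OF V, of i j] by simp
    also have "\<dots> = (1 / real n) * (\<Sum>l<n. X $$ (l, i) * X $$ (l, j))"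
      using ij by (simp add: first_cols_index[OF X])
    also have "\<dots> = ((1 / real n) \<cdot>\<^sub>m (transpose_mat X * X)) $$ (i, j)"
      using ij k X gram_index[OF X, of i j] by simp
    also have "\<dots> = 1\<^sub>m k $$ (i, j)" unfolding I using ij k by simp
    finally show "((1 / real n) \<cdot>\<^sub>m (transpose_mat (first_cols X k) * first_cols X k)) $$ (i, j) = 1\<^sub>m k $$ (i, j)" .
  qed (use V in auto)
  have k1: "k - 1 < k" "k - 1 < K" using k by auto
  have fin: "sqrt (real n) * (S / real n) / (sg * 1) = S / sqrt (real n) / sg" for S sg :: real
  proof -
    have r: "sqrt (real n) * sqrt (real n) = real n" by simp
    have "sqrt (real n) * (S / real n) = sqrt (real n) * (S / (sqrt (real n) * sqrt (real n)))"
      by (simp only: r)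
    also have "\<dots> = S / sqrt (real n)" using n by (simp del: real_sqrt_mult_self)
    finally show ?thesis by simp
  qed
  have "Z_tilde X y k = sqrt (real n) * ((\<Sum>i<n. X $$ (i, k - 1) * y $ i) / real n) / (sigma_hat X y * 1)"
    unfolding Z_tilde_def s_sub_def dims orthonormal_design(1)[OF V n IV y k1(1)] orthonormal_design(2)[OF V n IV y k1(1)]
    using k by (simp add: first_cols_index[OF X])
  then show *: "Z_tilde X y k = (\<Sum>i<n. X $$ (i, k - 1) / sqrt (real n) * y $ i) / sigma_hat X y"
    unfolding fin by (simp add: sum_divide_distrib)
  have "Z_hat X y k = sqrt (real n) * ((\<Sum>i<n. X $$ (i, k - 1) * y $ i) / real n) / (sigma_hat X y * 1)"
    unfolding Z_hat_def s_full_def dims orthonormal_design(1)[OF X n I y k1(2)] orthonormal_design(2)[OF X n I y k1(2)]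
    by simp
  then show "Z_hat X y k = Z_tilde X y k"
    unfolding * fin by (simp add: sum_divide_distrib)
qed

text \<open>Cauchy--Schwarz for the form \<^emph>\<open>A\<close>, applied to \<^emph>\<open>v\<close> and the columns \<^emph>\<open>w_m\<close> of the inverse, gives
  \<^emph>\<open>(v m)^2 = (w_m A v)^2 \<le> (w_m A w_m) (v A v)\<close>, which avoids a compactness argument on the sphere.\<close>

lemma pos_def_lower_bound:
  assumes A: "A \<in> carrier_mat k k" and pd: "pos_def_mat A"
  obtains \<kappa> where "\<kappa> > 0" "\<And>v. \<kappa> * (\<Sum>j<k. (v j)\<^sup>2) \<le> (\<Sum>i<k. v i * (\<Sum>j<k. A $$ (i, j) * v j))"
proof -
  note B = minv_pos_def[OF A pd]
  define S where "S u v = (\<Sum>i<k. u i * (\<Sum>j<k. A $$ (i, j) * v j))" for u v :: "nat \<Rightarrow> real"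
  have sym: "A $$ (i, j) = A $$ (j, i)" if "i < k" "j < k" for i j
  proof -
    have "transpose_mat A = A" using pd unfolding pos_def_mat_def by simp
    then have "A $$ (i, j) = transpose_mat A $$ (i, j)" by simp
    then show ?thesis using that A by simp
  qed
  have S_nonneg: "0 \<le> S v v" for v
  proof (cases "\<exists>j<k. v j \<noteq> 0")
    case True
    then show ?thesis using pd unfolding pos_def_mat_iff[OF A] S_def by (meson less_imp_le)
  next
    case False
    then show ?thesis by (simp add: S_def)
  qed
  define w where "w m j = minv A $$ (j, m)" for m j
  have Aw: "(\<Sum>j<k. A $$ (i, j) * w m j) = (if i = m then 1 else 0)" if "i < k" "m < k" for i m
  proof -
    have "(\<Sum>j<k. A $$ (i, j) * w m j) = (A * minv A) $$ (i, m)"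
      using A B(1) that by (simp add: w_def scalar_prod_def atLeast0LessThan)
    then show ?thesis unfolding B(2) using that by simp
  qed
  have Sw: "S v (w m) = v m" if "m < k" for v m
  proof -
    have "S v (w m) = (\<Sum>i<k. if i = m then v i else 0)"
      unfolding S_def by (intro sum.cong refl) (use Aw that in auto)
    then show ?thesis using that by simp
  qed
  have S_sym: "S u v = S v u" for u v
  proof -
    have "S u v = (\<Sum>i<k. \<Sum>j<k. u i * A $$ (i, j) * v j)" by (simp add: S_def sum_distrib_left mult_ac)
    also have "\<dots> = (\<Sum>j<k. \<Sum>i<k. u i * A $$ (i, j) * v j)" by (rule sum.swap)
    also have "\<dots> = (\<Sum>j<k. \<Sum>i<k. v j * (A $$ (j, i) * u i))"
      by (intro sum.cong refl) (use sym in auto)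
    finally show ?thesis by (simp add: S_def sum_distrib_left)
  qed
  have S_diff: "S (\<lambda>j. v j - s * u j) z = S v z - s * S u z" for u v z s
  proof -
    have "s * S u z = (\<Sum>i<k. s * u i * (\<Sum>j<k. A $$ (i, j) * z j))"
      by (simp add: S_def sum_distrib_left mult.assoc)
    then show ?thesis by (simp add: S_def left_diff_distrib sum_subtractf)
  qed
  define c where "c m = w m m" for m
  have key: "(v m)\<^sup>2 \<le> c m * S v v" if m: "m < k" for v m
  proof -
    have cm: "S (w m) (w m) = c m" using Sw[OF m] by (simp add: c_def)
    have "S v v - 2 * s * v m + s\<^sup>2 * c m \<ge> 0" for s
    proof -
      let ?z = "\<lambda>j. v j - s * w m j"
      have "S ?z ?z = S v ?z - s * S (w m) ?z" by (rule S_diff)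
      also have "S v ?z = S v v - s * v m" unfolding S_sym[of v ?z] S_diff S_sym[of "w m" v] Sw[OF m] ..
      also have "S (w m) ?z = v m - s * c m" unfolding S_sym[of "w m" ?z] S_diff Sw[OF m] cm by (simp add: c_def)
      finally have "S ?z ?z = S v v - 2 * s * v m + s\<^sup>2 * c m"
        by (simp add: power2_eq_square algebra_simps)
      then show ?thesis using S_nonneg[of ?z] by simp
    qed
    note q = this
    have c0: "c m > 0"
    proof -
      have "\<exists>j<k. w m j \<noteq> 0"
      proof (rule ccontr)
        assume "\<not> ?thesis"
        then have "(\<Sum>j<k. A $$ (m, j) * w m j) = 0" by simp
        then show False using Aw[OF m m] by simp
      qed
      then have "0 < S (w m) (w m)" using pd unfolding pos_def_mat_iff[OF A] S_def by blast
      then show ?thesis by (simp add: cm)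
    qed
    \<comment> \<open>The value \<open>s = v m / c m\<close> minimises the quadratic in
      \<open>s\<close>.\<close>
    have "0 \<le> c m * (S v v - 2 * (v m / c m) * v m + (v m / c m)\<^sup>2 * c m)"
      using q[of "v m / c m"] c0 by (intro mult_nonneg_nonneg) auto
    also have "\<dots> = c m * S v v - (v m)\<^sup>2" using c0 by (simp add: power2_eq_square field_simps)
    finally show ?thesis by simp
  qed
  have c_nonneg: "0 \<le> c m" if "m < k" for m
    using S_nonneg[of "w m"] Sw[OF that] by (simp add: c_def)
  \<comment> \<open>The sum is the trace of the inverse matrix; the added 1 keeps \<open>C\<close>
    positive even for \<open>k = 0\<close>.\<close>
  define C where "C = 1 + (\<Sum>m<k. c m)"
  have C: "C > 0" using sum_nonneg[of "{..<k}" c] c_nonneg by (auto simp: C_def add_pos_nonneg)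
  show ?thesis
  proof (rule that[of "1 / C"])
    show "1 / C > 0" using C by simp
    fix v :: "nat \<Rightarrow> real"
    have "(\<Sum>j<k. (v j)\<^sup>2) \<le> (\<Sum>j<k. c j * S v v)" by (rule sum_mono) (use key in auto)
    also have "\<dots> \<le> C * S v v" using S_nonneg[of v] by (simp add: C_def sum_distrib_right[symmetric] distrib_right)
    finally show "1 / C * (\<Sum>j<k. (v j)\<^sup>2) \<le> (\<Sum>i<k. v i * (\<Sum>j<k. A $$ (i, j) * v j))"
      using C unfolding S_def[symmetric] by (simp add: divide_le_eq mult.commute)
  qed
qed

text \<open>In a fixed dimension, entrywise convergence controls the quadratic forms: if all entries
  are within \<open>\<delta>\<close>, bounding \<open>|v i| * |v j|\<close> by the mean of the two
  squares shows that the forms differ by at most \<open>\<delta> * K\<close> times the squared norm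
  of \<open>v\<close>. Half of the lower bound for the limit matrix then survives for all large
  \<open>n\<close>, uniformly in \<open>v\<close>.\<close>

lemma design_lower_bound:
  fixes X :: "nat \<Rightarrow> real mat"
  assumes X: "\<forall>n>K. X n \<in> carrier_mat n K"
    and A: "A \<in> carrier_mat K K" and pd: "pos_def_mat A"
    and lim: "\<forall>i<K. \<forall>j<K. (\<lambda>n. ((1 / real n) \<cdot>\<^sub>m (transpose_mat (X n) * X n)) $$ (i, j)) \<longlonglongrightarrow> A $$ (i, j)"
  obtains \<kappa> where "\<kappa> > 0"
    "\<forall>\<^sub>F n in sequentially. \<forall>v. real n * \<kappa> * (\<Sum>j<K. (v j)\<^sup>2) \<le> (\<Sum>i<n. (\<Sum>j<K. X n $$ (i, j) * v j)\<^sup>2)"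
proof -
  obtain \<mu> where \<mu>: "\<mu> > 0" "\<And>v. \<mu> * (\<Sum>j<K. (v j)\<^sup>2) \<le> (\<Sum>i<K. v i * (\<Sum>j<K. A $$ (i, j) * v j))"
    using pos_def_lower_bound[OF A pd] by blast
  define H where "H n i j = ((1 / real n) \<cdot>\<^sub>m (transpose_mat (X n) * X n)) $$ (i, j)" for n i j
  \<comment> \<open>Chosen so that \<open>\<delta> * K\<close> is at most \<open>\<mu> / 2\<close>;
    the added 1 avoids a division by zero at \<open>K = 0\<close>.\<close>
  define \<delta> where "\<delta> = \<mu> / (2 * (real K + 1))"
  have \<delta>: "\<delta> > 0" "\<delta> * real K \<le> \<mu> / 2" using \<mu> by (auto simp: \<delta>_def field_simps)
  have "\<forall>\<^sub>F n in sequentially. \<forall>i\<in>{..<K}. \<forall>j\<in>{..<K}. \<bar>H n i j - A $$ (i, j)\<bar> < \<delta>"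
    unfolding eventually_ball_finite_distrib[OF finite_lessThan]
  proof (intro ballI)
    fix i j assume "i \<in> {..<K}" "j \<in> {..<K}"
    then have "(\<lambda>n. H n i j) \<longlonglongrightarrow> A $$ (i, j)" using lim by (simp add: H_def)
    from tendstoD[OF this \<delta>(1)] show "\<forall>\<^sub>F n in sequentially. \<bar>H n i j - A $$ (i, j)\<bar> < \<delta>"
      by (simp add: dist_real_def)
  qed
  moreover have "\<forall>\<^sub>F n in sequentially. n > K" by (rule eventually_gt_at_top)
  ultimately have "\<forall>\<^sub>F n in sequentially. \<forall>v. real n * (\<mu> / 2) * (\<Sum>j<K. (v j)\<^sup>2) \<le> (\<Sum>i<n. (\<Sum>j<K. X n $$ (i, j) * v j)\<^sup>2)"
  proof eventually_elim
    case (elim n)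
    have Xn: "X n \<in> carrier_mat n K" and n: "n > 0" using X elim by auto
    show ?case
    proof
      fix v :: "nat \<Rightarrow> real"
      have "(\<Sum>i<K. v i * (\<Sum>j<K. A $$ (i, j) * v j)) - (\<Sum>i<K. v i * (\<Sum>j<K. H n i j * v j))
        = (\<Sum>i<K. \<Sum>j<K. v i * (A $$ (i, j) - H n i j) * v j)"
        by (simp add: sum_subtractf sum_distrib_left algebra_simps)
      also have "\<dots> \<le> (\<Sum>i<K. \<Sum>j<K. \<delta> * (((v i)\<^sup>2 + (v j)\<^sup>2) / 2))"
      proof (intro sum_mono)
        fix i j assume ij: "i \<in> {..<K}" "j \<in> {..<K}"
        have "v i * (A $$ (i, j) - H n i j) * v j \<le> \<bar>v i * (A $$ (i, j) - H n i j) * v j\<bar>" by simp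
        also have "\<dots> = \<bar>H n i j - A $$ (i, j)\<bar> * (\<bar>v i\<bar> * \<bar>v j\<bar>)" by (simp add: abs_mult abs_minus_commute)
        also have "\<dots> \<le> \<delta> * (((v i)\<^sup>2 + (v j)\<^sup>2) / 2)"
        proof (rule mult_mono)
          have "0 \<le> (\<bar>v i\<bar> - \<bar>v j\<bar>)\<^sup>2" by simp
          then show "\<bar>v i\<bar> * \<bar>v j\<bar> \<le> ((v i)\<^sup>2 + (v j)\<^sup>2) / 2" by (simp add: power2_diff)
        qed (use elim ij \<delta> in \<open>auto intro: less_imp_le\<close>)
        finally show "v i * (A $$ (i, j) - H n i j) * v j \<le> \<delta> * (((v i)\<^sup>2 + (v j)\<^sup>2) / 2)" .
      qed
      also have "\<dots> = \<delta> * real K * (\<Sum>j<K. (v j)\<^sup>2)"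
        by (simp add: sum_distrib_left[symmetric] sum.distrib sum_divide_distrib[symmetric])
      also have "\<dots> \<le> \<mu> / 2 * (\<Sum>j<K. (v j)\<^sup>2)"
        using \<delta> by (intro mult_right_mono sum_nonneg) auto
      finally have 1: "(\<Sum>i<K. v i * (\<Sum>j<K. A $$ (i, j) * v j)) - (\<Sum>i<K. v i * (\<Sum>j<K. H n i j * v j)) \<le> \<mu> / 2 * (\<Sum>j<K. (v j)\<^sup>2)" .
      have "(\<Sum>i<K. v i * (\<Sum>j<K. H n i j * v j)) = (\<Sum>i<n. (\<Sum>j<K. X n $$ (i, j) * v j)\<^sup>2) / real n"
        unfolding sum_swap_gram sum_divide_distrib
      proof (intro sum.cong refl)
        fix i assume i: "i \<in> {..<K}"
        have "(\<Sum>j<K. H n i j * v j) = (\<Sum>j<K. (\<Sum>l<n. X n $$ (l, i) * X n $$ (l, j)) * v j / real n)"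
          by (intro sum.cong refl) (use i Xn gram_index[OF Xn] in \<open>simp add: H_def\<close>)
        then show "v i * (\<Sum>j<K. H n i j * v j) = v i * (\<Sum>l<K. (\<Sum>ia<n. X n $$ (ia, i) * X n $$ (ia, l)) * v l) / real n"
          by (simp add: sum_divide_distrib[symmetric])
      qed
      then have "\<mu> / 2 * (\<Sum>j<K. (v j)\<^sup>2) \<le> (\<Sum>i<n. (\<Sum>j<K. X n $$ (i, j) * v j)\<^sup>2) / real n"
        using 1 \<mu>(2)[of v] by linarith
      then show "real n * (\<mu> / 2) * (\<Sum>j<K. (v j)\<^sup>2) \<le> (\<Sum>i<n. (\<Sum>j<K. X n $$ (i, j) * v j)\<^sup>2)"
        using n by (simp add: pos_le_divide_eq mult_ac)
    qed
  qed
  then show ?thesis using that[of "\<mu> / 2"] \<mu> by simp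
qed

text \<open>The errors split into the residual \<open>r\<close> and the fitted error
  \<open>u\<close>, orthogonal by the normal equations, so \<open>RSS\<close> is the squared norm of
  the errors minus \<open>T = |u|^2\<close>. Moreover \<open>T\<close> equals the inner product of
  \<open>u\<close> and \<open>e\<close>, that is, of the estimation error \<open>d\<close> and
  \<open>g = X^t e\<close>. Half of the resulting bound is absorbed by \<open>T\<close> itself
  through \<open>low\<close>, leaving \<open>|g|^2 / \<kappa>\<close>.\<close>

lemma residual_bounds:
  assumes X: "X \<in> carrier_mat n K" and pd: "pos_def_mat (transpose_mat X * X)"
    and \<kappa>: "\<kappa> > 0" and low: "\<And>v. \<kappa> * (\<Sum>j<K. (v j)\<^sup>2) \<le> (\<Sum>i<n. (\<Sum>j<K. X $$ (i, j) * v j)\<^sup>2)"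
    and \<beta>: "\<beta> \<in> carrier_vec K" and y: "y = X *\<^sub>v \<beta> + Matrix.vec n e"
  defines "RSS \<equiv> (\<Sum>i<n. ((y - X *\<^sub>v ols X y) $ i)\<^sup>2)"
  shows "RSS \<le> (\<Sum>i<n. (e i)\<^sup>2)"
    and "(\<Sum>i<n. (e i)\<^sup>2) - (\<Sum>j<K. (\<Sum>i<n. X $$ (i, j) * e i)\<^sup>2) / \<kappa> \<le> RSS"
proof -
  have yc: "y \<in> carrier_vec n" using X by (auto simp: y intro!: add_carrier_vec mult_mat_vec_carrier[OF X \<beta>])
  have b: "ols X y \<in> carrier_vec K" by (rule ols_carrier[OF X pd])
  define d where "d j = ols X y $ j - \<beta> $ j" for j
  define u where "u i = (\<Sum>j<K. X $$ (i, j) * d j)" for i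
  define r where "r i = e i - u i" for i
  have res: "y $ i - (X *\<^sub>v ols X y) $ i = r i" if "i < n" for i
    using that X \<beta> b
    by (simp add: y r_def u_def d_def scalar_prod_def atLeast0LessThan right_diff_distrib sum_subtractf)
  have RSS: "RSS = (\<Sum>i<n. (r i)\<^sup>2)"
    unfolding RSS_def using res X yc by (intro sum.cong) auto
  have ne: "(\<Sum>i<n. X $$ (i, j) * r i) = 0" if "j < K" for j
    using ols_normal_equations[OF X pd yc that] res by simp
  have ur: "(\<Sum>i<n. u i * r i) = 0"
  proof -
    have "(\<Sum>i<n. u i * r i) = (\<Sum>i<n. \<Sum>j<K. d j * (X $$ (i, j) * r i))"
      unfolding u_def sum_distrib_right by (simp add: mult_ac)
    also have "\<dots> = (\<Sum>j<K. \<Sum>i<n. d j * (X $$ (i, j) * r i))" by (rule sum.swap)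
    also have "\<dots> = 0" using ne by (simp add: sum_distrib_left[symmetric])
    finally show ?thesis .
  qed
  define T where "T = (\<Sum>i<n. (u i)\<^sup>2)"
  define g where "g j = (\<Sum>i<n. X $$ (i, j) * e i)" for j
  have "(\<Sum>i<n. (e i)\<^sup>2) = (\<Sum>i<n. (r i)\<^sup>2 + (u i)\<^sup>2 + 2 * (u i * r i))"
    by (intro sum.cong refl) (simp add: r_def power2_eq_square algebra_simps)
  then have e2: "(\<Sum>i<n. (e i)\<^sup>2) = RSS + T"
    by (simp add: sum.distrib ur RSS T_def sum_distrib_left[symmetric])
  have "T = (\<Sum>i<n. u i * e i - u i * r i)"
    unfolding T_def by (intro sum.cong refl) (simp add: r_def power2_eq_square algebra_simps)
  then have "T = (\<Sum>i<n. u i * e i)" by (simp add: sum_subtractf ur)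
  also have "\<dots> = (\<Sum>i<n. \<Sum>j<K. d j * (X $$ (i, j) * e i))"
    unfolding u_def sum_distrib_right by (simp add: mult_ac)
  also have "\<dots> = (\<Sum>j<K. \<Sum>i<n. d j * (X $$ (i, j) * e i))" by (rule sum.swap)
  also have "\<dots> = (\<Sum>j<K. d j * g j)" by (simp add: g_def sum_distrib_left)
  \<comment> \<open>Young's inequality with weight \<open>\<kappa>\<close>, exactly the weight for
    which \<open>low\<close> bounds the first part by \<open>T\<close>.\<close>
  also have "\<dots> \<le> (\<Sum>j<K. (\<kappa> * (d j)\<^sup>2 + (g j)\<^sup>2 / \<kappa>) / 2)"
  proof (rule sum_mono)
    fix j
    have "0 \<le> (\<kappa> * d j - g j)\<^sup>2 / \<kappa>" using \<kappa> by simp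
    also have "\<dots> = \<kappa> * (d j)\<^sup>2 + (g j)\<^sup>2 / \<kappa> - 2 * (d j * g j)"
      using \<kappa> by (simp add: power2_eq_square field_simps)
    finally show "d j * g j \<le> (\<kappa> * (d j)\<^sup>2 + (g j)\<^sup>2 / \<kappa>) / 2" by simp
  qed
  also have "\<dots> = (\<kappa> * (\<Sum>j<K. (d j)\<^sup>2) + (\<Sum>j<K. (g j)\<^sup>2) / \<kappa>) / 2"
    by (simp add: sum.distrib sum_distrib_left sum_divide_distrib add_divide_distrib)
  also have "\<dots> \<le> (T + (\<Sum>j<K. (g j)\<^sup>2) / \<kappa>) / 2"
    using low[of d] by (simp add: T_def u_def)
  finally have T: "T \<le> (\<Sum>j<K. (g j)\<^sup>2) / \<kappa>" by simp
  have "T \<ge> 0" unfolding T_def by (rule sum_nonneg) simp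
  then show "RSS \<le> (\<Sum>i<n. (e i)\<^sup>2)" using e2 by simp
  show "(\<Sum>i<n. (e i)\<^sup>2) - (\<Sum>j<K. (\<Sum>i<n. X $$ (i, j) * e i)\<^sup>2) / \<kappa> \<le> RSS"
    using T e2 by (simp add: g_def)
qed

section \<open>Selection events\<close>

lemma (in prob_space) prob_tendsto_approx:
  assumes ev: "\<forall>\<^sub>F n in sequentially. A n \<in> events \<and> B n \<in> events \<and> C n \<in> events \<and> A n \<subseteq> B n \<union> C n \<and> B n \<subseteq> A n \<union> C n"
    and C: "(\<lambda>n. prob (C n)) \<longlonglongrightarrow> 0" and B: "(\<lambda>n. prob (B n)) \<longlonglongrightarrow> p"
  shows "(\<lambda>n. prob (A n)) \<longlonglongrightarrow> p"
proof -
  have "\<forall>\<^sub>F n in sequentially. norm (prob (A n) - prob (B n)) \<le> prob (C n)"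
    using ev
  proof eventually_elim
    case (elim n)
    have "prob (A n) \<le> prob (B n) + prob (C n)"
      using elim by (intro order_trans[OF finite_measure_mono measure_Un_le]) auto
    moreover have "prob (B n) \<le> prob (A n) + prob (C n)"
      using elim by (intro order_trans[OF finite_measure_mono measure_Un_le]) auto
    ultimately show ?case by simp
  qed
  then have "(\<lambda>n. prob (A n) - prob (B n)) \<longlonglongrightarrow> 0" by (rule Lim_null_comparison[OF _ C])
  then show ?thesis using B by (rule Lim_transform[rotated])
qed

lemma (in prob_space) prob_tendsto_0_mono:
  assumes "\<forall>\<^sub>F n in sequentially. A n \<subseteq> B n \<and> B n \<in> events" "(\<lambda>n. prob (B n)) \<longlonglongrightarrow> 0"
  shows "(\<lambda>n. prob (A n)) \<longlonglongrightarrow> 0"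
proof (rule tendsto_sandwich[OF _ _ tendsto_const assms(2)])
  show "\<forall>\<^sub>F n in sequentially. prob (A n) \<le> prob (B n)"
    using assms(1) by eventually_elim (auto intro: finite_measure_mono)
qed simp

text \<open>Outcomes correspond to their sets \<open>B\<close> of successes. The default value
  \<open>False\<close> outside \<open>J\<close> makes this correspondence one-to-one on the support,
  so the event is a finite sum of point masses.\<close>

lemma prob_Pi_bernoulli_count:
  assumes J: "finite J" and \<alpha>: "\<And>j. j \<in> J \<Longrightarrow> 0 \<le> \<alpha> j \<and> \<alpha> j \<le> 1"
  shows "measure_pmf.prob (Pi_pmf J False (\<lambda>j. bernoulli_pmf (\<alpha> j)))
            {b. (\<Sum>j\<in>J. if b j then 1 else 0 :: nat) = m}
    = (\<Sum>B\<in>{B. B \<subseteq> J \<and> card B = m}. \<Prod>j\<in>J. if j \<in> B then \<alpha> j else 1 - \<alpha> j)"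
proof -
  let ?P = "Pi_pmf J False (\<lambda>j. bernoulli_pmf (\<alpha> j))"
  let ?F = "{B. B \<subseteq> J \<and> card B = m}"
  let ?h = "\<lambda>B j. j \<in> B"
  have fin: "finite ?F" using J by (rule rev_finite_subset[OF finite_Pow_iff[THEN iffD2]]) auto
  have cnt: "(\<Sum>j\<in>J. if b j then 1 else 0 :: nat) = card {j\<in>J. b j}" for b
    using J by (simp add: sum.If_cases Int_def)
  have eq: "{b. (\<Sum>j\<in>J. if b j then 1 else 0 :: nat) = m} \<inter> {f. \<forall>x. x \<notin> J \<longrightarrow> f x = False} = ?h ` ?F"
  proof (intro equalityI subsetI)
    fix b assume b: "b \<in> {b. (\<Sum>j\<in>J. if b j then 1 else 0 :: nat) = m} \<inter> {f. \<forall>x. x \<notin> J \<longrightarrow> f x = False}"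
    then have "{j\<in>J. b j} \<in> ?F" "b = ?h {j\<in>J. b j}" unfolding cnt by auto
    then show "b \<in> ?h ` ?F" by blast
  next
    fix b assume "b \<in> ?h ` ?F"
    then obtain B where B: "B \<subseteq> J" "card B = m" "b = ?h B" by auto
    have "{j \<in> J. j \<in> B} = B" using B by auto
    then show "b \<in> {b. (\<Sum>j\<in>J. if b j then 1 else 0 :: nat) = m} \<inter> {f. \<forall>x. x \<notin> J \<longrightarrow> f x = False}"
      unfolding cnt using B by auto
  qed
  have "measure_pmf.prob ?P {b. (\<Sum>j\<in>J. if b j then 1 else 0 :: nat) = m} =
    measure_pmf.prob ?P ({b. (\<Sum>j\<in>J. if b j then 1 else 0 :: nat) = m} \<inter> {f. \<forall>x. x \<notin> J \<longrightarrow> f x = False})"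
    using set_Pi_pmf_subset[OF J, of False "\<lambda>j. bernoulli_pmf (\<alpha> j)"]
    by (intro measure_pmf.finite_measure_eq_AE) (auto simp: AE_measure_pmf_iff)
  also have "\<dots> = (\<Sum>b\<in>?h ` ?F. pmf ?P b)"
    unfolding eq by (rule measure_measure_pmf_finite) (use fin in simp)
  also have "\<dots> = (\<Sum>B\<in>?F. pmf ?P (?h B))"
    by (subst sum.reindex) (auto simp: inj_on_def fun_eq_iff)
  also have "\<dots> = (\<Sum>B\<in>?F. \<Prod>j\<in>J. if j \<in> B then \<alpha> j else 1 - \<alpha> j)"
  proof (rule sum.cong[OF refl])
    fix B assume B: "B \<in> ?F"
    have "pmf ?P (?h B) = (\<Prod>j\<in>J. pmf (bernoulli_pmf (\<alpha> j)) (j \<in> B))"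
      by (rule pmf_Pi'[OF J]) (use B in auto)
    also have "\<dots> = (\<Prod>j\<in>J. if j \<in> B then \<alpha> j else 1 - \<alpha> j)"
      by (rule prod.cong[OF refl]) (use \<alpha> in auto)
    finally show "pmf ?P (?h B) = (\<Prod>j\<in>J. if j \<in> B then \<alpha> j else 1 - \<alpha> j)" .
  qed
  finally show ?thesis .
qed

lemma k_B_eq_iff:
  assumes "dim_col X = K" "1 \<le> k" "k \<le> K"
  shows "k_B \<alpha> X y = k \<longleftrightarrow> thr \<alpha> k \<le> ereal \<bar>Z_tilde X y k\<bar> \<and> (\<forall>j\<in>{k+1..K}. ereal \<bar>Z_tilde X y j\<bar> < thr \<alpha> j)"
proof -
  let ?S = "{k \<in> {0..K}. thr \<alpha> k \<le> ereal \<bar>Z_tilde X y k\<bar>}"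
  \<comment> \<open>Both the threshold and the statistic are 0 at index 0, so 0 always qualifies and
    the maximum is over a nonempty set.\<close>
  have "0 \<in> ?S" by (simp add: thr_def Z_tilde_def)
  then have ne: "?S \<noteq> {}" by blast
  have "k_B \<alpha> X y = k \<longleftrightarrow> k \<in> ?S \<and> (\<forall>j\<in>?S. j \<le> k)"
    unfolding k_B_def assms(1) by (rule Max_eq_iff) (use ne in auto)
  also have "\<dots> \<longleftrightarrow> thr \<alpha> k \<le> ereal \<bar>Z_tilde X y k\<bar> \<and> (\<forall>j\<in>{k+1..K}. ereal \<bar>Z_tilde X y j\<bar> < thr \<alpha> j)"
    using assms by (auto simp: not_le[symmetric])
  finally show ?thesis .
qed

lemma k_F_eq_iff:
  assumes "dim_col X = K" "k \<le> K" "\<alpha> (Suc K) = 0"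
  shows "k_F \<alpha> X y = k \<longleftrightarrow> ereal \<bar>Z_tilde X y (k+1)\<bar> < thr \<alpha> (k+1) \<and> (\<forall>j\<in>{1..k}. thr \<alpha> j \<le> ereal \<bar>Z_tilde X y j\<bar>)"
proof -
  let ?S = "{k - 1 | k. k \<in> {1..K + 1} \<and> ereal \<bar>Z_tilde X y k\<bar> < thr \<alpha> k}"
  have S: "j \<in> ?S \<longleftrightarrow> j \<le> K \<and> ereal \<bar>Z_tilde X y (j+1)\<bar> < thr \<alpha> (j+1)" for j
    by (auto intro!: exI[of _ "Suc j"])
  \<comment> \<open>Level 0 makes the threshold at \<open>K + 1\<close> infinite, so the forward
    search stops at \<open>K\<close> at the latest and the minimum is over a nonempty set.\<close>
  have "K \<in> ?S" unfolding S using assms by (simp add: thr_def zq_def)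
  then have ne: "?S \<noteq> {}" by blast
  have fin: "finite ?S" by (rule finite_subset[of _ "{..K}"]) auto
  have "k_F \<alpha> X y = k \<longleftrightarrow> k \<in> ?S \<and> (\<forall>j\<in>?S. k \<le> j)"
    unfolding k_F_def assms(1) by (rule Min_eq_iff) (use ne fin in auto)
  also have "\<dots> \<longleftrightarrow> ereal \<bar>Z_tilde X y (k+1)\<bar> < thr \<alpha> (k+1) \<and> (\<forall>j<k. thr \<alpha> (j+1) \<le> ereal \<bar>Z_tilde X y (j+1)\<bar>)"
    unfolding S Ball_def using assms(2) by (meson leD leI order_trans less_imp_le)
  also have "(\<forall>j<k. thr \<alpha> (j+1) \<le> ereal \<bar>Z_tilde X y (j+1)\<bar>) \<longleftrightarrow> (\<forall>j\<in>{1..k}. thr \<alpha> j \<le> ereal \<bar>Z_tilde X y j\<bar>)"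
    (is "?L \<longleftrightarrow> ?R")
  proof
    assume L: ?L
    show ?R
    proof
      fix j assume "j \<in> {1..k}"
      then show "thr \<alpha> j \<le> ereal \<bar>Z_tilde X y j\<bar>" using L[rule_format, of "j - 1"] by auto
    qed
  qed auto
  finally show ?thesis .
qed

section \<open>Asymptotics of the test statistics\<close>

locale linear_model = prob_space M for M :: "'a measure" +
  fixes K k0 :: nat and \<beta>0 :: "real Matrix.vec" and X :: "nat \<Rightarrow> real mat"
    and \<Sigma>0 :: "real mat" and \<epsilon> :: "nat \<Rightarrow> 'a \<Rightarrow> real" and \<sigma>0 Mb :: real
    and Y :: "nat \<Rightarrow> 'a \<Rightarrow> real Matrix.vec"
  assumes k0: "1 \<le> k0" "k0 \<le> K"
    and beta0: "\<beta>0 \<in> carrier_vec K" "\<And>j. j < k0 \<Longrightarrow> \<beta>0 $ j \<noteq> 0" "\<And>j. k0 \<le> j \<Longrightarrow> j < K \<Longrightarrow> \<beta>0 $ j = 0"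
    and Xdim: "\<And>n. K < n \<Longrightarrow> X n \<in> carrier_mat n K"
    and X_sq: "\<And>n k. K < n \<Longrightarrow> k < K \<Longrightarrow> (\<Sum>i<n. (X n $$ (i, k))\<^sup>2) = real n"
    and X_max: "(\<lambda>n. Max ((\<lambda>i. sqrt (\<Sum>k<K. (X n $$ (i,k))\<^sup>2)) ` {..<n}) / sqrt (real n)) \<longlonglongrightarrow> 0"
    and X_pd: "\<And>n. K < n \<Longrightarrow> pos_def_mat (transpose_mat (X n) * X n)"
    and \<Sigma>0: "\<Sigma>0 \<in> carrier_mat K K" "pos_def_mat \<Sigma>0"
      "\<forall>i<K. \<forall>j<K. (\<lambda>n. ((1 / real n) \<cdot>\<^sub>m (transpose_mat (X n) * X n)) $$ (i,j)) \<longlonglongrightarrow> \<Sigma>0 $$ (i,j)"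
    and eps_indep: "indep_vars (\<lambda>_. borel) \<epsilon> UNIV"
    and eps4: "\<And>i. integrable M (\<lambda>\<omega>. (\<epsilon> i \<omega>) ^ 4)" "\<And>i. expectation (\<lambda>\<omega>. (\<epsilon> i \<omega>) ^ 4) \<le> Mb"
    and eps_mean: "\<And>i. expectation (\<epsilon> i) = 0"
    and eps_var: "\<And>i. expectation (\<lambda>\<omega>. (\<epsilon> i \<omega>)\<^sup>2) = \<sigma>0\<^sup>2"
    and \<sigma>0: "\<sigma>0 > 0"
    and Y: "\<And>n \<omega>. Y n \<omega> = X n *\<^sub>v \<beta>0 + Matrix.vec n (\<lambda>i. \<epsilon> i \<omega>)"
begin

lemma eps_rv [measurable]: "\<epsilon> i \<in> borel_measurable M"
  using eps_indep unfolding indep_vars_def2 by simp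

lemma eps_sq: "integrable M (\<lambda>\<omega>. (\<epsilon> i \<omega>)\<^sup>2)"
proof (rule Bochner_Integration.integrable_bound[where f="\<lambda>\<omega>. 1 + (\<epsilon> i \<omega>) ^ 4"])
  show "integrable M (\<lambda>\<omega>. 1 + (\<epsilon> i \<omega>) ^ 4)" using eps4(1)[of i] by simp
  have "x\<^sup>2 \<le> 1 + x ^ 4" for x :: real
  proof -
    have "0 \<le> (x\<^sup>2 - 1/2)\<^sup>2" by simp
    also have "\<dots> = x ^ 4 - x\<^sup>2 + 1/4" by (simp add: power2_eq_square power4_eq_xxxx algebra_simps)
    finally show ?thesis by simp
  qed
  then show "AE \<omega> in M. norm ((\<epsilon> i \<omega>)\<^sup>2) \<le> norm (1 + (\<epsilon> i \<omega>) ^ 4)"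
    by (auto intro: order_trans[OF _ abs_ge_self])
qed simp

section \<open>Measurability and consistency of the variance estimator\<close>

abbreviation sg :: "nat \<Rightarrow> 'a \<Rightarrow> real" where "sg n \<omega> \<equiv> sigma_hat (X n) (Y n \<omega>)"

lemma Y_carrier: "K < n \<Longrightarrow> Y n \<omega> \<in> carrier_vec n"
  unfolding Y using mult_mat_vec_carrier[OF Xdim beta0(1)] by simp

lemma Y_index: "K < n \<Longrightarrow> i < n \<Longrightarrow> Y n \<omega> $ i = (\<Sum>j<K. X n $$ (i, j) * \<beta>0 $ j) + \<epsilon> i \<omega>"
  unfolding Y using Xdim[of n] beta0(1) by (simp add: scalar_prod_def atLeast0LessThan)

lemma sum_Y: "K < n \<Longrightarrow> (\<Sum>i<n. q i * Y n \<omega> $ i) = (\<Sum>j<K. \<beta>0 $ j * (\<Sum>i<n. q i * X n $$ (i, j))) + (\<Sum>i<n. q i * \<epsilon> i \<omega>)"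
proof -
  assume n: "K < n"
  have "(\<Sum>i<n. q i * Y n \<omega> $ i) = (\<Sum>i<n. \<Sum>j<K. \<beta>0 $ j * (q i * X n $$ (i, j))) + (\<Sum>i<n. q i * \<epsilon> i \<omega>)"
    using n by (simp add: Y_index distrib_left sum.distrib sum_distrib_left mult_ac)
  also have "(\<Sum>i<n. \<Sum>j<K. \<beta>0 $ j * (q i * X n $$ (i, j))) = (\<Sum>j<K. \<Sum>i<n. \<beta>0 $ j * (q i * X n $$ (i, j)))"
    by (rule sum.swap)
  finally show ?thesis by (simp add: sum_distrib_left)
qed

lemma sg_nonneg: "0 \<le> sg n \<omega>"
  unfolding sigma_hat_def by (intro real_sqrt_ge_zero divide_nonneg_nonneg sum_nonneg) auto

lemma sg_square:
  assumes n: "K < n"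
  shows "(sg n \<omega>)\<^sup>2 = (\<Sum>i<n. ((Y n \<omega> - X n *\<^sub>v ols (X n) (Y n \<omega>)) $ i)\<^sup>2) / (real n - real K)"
proof -
  have "dim_row (X n) = n" "dim_col (X n) = K" using Xdim[OF n] by auto
  moreover have "real (n - K) = real n - real K" using n by simp
  ultimately show ?thesis unfolding sigma_hat_def
    using n by (simp add: real_sqrt_pow2 sum_nonneg)
qed

lemma Y_index_measurable: "K < n \<Longrightarrow> i < n \<Longrightarrow> (\<lambda>\<omega>. Y n \<omega> $ i) \<in> borel_measurable M"
  by (simp add: Y_index)

lemma sg_measurable: assumes n: "K < n" shows "sg n \<in> borel_measurable M"
proof -
  have X: "X n \<in> carrier_mat n K" and pd: "pos_def_mat (transpose_mat (X n) * X n)" using Xdim X_pd n by auto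
  have ols_meas: "(\<lambda>\<omega>. ols (X n) (Y n \<omega>) $ j) \<in> borel_measurable M" if j: "j < K" for j
    unfolding ols_index[OF X pd Y_carrier[OF n] j]
    by (intro borel_measurable_sum borel_measurable_times borel_measurable_const Y_index_measurable[OF n]) simp
  have res: "(Y n \<omega> - X n *\<^sub>v ols (X n) (Y n \<omega>)) $ i = Y n \<omega> $ i - (\<Sum>j<K. X n $$ (i, j) * ols (X n) (Y n \<omega>) $ j)" if "i < n" for i \<omega>
    using that X Y_carrier[OF n, of \<omega>] ols_carrier[OF X pd, of "Y n \<omega>"] by (simp add: scalar_prod_def atLeast0LessThan)
  have "(\<lambda>\<omega>. (Y n \<omega> - X n *\<^sub>v ols (X n) (Y n \<omega>)) $ i) \<in> borel_measurable M" if i: "i < n" for i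
    unfolding res[OF i] by (intro borel_measurable_diff Y_index_measurable[OF n i] borel_measurable_sum borel_measurable_times borel_measurable_const ols_meas) simp
  moreover have "dim_row (X n) = n" using X by simp
  ultimately show ?thesis unfolding sigma_hat_def
    by (intro borel_measurable_sqrt[THEN measurable_compose[rotated]] borel_measurable_divide borel_measurable_sum borel_measurable_power borel_measurable_const) auto
qed

lemma lower_bound:
  obtains \<kappa> where "\<kappa> > 0" "\<forall>\<^sub>F n in sequentially. \<forall>v. real n * \<kappa> * (\<Sum>j<K. (v j)\<^sup>2) \<le> (\<Sum>i<n. (\<Sum>j<K. X n $$ (i, j) * v j)\<^sup>2)"
  using design_lower_bound[of K X, OF _ \<Sigma>0] Xdim by blast

text \<open>For large \<open>n\<close> the deviation times \<open>n - K\<close> is dominated by a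
  nonnegative variable \<open>U n\<close> whose mean is of order \<open>sqrt n\<close>, and the
  Markov inequality concludes. The terms of \<open>U n\<close> bound the fluctuation
  \<open>S n\<close> of the squared errors (a variance argument, hence the fourth moments), the
  correction \<open>K * \<sigma>0^2\<close> for dividing by \<open>n - K\<close>, and the part of
  the errors absorbed by the fit, whose mean stays bounded.\<close>

lemma sg_square_consistent:
  assumes \<delta>: "\<delta> > 0"
  shows "(\<lambda>n. prob {\<omega>\<in>space M. \<bar>(sg n \<omega>)\<^sup>2 - \<sigma>0\<^sup>2\<bar> \<ge> \<delta>}) \<longlonglongrightarrow> 0"
proof -
  obtain \<kappa> where \<kappa>: "\<kappa> > 0" and low: "\<forall>\<^sub>F n in sequentially. \<forall>v. real n * \<kappa> * (\<Sum>j<K. (v j)\<^sup>2) \<le> (\<Sum>i<n. (\<Sum>j<K. X n $$ (i, j) * v j)\<^sup>2)"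
    by (rule lower_bound)
  define \<xi> where "\<xi> i \<omega> = (\<epsilon> i \<omega>)\<^sup>2 - \<sigma>0\<^sup>2" for i \<omega>
  have \<xi>_indep: "indep_vars (\<lambda>_. borel) \<xi> UNIV"
    unfolding \<xi>_def by (rule indep_vars_compose2[OF eps_indep, where Y="\<lambda>_ x. x\<^sup>2 - \<sigma>0\<^sup>2"]) simp
  have \<xi>2: "(\<xi> i \<omega>)\<^sup>2 = (\<epsilon> i \<omega>) ^ 4 - 2 * \<sigma>0\<^sup>2 * (\<epsilon> i \<omega>)\<^sup>2 + \<sigma>0 ^ 4" for i \<omega>
    by (simp add: \<xi>_def power2_eq_square power4_eq_xxxx algebra_simps)
  have \<xi>_sq: "integrable M (\<lambda>\<omega>. (\<xi> i \<omega>)\<^sup>2)" for i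
    unfolding \<xi>2 using eps4 eps_sq by simp
  have \<xi>_mean: "expectation (\<xi> i) = 0" for i
    unfolding \<xi>_def using eps_sq eps_var by (simp add: prob_space)
  have \<xi>_var: "expectation (\<lambda>\<omega>. (\<xi> i \<omega>)\<^sup>2) \<le> Mb" for i
  proof -
    have "expectation (\<lambda>\<omega>. (\<xi> i \<omega>)\<^sup>2) = expectation (\<lambda>\<omega>. (\<epsilon> i \<omega>) ^ 4) - 2 * \<sigma>0\<^sup>2 * \<sigma>0\<^sup>2 + \<sigma>0 ^ 4"
      unfolding \<xi>2 using eps4 eps_sq eps_var by (simp add: prob_space)
    also have "\<dots> = expectation (\<lambda>\<omega>. (\<epsilon> i \<omega>) ^ 4) - \<sigma>0 ^ 4" by (simp add: power2_eq_square power4_eq_xxxx)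
    also have "\<dots> \<le> Mb" using eps4(2)[of i] \<sigma>0 zero_le_power[of \<sigma>0 4] by linarith
    finally show ?thesis .
  qed
  define S where "S n \<omega> = (\<Sum>i<n. 1 * \<xi> i \<omega>)" for n \<omega>
  define g where "g n j \<omega> = (\<Sum>i<n. X n $$ (i, j) * \<epsilon> i \<omega>)" for n j \<omega>
  \<comment> \<open>The first two terms dominate \<open>|S n|\<close>, yet their mean needs only the
    variance of \<open>S n\<close>; since that variance is of order \<open>n\<close>, the weight
    \<open>sqrt n\<close> balances them.\<close>
  define U where "U n \<omega> = sqrt (real n) + (S n \<omega>)\<^sup>2 / sqrt (real n) + real K * \<sigma>0\<^sup>2 + (\<Sum>j<K. (g n j \<omega>)\<^sup>2) / (real n * \<kappa>)" for n \<omega>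
  define c where "c n = sqrt (real n) + real n * Mb / sqrt (real n) + real K * \<sigma>0\<^sup>2 + real K * (real n * \<sigma>0\<^sup>2) / (real n * \<kappa>)" for n
  have S_int: "integrable M (\<lambda>\<omega>. (S n \<omega>)\<^sup>2)" for n
    unfolding S_def by (rule integrable_square_sum_indep[OF _ \<xi>_indep \<xi>_sq \<xi>_mean]) simp
  have S_exp: "expectation (\<lambda>\<omega>. (S n \<omega>)\<^sup>2) \<le> real n * Mb" for n
  proof -
    have "expectation (\<lambda>\<omega>. (S n \<omega>)\<^sup>2) = (\<Sum>i<n. 1\<^sup>2 * expectation (\<lambda>\<omega>. (\<xi> i \<omega>)\<^sup>2))"
      unfolding S_def by (rule expectation_square_sum_indep[OF _ \<xi>_indep \<xi>_sq \<xi>_mean]) simp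
    also have "\<dots> \<le> (\<Sum>i<n. Mb)" using \<xi>_var by (intro sum_mono) simp
    finally show ?thesis by simp
  qed
  have g_int: "integrable M (\<lambda>\<omega>. (g n j \<omega>)\<^sup>2)" for n j
    unfolding g_def by (rule integrable_square_sum_indep[OF _ eps_indep eps_sq eps_mean]) simp
  have g_exp: "expectation (\<lambda>\<omega>. (g n j \<omega>)\<^sup>2) = real n * \<sigma>0\<^sup>2" if "K < n" "j < K" for n j
  proof -
    have "expectation (\<lambda>\<omega>. (g n j \<omega>)\<^sup>2) = (\<Sum>i<n. (X n $$ (i, j))\<^sup>2 * expectation (\<lambda>\<omega>. (\<epsilon> i \<omega>)\<^sup>2))"
      unfolding g_def by (rule expectation_square_sum_indep[OF _ eps_indep eps_sq eps_mean]) simp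
    then show ?thesis using X_sq[OF that] by (simp add: eps_var sum_distrib_right[symmetric])
  qed
  have U_int: "integrable M (U n)" for n
    unfolding U_def using S_int g_int
    by (intro Bochner_Integration.integrable_add Bochner_Integration.integrable_divide Bochner_Integration.integrable_sum) auto
  have U_nonneg: "0 \<le> U n \<omega>" for n \<omega>
    unfolding U_def using \<kappa> by (intro add_nonneg_nonneg divide_nonneg_nonneg sum_nonneg mult_nonneg_nonneg) auto
  have U_exp: "expectation (U n) \<le> c n" if n: "K < n" for n
  proof -
    have "expectation (U n) = sqrt (real n) + expectation (\<lambda>\<omega>. (S n \<omega>)\<^sup>2) / sqrt (real n) + real K * \<sigma>0\<^sup>2 + (\<Sum>j<K. expectation (\<lambda>\<omega>. (g n j \<omega>)\<^sup>2)) / (real n * \<kappa>)"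
      unfolding U_def using S_int g_int by (simp add: prob_space Bochner_Integration.integral_sum)
    also have "\<dots> = sqrt (real n) + expectation (\<lambda>\<omega>. (S n \<omega>)\<^sup>2) / sqrt (real n) + real K * \<sigma>0\<^sup>2 + real K * (real n * \<sigma>0\<^sup>2) / (real n * \<kappa>)"
      using g_exp[OF n] by simp
    also have "\<dots> \<le> c n"
      unfolding c_def using S_exp[of n] \<kappa> by (intro add_mono divide_right_mono) auto
    finally show ?thesis .
  qed
  have bound: "\<forall>\<^sub>F n in sequentially. prob {\<omega>\<in>space M. \<bar>(sg n \<omega>)\<^sup>2 - \<sigma>0\<^sup>2\<bar> \<ge> \<delta>} \<le> c n / (\<delta> * (real n - real K))"
    using low eventually_gt_at_top[of K]
  proof eventually_elim
    case (elim n)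
    then have n: "K < n" and n0: "real n - real K > 0" and lown: "\<And>v. real n * \<kappa> * (\<Sum>j<K. (v j)\<^sup>2) \<le> (\<Sum>i<n. (\<Sum>j<K. X n $$ (i, j) * v j)\<^sup>2)" by auto
    have nk: "real n * \<kappa> > 0" using n \<kappa> by simp
    have D: "\<bar>(sg n \<omega>)\<^sup>2 - \<sigma>0\<^sup>2\<bar> * (real n - real K) \<le> U n \<omega>" for \<omega>
    proof -
      define R where "R = (\<Sum>i<n. ((Y n \<omega> - X n *\<^sub>v ols (X n) (Y n \<omega>)) $ i)\<^sup>2)"
      note rb = residual_bounds[OF Xdim[OF n] X_pd[OF n] nk lown beta0(1) Y[of n \<omega>], folded R_def]
      have e2: "(\<Sum>i<n. (\<epsilon> i \<omega>)\<^sup>2) = S n \<omega> + real n * \<sigma>0\<^sup>2"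
        by (simp add: S_def \<xi>_def sum_subtractf)
      have Sabs: "\<bar>S n \<omega>\<bar> \<le> sqrt (real n) + (S n \<omega>)\<^sup>2 / sqrt (real n)"
      proof -
        have s: "sqrt (real n) > 0" using n by simp
        have "0 \<le> (\<bar>S n \<omega>\<bar> - sqrt (real n) / 2)\<^sup>2 + 3/4 * (sqrt (real n))\<^sup>2" by simp
        also have "\<dots> = (S n \<omega>)\<^sup>2 + (sqrt (real n))\<^sup>2 - \<bar>S n \<omega>\<bar> * sqrt (real n)"
          by (simp add: power2_diff power_divide)
        finally have "\<bar>S n \<omega>\<bar> * sqrt (real n) \<le> (S n \<omega>)\<^sup>2 + sqrt (real n) * sqrt (real n)" by (simp add: power2_eq_square)
        then have "\<bar>S n \<omega>\<bar> \<le> ((S n \<omega>)\<^sup>2 + sqrt (real n) * sqrt (real n)) / sqrt (real n)"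
          using s by (simp only: pos_le_divide_eq)
        also have "\<dots> = sqrt (real n) + (S n \<omega>)\<^sup>2 / sqrt (real n)"
          using s by (simp add: add_divide_distrib del: real_sqrt_mult_self)
        finally show ?thesis .
      qed
      have gn: "0 \<le> (\<Sum>j<K. (g n j \<omega>)\<^sup>2) / (real n * \<kappa>)"
        using nk by (intro divide_nonneg_nonneg sum_nonneg) auto
      have kn: "0 \<le> real K * \<sigma>0\<^sup>2" by simp
      have "\<bar>(sg n \<omega>)\<^sup>2 - \<sigma>0\<^sup>2\<bar> * (real n - real K) = \<bar>((sg n \<omega>)\<^sup>2 - \<sigma>0\<^sup>2) * (real n - real K)\<bar>"
        using n0 by (simp add: abs_mult)
      also have "((sg n \<omega>)\<^sup>2 - \<sigma>0\<^sup>2) * (real n - real K) = R - real n * \<sigma>0\<^sup>2 + real K * \<sigma>0\<^sup>2"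
      proof -
        have "R / (real n - real K) * (real n - real K) = R" using n0 by simp
        then show ?thesis unfolding sg_square[OF n] R_def[symmetric] left_diff_distrib[of "R / (real n - real K)"]
          by (simp only:) (simp add: algebra_simps)
      qed
      also have "\<bar>\<dots>\<bar> \<le> U n \<omega>"
        unfolding U_def by (intro abs_leI) (use rb[folded g_def] e2 Sabs gn kn in linarith)+
      finally show ?thesis .
    qed
    have "prob {\<omega>\<in>space M. \<bar>(sg n \<omega>)\<^sup>2 - \<sigma>0\<^sup>2\<bar> \<ge> \<delta>} \<le> prob {\<omega>\<in>space M. U n \<omega> \<ge> \<delta> * (real n - real K)}"
    proof (rule finite_measure_mono)
      show "{\<omega>\<in>space M. \<bar>(sg n \<omega>)\<^sup>2 - \<sigma>0\<^sup>2\<bar> \<ge> \<delta>} \<subseteq> {\<omega>\<in>space M. U n \<omega> \<ge> \<delta> * (real n - real K)}"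
        using D n0 by (auto intro: order_trans[OF mult_right_mono[of \<delta>]])
      show "{\<omega>\<in>space M. U n \<omega> \<ge> \<delta> * (real n - real K)} \<in> events"
        using borel_measurable_integrable[OF U_int[of n]] by simp
    qed
    also have "\<dots> \<le> expectation (U n) / (\<delta> * (real n - real K))"
      by (rule integral_Markov_inequality_measure[where A="{}"]) (use U_int U_nonneg \<delta> n0 in auto)
    also have "\<dots> \<le> c n / (\<delta> * (real n - real K))"
      using U_exp[OF n] \<delta> n0 by (intro divide_right_mono) auto
    finally show ?case .
  qed
  have "(\<lambda>n. c n / (\<delta> * (real n - real K))) \<longlonglongrightarrow> 0"
    unfolding c_def using \<delta> \<kappa> by real_asymp
  with bound show ?thesis
    by (intro tendsto_sandwich[OF _ bound tendsto_const]) auto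
qed


text \<open>Continuous mapping: \<open>\<sigma>0 / sqrt x\<close> is continuous at
  \<open>x = \<sigma>0^2\<close>, and \<open>sg\<close> is the nonnegative root of its
  square.\<close>

lemma ratio_consistent:
  assumes \<delta>: "\<delta> > 0"
  shows "(\<lambda>n. prob {\<omega>\<in>space M. \<bar>\<sigma>0 / sg n \<omega> - 1\<bar> \<ge> \<delta>}) \<longlonglongrightarrow> 0"
proof -
  have "isCont (\<lambda>x. \<sigma>0 / sqrt x) (\<sigma>0\<^sup>2)"
    using \<sigma>0 by (intro continuous_intros) auto
  then obtain \<eta> where \<eta>: "\<eta> > 0" "\<And>x. \<bar>x - \<sigma>0\<^sup>2\<bar> < \<eta> \<Longrightarrow> \<bar>\<sigma>0 / sqrt x - \<sigma>0 / sqrt (\<sigma>0\<^sup>2)\<bar> < \<delta>"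
    unfolding continuous_at_eps_delta using \<delta> by (auto simp: dist_real_def)
  have impl: "\<bar>\<sigma>0 / sg n \<omega> - 1\<bar> < \<delta>" if "\<bar>(sg n \<omega>)\<^sup>2 - \<sigma>0\<^sup>2\<bar> < \<eta>" for n \<omega>
    using \<eta>(2)[OF that] \<sigma>0 sg_nonneg[of n \<omega>] by simp
  show ?thesis
  proof (rule prob_tendsto_0_mono[OF _ sg_square_consistent[OF \<eta>(1)]])
    show "\<forall>\<^sub>F n in sequentially. {\<omega>\<in>space M. \<bar>\<sigma>0 / sg n \<omega> - 1\<bar> \<ge> \<delta>} \<subseteq> {\<omega>\<in>space M. \<bar>(sg n \<omega>)\<^sup>2 - \<sigma>0\<^sup>2\<bar> \<ge> \<eta>} \<and>
        {\<omega>\<in>space M. \<bar>(sg n \<omega>)\<^sup>2 - \<sigma>0\<^sup>2\<bar> \<ge> \<eta>} \<in> events"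
      using eventually_gt_at_top[of K]
    proof eventually_elim
      case (elim n)
      note [measurable] = sg_measurable[OF elim]
      have "{\<omega>\<in>space M. \<bar>(sg n \<omega>)\<^sup>2 - \<sigma>0\<^sup>2\<bar> \<ge> \<eta>} \<in> events" by measurable
      then show ?case using impl by (auto simp: not_less[symmetric])
    qed
  qed
qed

text \<open>A combination of the contrasts with weights \<open>t\<close> is again a single weight
  vector, and by orthonormality its squared norm is exactly the sum of \<open>(t j)^2\<close> for
  \<open>n > K\<close>. Hence the limit factorises over \<open>J\<close> although the coordinates
  share the same errors. The common denominator leaves every combination as the one factor
  \<open>r n\<close>.\<close>

lemma studentized_joint_limit:
  fixes q :: "nat \<Rightarrow> nat \<Rightarrow> nat \<Rightarrow> real"
  assumes J: "finite J"
    and orth: "\<And>n j l. K < n \<Longrightarrow> j \<in> J \<Longrightarrow> l \<in> J \<Longrightarrow> (\<Sum>i<n. q n j i * q n l i) = (if j = l then 1 else 0)"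
    and small: "\<forall>\<^sub>F n in sequentially. \<forall>j\<in>J. \<forall>i<n. \<bar>q n j i\<bar> \<le> m n" and m: "m \<longlonglongrightarrow> 0"
    and A: "\<And>j. A j \<in> sets borel" "\<And>j. j \<in> J \<Longrightarrow> emeasure std_normal_distribution (frontier (A j)) = 0"
  shows "(\<lambda>n. prob {\<omega>\<in>space M. \<forall>j\<in>J. (\<Sum>i<n. q n j i * \<epsilon> i \<omega>) / sg n \<omega> \<in> A j}) \<longlonglongrightarrow> (\<Prod>j\<in>J. measure std_normal_distribution (A j))"
proof -
  define r where "r n \<omega> = (if K < n then \<sigma>0 / sg n \<omega> else 1)" for n \<omega>
  define W where "W n j \<omega> = (\<Sum>i<n. q n j i * \<epsilon> i \<omega>) / \<sigma>0" for n j \<omega>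
  define Z where "Z n j \<omega> = r n \<omega> * W n j \<omega>" for n j \<omega>
  have r_meas [measurable]: "r n \<in> borel_measurable M" for n
  proof (cases "K < n")
    case True
    note [measurable] = sg_measurable[OF True]
    have "r n = (\<lambda>\<omega>. \<sigma>0 / sg n \<omega>)" using True by (simp add: r_def fun_eq_iff)
    then show ?thesis by simp
  next
    case False
    then have "r n = (\<lambda>_. 1)" by (simp add: r_def fun_eq_iff)
    then show ?thesis by simp
  qed
  have W_meas [measurable]: "W n j \<in> borel_measurable M" for n j
    unfolding W_def by measurable
  have Z_meas [measurable]: "Z n j \<in> borel_measurable M" for n j
    unfolding Z_def by measurable
  have Z_eq: "Z n j \<omega> = (\<Sum>i<n. q n j i * \<epsilon> i \<omega>) / sg n \<omega>" if "K < n" for n j \<omega>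
    using that \<sigma>0 by (simp add: Z_def r_def W_def)
  have r_lim: "(\<lambda>n. prob {\<omega>\<in>space M. \<bar>r n \<omega> - 1\<bar> \<ge> \<delta>}) \<longlonglongrightarrow> 0" if \<delta>: "\<delta> > 0" for \<delta>
  proof (rule Lim_transform_eventually[OF ratio_consistent[OF \<delta>]])
    show "\<forall>\<^sub>F n in sequentially. prob {\<omega>\<in>space M. \<bar>\<sigma>0 / sg n \<omega> - 1\<bar> \<ge> \<delta>} = prob {\<omega>\<in>space M. \<bar>r n \<omega> - 1\<bar> \<ge> \<delta>}"
      using eventually_gt_at_top[of K] by eventually_elim (simp add: r_def)
  qed
  have "(\<lambda>n. prob {\<omega>\<in>space M. \<forall>j\<in>J. Z n j \<omega> \<in> A j}) \<longlonglongrightarrow> (\<Prod>j\<in>J. measure std_normal_distribution (A j))"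
  proof (rule joint_convergence_of_char[OF J Z_meas real_dist_normal_dist _ A])
    fix t :: "nat \<Rightarrow> real"
    define a where "a n i = (\<Sum>j\<in>J. t j * q n j i) / \<sigma>0" for n i
    \<comment> \<open>Chosen so that \<open>\<sigma>0^2 * v\<close> is the exact variance of the
      combination once \<open>n > K\<close>.\<close>
    define v where "v = (\<Sum>j\<in>J. (t j)\<^sup>2) / \<sigma>0\<^sup>2"
    have S_eq: "(\<Sum>j\<in>J. t j * W n j \<omega>) = (\<Sum>i<n. a n i * \<epsilon> i \<omega>)" for n \<omega>
    proof -
      have "(\<Sum>j\<in>J. t j * W n j \<omega>) = (\<Sum>j\<in>J. \<Sum>i<n. t j * q n j i / \<sigma>0 * \<epsilon> i \<omega>)"
        by (simp add: W_def sum_distrib_left sum_divide_distrib mult.assoc)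
      also have "\<dots> = (\<Sum>i<n. \<Sum>j\<in>J. t j * q n j i / \<sigma>0 * \<epsilon> i \<omega>)" by (rule sum.swap)
      finally show ?thesis by (simp add: a_def sum_distrib_right sum_divide_distrib)
    qed
    have a_sq: "(\<Sum>i<n. (a n i)\<^sup>2) = v" if n: "K < n" for n
    proof -
      have "(\<Sum>i<n. (a n i)\<^sup>2) = (\<Sum>i<n. (\<Sum>j\<in>J. q n j i * t j)\<^sup>2) / \<sigma>0\<^sup>2"
        unfolding a_def power_divide sum_divide_distrib[of _ _ "\<sigma>0\<^sup>2"] by (simp add: mult.commute)
      also have "(\<Sum>i<n. (\<Sum>j\<in>J. q n j i * t j)\<^sup>2) = (\<Sum>j\<in>J. t j * (\<Sum>l\<in>J. (\<Sum>i<n. q n j i * q n l i) * t l))"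
        by (rule sum_swap_gram)
      also have "\<dots> = (\<Sum>j\<in>J. t j * (\<Sum>l\<in>J. if j = l then t l else 0))"
        by (intro sum.cong refl arg_cong2[where f="(*)"]) (use orth[OF n] in auto)
      also have "\<dots> = (\<Sum>j\<in>J. (t j)\<^sup>2)"
        using J by (intro sum.cong refl) (simp add: power2_eq_square)
      finally show ?thesis by (simp add: v_def)
    qed
    have "(\<lambda>n. expectation (\<lambda>\<omega>. iexp (\<Sum>i<n. a n i * \<epsilon> i \<omega>))) \<longlonglongrightarrow> complex_of_real (exp (- (\<sigma>0\<^sup>2 * v / 2)))"
    proof (rule linear_statistic_char_limit[OF eps_indep eps4 eps_sq eps_var eps_mean])
      show "(\<lambda>n. \<Sum>i<n. (a n i)\<^sup>2) \<longlonglongrightarrow> v"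
        by (rule tendsto_eventually) (rule eventually_mono[OF eventually_gt_at_top[of K] a_sq])
      show "\<forall>\<^sub>F n in sequentially. \<forall>i<n. \<bar>a n i\<bar> \<le> (\<Sum>j\<in>J. \<bar>t j\<bar>) * m n / \<sigma>0"
        using small
      proof eventually_elim
        case (elim n)
        show ?case
        proof (intro allI impI)
          fix i assume i: "i < n"
          have "\<bar>\<Sum>j\<in>J. t j * q n j i\<bar> \<le> (\<Sum>j\<in>J. \<bar>t j * q n j i\<bar>)" by (rule sum_abs)
          also have "\<dots> \<le> (\<Sum>j\<in>J. \<bar>t j\<bar> * m n)"
            unfolding abs_mult using elim i by (intro sum_mono mult_left_mono) auto
          finally show "\<bar>a n i\<bar> \<le> (\<Sum>j\<in>J. \<bar>t j\<bar>) * m n / \<sigma>0"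
            using \<sigma>0 by (simp add: a_def divide_right_mono sum_distrib_right)
        qed
      qed
      show "(\<lambda>n. (\<Sum>j\<in>J. \<bar>t j\<bar>) * m n / \<sigma>0) \<longlonglongrightarrow> 0"
        using m by (auto intro!: tendsto_eq_intros simp: \<sigma>0[THEN less_imp_neq, symmetric])
    qed
    then have "(\<lambda>n. expectation (\<lambda>\<omega>. iexp (r n \<omega> * (\<Sum>j\<in>J. t j * W n j \<omega>)))) \<longlonglongrightarrow> complex_of_real (exp (- (\<sigma>0\<^sup>2 * v / 2)))"
    proof (intro char_limit_slutsky[where B="v * \<sigma>0\<^sup>2"] r_lim)
      show "\<forall>\<^sub>F n in sequentially. integrable M (\<lambda>\<omega>. (\<Sum>j\<in>J. t j * W n j \<omega>)\<^sup>2) \<and> expectation (\<lambda>\<omega>. (\<Sum>j\<in>J. t j * W n j \<omega>)\<^sup>2) \<le> v * \<sigma>0\<^sup>2"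
        using eventually_gt_at_top[of K]
      proof eventually_elim
        case (elim n)
        show ?case
          unfolding S_eq
          using integrable_square_sum_indep[OF _ eps_indep eps_sq eps_mean, of "{..<n}" "a n"]
            expectation_square_sum_indep[OF _ eps_indep eps_sq eps_mean, of "{..<n}" "a n"] a_sq[OF elim]
          by (simp add: eps_var sum_distrib_right[symmetric])
      qed
    qed (simp_all add: S_eq)
    moreover have "r n \<omega> * (\<Sum>j\<in>J. t j * W n j \<omega>) = (\<Sum>j\<in>J. t j * Z n j \<omega>)" for n \<omega>
      by (simp add: Z_def sum_distrib_left mult_ac)
    moreover have "complex_of_real (exp (- (\<sigma>0\<^sup>2 * v / 2))) = (\<Prod>j\<in>J. char std_normal_distribution (t j))"
    proof -
      have "- (\<sigma>0\<^sup>2 * v / 2) = (\<Sum>j\<in>J. - (t j)\<^sup>2 / 2)"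
        using \<sigma>0 by (simp add: v_def sum_negf sum_divide_distrib[symmetric])
      then show ?thesis unfolding char_std_normal_distribution by (simp only: exp_sum[OF J] of_real_prod)
    qed
    ultimately show "(\<lambda>n. expectation (\<lambda>\<omega>. iexp (\<Sum>j\<in>J. t j * Z n j \<omega>))) \<longlonglongrightarrow> (\<Prod>j\<in>J. char std_normal_distribution (t j))"
      by simp
  qed
  then show ?thesis
  proof (rule Lim_transform_eventually)
    show "\<forall>\<^sub>F n in sequentially. prob {\<omega>\<in>space M. \<forall>j\<in>J. Z n j \<omega> \<in> A j} = prob {\<omega>\<in>space M. \<forall>j\<in>J. (\<Sum>i<n. q n j i * \<epsilon> i \<omega>) / sg n \<omega> \<in> A j}"
      using eventually_gt_at_top[of K] by eventually_elim (simp add: Z_eq)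
  qed
qed

text \<open>The statistic is \<open>(d n + W n) / sg n\<close>, where \<open>W n\<close> has fixed
  variance. Outside two events of vanishing probability, \<open>sg n\<close> is below
  \<open>2 * \<sigma>0\<close> and \<open>W n\<close> is smaller than half of the drift, so the
  numerator keeps at least \<open>|d n| / 2\<close>.\<close>

lemma divergent_drift:
  fixes q :: "nat \<Rightarrow> nat \<Rightarrow> real"
  assumes q: "\<And>n. K < n \<Longrightarrow> (\<Sum>i<n. (q n i)\<^sup>2) = 1"
    and drift: "filterlim (\<lambda>n. \<bar>\<Sum>j<K. \<beta>0 $ j * (\<Sum>i<n. q n i * X n $$ (i, j))\<bar>) at_top sequentially"
  shows "(\<lambda>n. prob {\<omega>\<in>space M. \<bar>(\<Sum>i<n. q n i * Y n \<omega> $ i) / sg n \<omega>\<bar> < z}) \<longlonglongrightarrow> 0"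
proof -
  define d where "d n = (\<Sum>j<K. \<beta>0 $ j * (\<Sum>i<n. q n i * X n $$ (i, j)))" for n
  define W where "W n \<omega> = (\<Sum>i<n. q n i * \<epsilon> i \<omega>)" for n \<omega>
  have W_meas [measurable]: "W n \<in> borel_measurable M" for n unfolding W_def by measurable
  let ?A = "\<lambda>n. {\<omega>\<in>space M. \<bar>\<sigma>0 / sg n \<omega> - 1\<bar> \<ge> 1/2}"
  let ?B = "\<lambda>n. {\<omega>\<in>space M. (W n \<omega>)\<^sup>2 \<ge> (\<bar>d n\<bar> / 2)\<^sup>2}"
  have W_int: "integrable M (\<lambda>\<omega>. (W n \<omega>)\<^sup>2)" for n
    unfolding W_def by (rule integrable_square_sum_indep[OF _ eps_indep eps_sq eps_mean]) simp
  have W_exp: "expectation (\<lambda>\<omega>. (W n \<omega>)\<^sup>2) = \<sigma>0\<^sup>2" if "K < n" for n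
    unfolding W_def using expectation_square_sum_indep[OF _ eps_indep eps_sq eps_mean, of "{..<n}" "q n"] q[OF that]
    by (simp add: eps_var sum_distrib_right[symmetric])
  have dlim: "filterlim (\<lambda>n. \<bar>d n\<bar>) at_top sequentially" using drift by (simp add: d_def)
  have B_lim: "(\<lambda>n. prob (?B n)) \<longlonglongrightarrow> 0"
  proof (rule tendsto_sandwich[OF _ _ tendsto_const])
    have "\<forall>\<^sub>F n in sequentially. \<bar>d n\<bar> \<ge> 1" using dlim unfolding filterlim_at_top by blast
    then show "\<forall>\<^sub>F n in sequentially. prob (?B n) \<le> \<sigma>0\<^sup>2 / (\<bar>d n\<bar> / 2)\<^sup>2"
      using eventually_gt_at_top[of K]
    proof eventually_elim
      case (elim n)
      have "prob (?B n) \<le> expectation (\<lambda>\<omega>. (W n \<omega>)\<^sup>2) / (\<bar>d n\<bar> / 2)\<^sup>2"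
        by (rule integral_Markov_inequality_measure[where A="{}"]) (use W_int elim in auto)
      then show ?case using W_exp elim by simp
    qed
    have "((\<lambda>x::real. \<sigma>0\<^sup>2 / (x / 2)\<^sup>2) \<longlongrightarrow> 0) at_top" by real_asymp
    from filterlim_compose[OF this dlim] show "(\<lambda>n. \<sigma>0\<^sup>2 / (\<bar>d n\<bar> / 2)\<^sup>2) \<longlonglongrightarrow> 0" .
  qed simp
  \<comment> \<open>Half of this bound is \<open>2 * \<sigma>0 * (|z| + 1)\<close>, and dividing by
    \<open>sg n < 2 * \<sigma>0\<close> leaves at least \<open>|z| + 1\<close>, which exceeds
    \<open>z\<close>.\<close>
  have dlarge: "\<forall>\<^sub>F n in sequentially. \<bar>d n\<bar> \<ge> 4 * \<sigma>0 * (\<bar>z\<bar> + 1)" using dlim unfolding filterlim_at_top by blast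
  have lim: "(\<lambda>n. prob (?A n) + prob (?B n)) \<longlonglongrightarrow> 0"
    using tendsto_add[OF ratio_consistent[of "1/2"] B_lim] by simp
  show ?thesis
  proof (rule tendsto_sandwich[OF _ _ tendsto_const lim])
    show "\<forall>\<^sub>F n in sequentially. prob {\<omega>\<in>space M. \<bar>(\<Sum>i<n. q n i * Y n \<omega> $ i) / sg n \<omega>\<bar> < z} \<le> prob (?A n) + prob (?B n)"
      using dlarge eventually_gt_at_top[of K]
    proof eventually_elim
      case (elim n)
      note [measurable] = sg_measurable[OF elim(2)]
      have "{\<omega>\<in>space M. \<bar>(\<Sum>i<n. q n i * Y n \<omega> $ i) / sg n \<omega>\<bar> < z} \<subseteq> ?A n \<union> ?B n"
      proof (rule subsetI, rule ccontr)
        fix \<omega> assume w: "\<omega> \<in> {\<omega>\<in>space M. \<bar>(\<Sum>i<n. q n i * Y n \<omega> $ i) / sg n \<omega>\<bar> < z}"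
          and nw: "\<omega> \<notin> ?A n \<union> ?B n"
        have 1: "\<bar>\<sigma>0 / sg n \<omega> - 1\<bar> < 1/2" and 2: "(W n \<omega>)\<^sup>2 < (\<bar>d n\<bar> / 2)\<^sup>2" using w nw by auto
        have r: "\<sigma>0 / sg n \<omega> > 1/2" using 1 by linarith
        have W: "\<bar>W n \<omega>\<bar> < \<bar>d n\<bar> / 2" by (rule power2_less_imp_less) (use 2 in auto)
        have "(\<Sum>i<n. q n i * Y n \<omega> $ i) = d n + W n \<omega>" unfolding sum_Y[OF elim(2)] d_def W_def ..
        then have "\<bar>(\<Sum>i<n. q n i * Y n \<omega> $ i)\<bar> \<ge> \<bar>d n\<bar> / 2" using W by linarith
        then have big: "\<bar>(\<Sum>i<n. q n i * Y n \<omega> $ i)\<bar> \<ge> 2 * \<sigma>0 * (\<bar>z\<bar> + 1)" using elim by linarith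
        \<comment> \<open>A zero denominator would give the quotient 0, contradicting
          \<open>r\<close>.\<close>
        have sgp: "sg n \<omega> > 0" using r sg_nonneg[of n \<omega>] by (cases "sg n \<omega> = 0") auto
        have "sg n \<omega> < 2 * \<sigma>0" using r sgp by (simp add: field_simps)
        then have "sg n \<omega> * (\<bar>z\<bar> + 1) \<le> 2 * \<sigma>0 * (\<bar>z\<bar> + 1)" by (intro mult_right_mono) auto
        then have "\<bar>z\<bar> + 1 \<le> \<bar>(\<Sum>i<n. q n i * Y n \<omega> $ i)\<bar> / sg n \<omega>"
          using big sgp by (simp add: pos_le_divide_eq mult.commute)
        moreover have "\<bar>(\<Sum>i<n. q n i * Y n \<omega> $ i)\<bar> / sg n \<omega> < z" using w sgp by simp
        ultimately show False by linarith
      qed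
      then have "prob {\<omega>\<in>space M. \<bar>(\<Sum>i<n. q n i * Y n \<omega> $ i) / sg n \<omega>\<bar> < z} \<le> prob (?A n \<union> ?B n)"
        by (intro finite_measure_mono) auto
      also have "\<dots> \<le> prob (?A n) + prob (?B n)" by (intro measure_Un_le) auto
      finally show ?case .
    qed
  qed simp
qed

text \<open>Up to sign the \<open>q n k\<close> are the Gram-Schmidt vectors of the columns: each
  lies in the span of the first \<open>k\<close> columns and is orthogonal to the earlier ones.
  Since \<open>q n k\<close> has norm 1, \<open>lower_bound\<close> gives
  \<open>n * \<kappa> * |b|^2 \<le> 1\<close> for large \<open>n\<close>. This is used twice: by
  Cauchy-Schwarz each coordinate is at most the largest row norm over
  \<open>sqrt (n * \<kappa>)\<close>; and at \<open>k0\<close>, where the last coefficient times the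
  inner product with the last column is 1, that inner product is at least
  \<open>sqrt (n * \<kappa>)\<close> in absolute value.\<close>

lemma contrasts:
  obtains q :: "nat \<Rightarrow> nat \<Rightarrow> nat \<Rightarrow> real" and m :: "nat \<Rightarrow> real" where
    "\<And>n j l. K < n \<Longrightarrow> j \<in> {1..K} \<Longrightarrow> l \<in> {1..K} \<Longrightarrow> (\<Sum>i<n. q n j i * q n l i) = (if j = l then 1 else 0)"
    "\<forall>\<^sub>F n in sequentially. \<forall>j\<in>{1..K}. \<forall>i<n. \<bar>q n j i\<bar> \<le> m n" "m \<longlonglongrightarrow> 0"
    "\<And>n j \<omega>. K < n \<Longrightarrow> j \<in> {1..K} \<Longrightarrow> Z_tilde (X n) (Y n \<omega>) j = (\<Sum>i<n. q n j i * Y n \<omega> $ i) / sg n \<omega>"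
    "\<And>n j. K < n \<Longrightarrow> j \<in> {k0+1..K} \<Longrightarrow> (\<Sum>l<K. \<beta>0 $ l * (\<Sum>i<n. q n j i * X n $$ (i, l))) = 0"
    "filterlim (\<lambda>n. \<bar>\<Sum>l<K. \<beta>0 $ l * (\<Sum>i<n. q n k0 i * X n $$ (i, l))\<bar>) at_top sequentially"
proof -
  define P where "P n k q b \<longleftrightarrow> (\<forall>i<n. q i = (\<Sum>j<k. b j * X n $$ (i, j))) \<and> (\<Sum>i<n. (q i)\<^sup>2) = 1 \<and>
      (\<forall>j<k - 1. (\<Sum>i<n. q i * X n $$ (i, j)) = 0) \<and> b (k - 1) * (\<Sum>i<n. q i * X n $$ (i, k - 1)) = 1 \<and>
      (\<forall>y\<in>carrier_vec n. Z_tilde (X n) y k = (\<Sum>i<n. q i * y $ i) / sigma_hat (X n) y)"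
    for n k and q b :: "nat \<Rightarrow> real"
  \<comment> \<open>Contrasts exist separately for each sample size and each \<open>k\<close>;
    choice over pairs collects them, with the guards inside the existential.\<close>
  have "\<forall>x. \<exists>p. K < fst x \<longrightarrow> snd x \<in> {1..K} \<longrightarrow> P (fst x) (snd x) (fst p) (snd p)"
  proof
    fix x :: "nat \<times> nat"
    show "\<exists>p. K < fst x \<longrightarrow> snd x \<in> {1..K} \<longrightarrow> P (fst x) (snd x) (fst p) (snd p)"
    proof (cases "K < fst x \<and> snd x \<in> {1..K}")
      case True
      then have n: "K < fst x" "fst x > 0" and k: "1 \<le> snd x" "snd x \<le> K" by auto
      obtain q b where "P (fst x) (snd x) q b"
        unfolding P_def by (rule Z_tilde_contrast[OF Xdim[OF n(1)] X_pd[OF n(1)] n(2) k]) blast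
      then show ?thesis by (intro exI[of _ "(q, b)"]) simp
    qed blast
  qed
  from choice[OF this] obtain f where f: "\<And>n k. K < n \<Longrightarrow> k \<in> {1..K} \<Longrightarrow> P n k (fst (f (n, k))) (snd (f (n, k)))"
    by auto
  define q where "q n k = fst (f (n, k))" for n k
  define b where "b n k = snd (f (n, k))" for n k
  have q_span: "q n k i = (\<Sum>j<k. b n k j * X n $$ (i, j))" if "K < n" "k \<in> {1..K}" "i < n" for n k i
    using f[OF that(1,2)] that(3) unfolding P_def q_def b_def by blast
  have q_norm: "(\<Sum>i<n. (q n k i)\<^sup>2) = 1" if "K < n" "k \<in> {1..K}" for n k
    using f[OF that] unfolding P_def q_def b_def by blast
  have q_orth: "(\<Sum>i<n. q n k i * X n $$ (i, j)) = 0" if "K < n" "k \<in> {1..K}" "j < k - 1" for n k j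
    using f[OF that(1,2)] that(3) unfolding P_def q_def b_def by blast
  have q_last: "b n k (k - 1) * (\<Sum>i<n. q n k i * X n $$ (i, k - 1)) = 1" if "K < n" "k \<in> {1..K}" for n k
    using f[OF that] unfolding P_def q_def b_def by blast
  have q_Z: "Z_tilde (X n) y k = (\<Sum>i<n. q n k i * y $ i) / sigma_hat (X n) y" if "K < n" "k \<in> {1..K}" "y \<in> carrier_vec n" for n k y
    using f[OF that(1,2)] that(3) unfolding P_def q_def b_def by blast
  have orth_less: "(\<Sum>i<n. q n j i * q n l i) = 0" if n: "K < n" and j: "j \<in> {1..K}" and l: "l \<in> {1..K}" and jl: "j < l" for n j l
  proof -
    have "(\<Sum>i<n. q n j i * q n l i) = (\<Sum>i<n. \<Sum>m<j. b n j m * (q n l i * X n $$ (i, m)))"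
    proof (rule sum.cong[OF refl])
      fix i assume "i \<in> {..<n}"
      then have "q n j i = (\<Sum>m<j. b n j m * X n $$ (i, m))" by (simp add: q_span[OF n j])
      then show "q n j i * q n l i = (\<Sum>m<j. b n j m * (q n l i * X n $$ (i, m)))"
        by (simp only: sum_distrib_right) (simp add: mult_ac)
    qed
    also have "\<dots> = (\<Sum>m<j. \<Sum>i<n. b n j m * (q n l i * X n $$ (i, m)))" by (rule sum.swap)
    also have "\<dots> = (\<Sum>m<j. b n j m * (\<Sum>i<n. q n l i * X n $$ (i, m)))" by (simp add: sum_distrib_left)
    also have "\<dots> = 0" using q_orth[OF n l] jl by (intro sum.neutral) auto
    finally show ?thesis .
  qed
  have 1: "(\<Sum>i<n. q n j i * q n l i) = (if j = l then 1 else 0)" if "K < n" "j \<in> {1..K}" "l \<in> {1..K}" for n j l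
  proof (cases j l rule: linorder_cases)
    case less
    then show ?thesis using orth_less[of n j l] that by simp
  next
    case equal
    then show ?thesis using q_norm[OF that(1,2)] by (simp add: power2_eq_square)
  next
    case greater
    then show ?thesis using orth_less[of n l j] that by (simp add: mult.commute)
  qed
  obtain \<kappa> where \<kappa>: "\<kappa> > 0" and low: "\<forall>\<^sub>F n in sequentially. \<forall>v. real n * \<kappa> * (\<Sum>j<K. (v j)\<^sup>2) \<le> (\<Sum>i<n. (\<Sum>j<K. X n $$ (i, j) * v j)\<^sup>2)"
    by (rule lower_bound)
  have b_bound: "\<forall>\<^sub>F n in sequentially. K < n \<and> (\<forall>k\<in>{1..K}. real n * \<kappa> * (\<Sum>j<k. (b n k j)\<^sup>2) \<le> 1)"
    using low eventually_gt_at_top[of K]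
  proof eventually_elim
    case (elim n)
    show ?case
    proof (intro conjI ballI)
      show n: "K < n" by fact
      fix k assume k: "k \<in> {1..K}"
      \<comment> \<open>Padding with zeros makes the lower bound for all \<open>K\<close> columns
        applicable to coefficients on \<open>k\<close> of them.\<close>
      define v where "v j = (if j < k then b n k j else 0)" for j
      have ext: "(\<Sum>j<K. h j (v j)) = (\<Sum>j<k. h j (b n k j))" if "\<And>j. h j 0 = (0::real)" for h
      proof -
        have "(\<Sum>j<K. h j (v j)) = (\<Sum>j<k. h j (v j))"
          by (rule sum.mono_neutral_right) (use k that in \<open>auto simp: v_def\<close>)
        then show ?thesis by (simp add: v_def)
      qed
      have "real n * \<kappa> * (\<Sum>j<k. (b n k j)\<^sup>2) = real n * \<kappa> * (\<Sum>j<K. (v j)\<^sup>2)"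
        using ext[of "\<lambda>_ x. x\<^sup>2"] by simp
      also have "\<dots> \<le> (\<Sum>i<n. (\<Sum>j<K. X n $$ (i, j) * v j)\<^sup>2)" using elim by blast
      also have "\<dots> = (\<Sum>i<n. (q n k i)\<^sup>2)"
        using ext[of "\<lambda>j x. X n $$ (_, j) * x"] by (intro sum.cong refl) (simp add: q_span[OF n k] mult.commute)
      also have "\<dots> = 1" by (rule q_norm[OF n k])
      finally show "real n * \<kappa> * (\<Sum>j<k. (b n k j)\<^sup>2) \<le> 1" .
    qed
  qed
  define mx where "mx n = Max ((\<lambda>i. sqrt (\<Sum>k<K. (X n $$ (i,k))\<^sup>2)) ` {..<n})" for n
  define m where "m n = mx n / sqrt (real n) / sqrt \<kappa>" for n
  have 3: "m \<longlonglongrightarrow> 0"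
    unfolding m_def mx_def using tendsto_divide[OF X_max tendsto_const[of "sqrt \<kappa>"]] \<kappa> by simp
  have 2: "\<forall>\<^sub>F n in sequentially. \<forall>j\<in>{1..K}. \<forall>i<n. \<bar>q n j i\<bar> \<le> m n"
    using b_bound
  proof eventually_elim
    case (elim n)
    then have n: "K < n" by blast
    show ?case
    proof (intro ballI allI impI)
      fix k i assume k: "k \<in> {1..K}" and i: "i < n"
      have mxi: "sqrt (\<Sum>k<K. (X n $$ (i,k))\<^sup>2) \<le> mx n"
        unfolding mx_def using i by (intro Max_ge) auto
      have mx0: "0 \<le> mx n" by (rule order_trans[OF _ mxi]) (simp add: sum_nonneg)
      have m0: "0 \<le> m n" unfolding m_def using mx0 \<kappa> by simp
      have "(q n k i)\<^sup>2 \<le> (\<Sum>j<k. (b n k j)\<^sup>2) * (\<Sum>j<k. (X n $$ (i, j))\<^sup>2)"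
        unfolding q_span[OF n k i] by (rule Cauchy_Schwarz_ineq_sum)
      also have "\<dots> \<le> (1 / (real n * \<kappa>)) * (mx n)\<^sup>2"
      proof (rule mult_mono)
        show "(\<Sum>j<k. (b n k j)\<^sup>2) \<le> 1 / (real n * \<kappa>)"
          using elim k n \<kappa> by (simp add: pos_le_divide_eq mult.commute)
        have "(\<Sum>j<k. (X n $$ (i, j))\<^sup>2) \<le> (\<Sum>j<K. (X n $$ (i, j))\<^sup>2)"
          using k by (intro sum_mono2) auto
        also have "\<dots> = (sqrt (\<Sum>j<K. (X n $$ (i, j))\<^sup>2))\<^sup>2" by (simp add: sum_nonneg)
        also have "\<dots> \<le> (mx n)\<^sup>2" using mxi by (intro power_mono) (auto simp: sum_nonneg)
        finally show "(\<Sum>j<k. (X n $$ (i, j))\<^sup>2) \<le> (mx n)\<^sup>2" .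
      qed (use \<kappa> in \<open>auto intro!: sum_nonneg\<close>)
      also have "\<dots> = (m n)\<^sup>2" unfolding m_def power_divide using \<kappa> by simp
      finally show "\<bar>q n k i\<bar> \<le> m n" using m0 by (simp add: abs_le_square_iff[symmetric])
    qed
  qed
  have 4: "Z_tilde (X n) (Y n \<omega>) j = (\<Sum>i<n. q n j i * Y n \<omega> $ i) / sg n \<omega>" if "K < n" "j \<in> {1..K}" for n j \<omega>
    using q_Z[OF that Y_carrier[OF that(1)]] .
  have 5: "(\<Sum>l<K. \<beta>0 $ l * (\<Sum>i<n. q n j i * X n $$ (i, l))) = 0" if n: "K < n" and j: "j \<in> {k0+1..K}" for n j
  proof (rule sum.neutral, rule ballI)
    fix l assume l: "l \<in> {..<K}"
    \<comment> \<open>Either \<open>l < j - 1\<close> and the column is orthogonal to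
      \<open>q n j\<close>, or \<open>l \<ge> j - 1 \<ge> k0\<close> and the coefficient is
      zero.\<close>
    show "\<beta>0 $ l * (\<Sum>i<n. q n j i * X n $$ (i, l)) = 0"
      using q_orth[OF n, of j l] beta0(3)[of l] j l by (cases "l < j - 1") auto
  qed
  define t where "t n = (\<Sum>i<n. q n k0 i * X n $$ (i, k0 - 1))" for n
  \<comment> \<open>Columns before index \<open>k0 - 1\<close> are orthogonal to the contrast and
    those after it have zero coefficient, so a single term survives.\<close>
  have drift: "(\<Sum>l<K. \<beta>0 $ l * (\<Sum>i<n. q n k0 i * X n $$ (i, l))) = \<beta>0 $ (k0 - 1) * t n" if n: "K < n" for n
  proof -
    have "(\<Sum>l<K. \<beta>0 $ l * (\<Sum>i<n. q n k0 i * X n $$ (i, l))) = (\<Sum>l<K. if l = k0 - 1 then \<beta>0 $ (k0 - 1) * t n else 0)"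
    proof (rule sum.cong[OF refl])
      fix l assume l: "l \<in> {..<K}"
      consider "l < k0 - 1" | "l = k0 - 1" | "l \<ge> k0" using k0 by linarith
      then show "\<beta>0 $ l * (\<Sum>i<n. q n k0 i * X n $$ (i, l)) = (if l = k0 - 1 then \<beta>0 $ (k0 - 1) * t n else 0)"
        using q_orth[OF n, of k0 l] beta0(3)[of l] k0 l by cases (auto simp: t_def)
    qed
    then show ?thesis using k0 by simp
  qed
  have "\<forall>\<^sub>F n in sequentially. \<bar>\<beta>0 $ (k0 - 1)\<bar> * sqrt (real n * \<kappa>) \<le> \<bar>\<Sum>l<K. \<beta>0 $ l * (\<Sum>i<n. q n k0 i * X n $$ (i, l))\<bar>"
    using b_bound
  proof eventually_elim
    case (elim n)
    then have n: "K < n" by blast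
    have k0K: "k0 \<in> {1..K}" using k0 by auto
    have bt: "b n k0 (k0 - 1) * t n = 1" unfolding t_def by (rule q_last[OF n k0K])
    have nk: "real n * \<kappa> > 0" using n \<kappa> by simp
    have "(b n k0 (k0 - 1))\<^sup>2 \<le> (\<Sum>j<k0. (b n k0 j)\<^sup>2)"
      using k0 by (intro member_le_sum) auto
    then have "real n * \<kappa> * (b n k0 (k0 - 1))\<^sup>2 \<le> real n * \<kappa> * (\<Sum>j<k0. (b n k0 j)\<^sup>2)"
      using nk by (intro mult_left_mono) auto
    also have "\<dots> \<le> 1" using elim k0K by blast
    finally have "real n * \<kappa> * (b n k0 (k0 - 1))\<^sup>2 * (t n)\<^sup>2 \<le> 1 * (t n)\<^sup>2" by (intro mult_right_mono) auto
    moreover have "(b n k0 (k0 - 1))\<^sup>2 * (t n)\<^sup>2 = 1" using bt by (simp add: power_mult_distrib[symmetric])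
    ultimately have "real n * \<kappa> \<le> (t n)\<^sup>2" by (simp add: mult.assoc)
    then have "sqrt (real n * \<kappa>) \<le> \<bar>t n\<bar>" by (metis real_sqrt_abs real_sqrt_le_iff)
    then show ?case unfolding drift[OF n] abs_mult by (intro mult_left_mono) auto
  qed
  moreover have "filterlim (\<lambda>n. \<bar>\<beta>0 $ (k0 - 1)\<bar> * sqrt (real n * \<kappa>)) at_top sequentially"
  proof -
    have "\<bar>\<beta>0 $ (k0 - 1)\<bar> > 0" using beta0(2)[of "k0 - 1"] k0 by simp
    then show ?thesis using \<kappa> by real_asymp
  qed
  ultimately have 6: "filterlim (\<lambda>n. \<bar>\<Sum>l<K. \<beta>0 $ l * (\<Sum>i<n. q n k0 i * X n $$ (i, l))\<bar>) at_top sequentially"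
    by (rule filterlim_at_top_mono[rotated])
  show ?thesis by (rule that[of q m, OF 1 2 3 4 5 6])
qed

section \<open>The statistics at zero and at nonzero coefficients\<close>

lemma Z_tilde_measurable:
  assumes n: "K < n" shows "(\<lambda>\<omega>. Z_tilde (X n) (Y n \<omega>) j) \<in> borel_measurable M"
proof (cases "j \<in> {1..K}")
  case True
  obtain q :: "nat \<Rightarrow> nat \<Rightarrow> nat \<Rightarrow> real" where "\<And>n j \<omega>. K < n \<Longrightarrow> j \<in> {1..K} \<Longrightarrow> Z_tilde (X n) (Y n \<omega>) j = (\<Sum>i<n. q n j i * Y n \<omega> $ i) / sg n \<omega>"
    using contrasts by metis
  from this[OF n True] show ?thesis
    by (simp only:) (intro borel_measurable_divide borel_measurable_sum borel_measurable_times borel_measurable_const Y_index_measurable[OF n] sg_measurable[OF n]; simp)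
next
  case False
  have "dim_col (X n) = K" using Xdim[OF n] by simp
  then show ?thesis using False by (auto simp: Z_tilde_def)
qed

lemma Z_tilde_k0_diverges: "(\<lambda>n. prob {\<omega>\<in>space M. \<bar>Z_tilde (X n) (Y n \<omega>) k0\<bar> < z}) \<longlonglongrightarrow> 0"
proof -
  obtain q m where q: "\<And>n j l. K < n \<Longrightarrow> j \<in> {1..K} \<Longrightarrow> l \<in> {1..K} \<Longrightarrow> (\<Sum>i<n. q n j i * q n l i) = (if j = l then 1 else (0::real))"
    "\<And>n j \<omega>. K < n \<Longrightarrow> j \<in> {1..K} \<Longrightarrow> Z_tilde (X n) (Y n \<omega>) j = (\<Sum>i<n. q n j i * Y n \<omega> $ i) / sg n \<omega>"
    "filterlim (\<lambda>n. \<bar>\<Sum>l<K. \<beta>0 $ l * (\<Sum>i<n. q n k0 i * X n $$ (i, l))\<bar>) at_top sequentially"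
    by (rule contrasts) blast
  have k0K: "k0 \<in> {1..K}" using k0 by auto
  have "(\<lambda>n. prob {\<omega>\<in>space M. \<bar>(\<Sum>i<n. q n k0 i * Y n \<omega> $ i) / sg n \<omega>\<bar> < z}) \<longlonglongrightarrow> 0"
    by (rule divergent_drift[OF _ q(3)]) (use q(1)[OF _ k0K k0K] in \<open>simp add: power2_eq_square\<close>)
  then show ?thesis
  proof (rule Lim_transform_eventually)
    show "\<forall>\<^sub>F n in sequentially. prob {\<omega>\<in>space M. \<bar>(\<Sum>i<n. q n k0 i * Y n \<omega> $ i) / sg n \<omega>\<bar> < z} = prob {\<omega>\<in>space M. \<bar>Z_tilde (X n) (Y n \<omega>) k0\<bar> < z}"
      using eventually_gt_at_top[of K] by eventually_elim (simp only: q(2)[OF _ k0K])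
  qed
qed

text \<open>Here the contrast at \<open>k\<close> is column index \<open>k - 1\<close> divided by
  \<open>sqrt n\<close>. It is orthogonal to all other columns, later ones included, so its drift is
  \<open>sqrt n\<close> times one nonzero coefficient and nothing can cancel it.\<close>

lemma Z_tilde_diverges_orthonormal:
  assumes I: "\<And>n. K < n \<Longrightarrow> (1 / real n) \<cdot>\<^sub>m (transpose_mat (X n) * X n) = 1\<^sub>m K" and k: "k \<in> {1..k0}"
  shows "(\<lambda>n. prob {\<omega>\<in>space M. \<bar>Z_tilde (X n) (Y n \<omega>) k\<bar> < z}) \<longlonglongrightarrow> 0"
proof -
  define q where "q n i = X n $$ (i, k - 1) / sqrt (real n)" for n i
  have k': "1 \<le> k" "k \<le> K" "k - 1 < K" "k - 1 < k0" using k k0 by auto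
  have gram: "(\<Sum>i<n. X n $$ (i, k - 1) * X n $$ (i, l)) = (if l = k - 1 then real n else 0)" if n: "K < n" and l: "l < K" for n l
  proof -
    have "((1 / real n) \<cdot>\<^sub>m (transpose_mat (X n) * X n)) $$ (k - 1, l) = (1 / real n) * (\<Sum>i<n. X n $$ (i, k - 1) * X n $$ (i, l))"
      using Xdim[OF n] k' l gram_index[OF Xdim[OF n] k'(3) l] by simp
    then have "(1 / real n) * (\<Sum>i<n. X n $$ (i, k - 1) * X n $$ (i, l)) = (if l = k - 1 then 1 else 0)"
      unfolding I[OF n] using k' l by auto
    then show ?thesis using n by (auto split: if_splits)
  qed
  have norm: "(\<Sum>i<n. (q n i)\<^sup>2) = 1" if n: "K < n" for n
    using X_sq[OF n k'(3)] n by (simp add: q_def power_divide sum_divide_distrib[symmetric])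
  have drift: "(\<Sum>j<K. \<beta>0 $ j * (\<Sum>i<n. q n i * X n $$ (i, j))) = \<beta>0 $ (k - 1) * sqrt (real n)" if n: "K < n" for n
  proof -
    have "(\<Sum>j<K. \<beta>0 $ j * (\<Sum>i<n. q n i * X n $$ (i, j))) = (\<Sum>j<K. if j = k - 1 then \<beta>0 $ j * (real n / sqrt (real n)) else 0)"
      using gram[OF n] by (intro sum.cong refl) (auto simp: q_def sum_divide_distrib[symmetric])
    then show ?thesis using k' by (simp add: real_div_sqrt)
  qed
  have "(\<lambda>n. prob {\<omega>\<in>space M. \<bar>(\<Sum>i<n. q n i * Y n \<omega> $ i) / sg n \<omega>\<bar> < z}) \<longlonglongrightarrow> 0"
  proof (rule divergent_drift[OF norm])
    have "\<bar>\<beta>0 $ (k - 1)\<bar> > 0" using beta0(2)[OF k'(4)] by simp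
    then have "filterlim (\<lambda>n. \<bar>\<beta>0 $ (k - 1)\<bar> * sqrt (real n)) at_top sequentially" by real_asymp
    then show "filterlim (\<lambda>n. \<bar>\<Sum>j<K. \<beta>0 $ j * (\<Sum>i<n. q n i * X n $$ (i, j))\<bar>) at_top sequentially"
    proof (rule filterlim_cong[OF refl refl, THEN iffD1, rotated])
      show "\<forall>\<^sub>F n in sequentially. \<bar>\<beta>0 $ (k - 1)\<bar> * sqrt (real n) = \<bar>\<Sum>j<K. \<beta>0 $ j * (\<Sum>i<n. q n i * X n $$ (i, j))\<bar>"
        using eventually_gt_at_top[of K] by eventually_elim (simp add: drift abs_mult)
    qed
  qed
  then show ?thesis
  proof (rule Lim_transform_eventually)
    show "\<forall>\<^sub>F n in sequentially. prob {\<omega>\<in>space M. \<bar>(\<Sum>i<n. q n i * Y n \<omega> $ i) / sg n \<omega>\<bar> < z} = prob {\<omega>\<in>space M. \<bar>Z_tilde (X n) (Y n \<omega>) k\<bar> < z}"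
      using eventually_gt_at_top[of K]
    proof eventually_elim
      case (elim n)
      have "n > 0" using elim by simp
      from Z_orthonormal(1)[OF Xdim[OF elim] this I[OF elim] Y_carrier[OF elim] k'(1,2)] show ?case by (simp add: q_def)
    qed
  qed
qed

text \<open>\<open>B\<close> prescribes the rejections, and comparing with \<open>j \<in> B\<close>
  treats both outcomes in one formula; taking \<open>B\<close> empty, a singleton, an interval or a
  running subset serves all three estimators. On \<open>J\<close> the mean drops out of the
  statistic, and each outcome is a set whose frontier has at most two points, hence normal measure
  0.\<close>

lemma rejection_set_limit:
  assumes J: "J \<subseteq> {k0+1..K}"
    and z: "\<And>j. j \<in> {1..K} \<Longrightarrow> measure std_normal_distribution {w. z j \<le> \<bar>w\<bar>} = \<alpha> j"
      "\<And>j. j \<in> {1..K} \<Longrightarrow> measure std_normal_distribution {w. \<bar>w\<bar> < z j} = 1 - \<alpha> j"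
  shows "(\<lambda>n. prob {\<omega>\<in>space M. \<forall>j\<in>J. (z j \<le> \<bar>Z_tilde (X n) (Y n \<omega>) j\<bar>) = (j \<in> B)}) \<longlonglongrightarrow> (\<Prod>j\<in>J. if j \<in> B then \<alpha> j else 1 - \<alpha> j)"
proof -
  obtain q m where q: "\<And>n j l. K < n \<Longrightarrow> j \<in> {1..K} \<Longrightarrow> l \<in> {1..K} \<Longrightarrow> (\<Sum>i<n. q n j i * q n l i) = (if j = l then 1 else (0::real))"
    "\<forall>\<^sub>F n in sequentially. \<forall>j\<in>{1..K}. \<forall>i<n. \<bar>q n j i\<bar> \<le> m n" "m \<longlonglongrightarrow> 0"
    "\<And>n j \<omega>. K < n \<Longrightarrow> j \<in> {1..K} \<Longrightarrow> Z_tilde (X n) (Y n \<omega>) j = (\<Sum>i<n. q n j i * Y n \<omega> $ i) / sg n \<omega>"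
    "\<And>n j. K < n \<Longrightarrow> j \<in> {k0+1..K} \<Longrightarrow> (\<Sum>l<K. \<beta>0 $ l * (\<Sum>i<n. q n j i * X n $$ (i, l))) = 0"
    by (rule contrasts) blast
  have J1: "J \<subseteq> {1..K}" using J by auto
  define A where "A j = (if j \<in> B then {w. z j \<le> \<bar>w\<bar>} else {w. \<bar>w\<bar> < z j})" for j
  have "(\<lambda>n. prob {\<omega>\<in>space M. \<forall>j\<in>J. (\<Sum>i<n. q n j i * \<epsilon> i \<omega>) / sg n \<omega> \<in> A j}) \<longlonglongrightarrow> (\<Prod>j\<in>J. measure std_normal_distribution (A j))"
  proof (rule studentized_joint_limit[OF _ _ _ q(3)])
    show "finite J" using J by (rule finite_subset) simp
    show "(\<Sum>i<n. q n j i * q n l i) = (if j = l then 1 else 0)" if "K < n" "j \<in> J" "l \<in> J" for n j l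
      using q(1) that J1 by blast
    show "\<forall>\<^sub>F n in sequentially. \<forall>j\<in>J. \<forall>i<n. \<bar>q n j i\<bar> \<le> m n"
      using q(2) by eventually_elim (use J1 in blast)
    show "A j \<in> sets borel" for j unfolding A_def by (cases "j \<in> B") auto
    fix j assume "j \<in> J"
    have "frontier (A j) \<subseteq> {- z j, z j}"
      unfolding A_def using frontier_abs_less[of "z j"] frontier_abs_ge[of "z j"] by simp
    then have "finite (frontier (A j))" by (rule finite_subset) simp
    then show "emeasure std_normal_distribution (frontier (A j)) = 0" by (rule emeasure_std_normal_finite)
  qed
  moreover have "(\<Prod>j\<in>J. measure std_normal_distribution (A j)) = (\<Prod>j\<in>J. if j \<in> B then \<alpha> j else 1 - \<alpha> j)"
    by (rule prod.cong[OF refl]) (use z J1 in \<open>auto simp: A_def\<close>)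
  ultimately have L: "(\<lambda>n. prob {\<omega>\<in>space M. \<forall>j\<in>J. (\<Sum>i<n. q n j i * \<epsilon> i \<omega>) / sg n \<omega> \<in> A j}) \<longlonglongrightarrow> (\<Prod>j\<in>J. if j \<in> B then \<alpha> j else 1 - \<alpha> j)"
    by simp
  show ?thesis
  proof (rule Lim_transform_eventually[OF L])
    show "\<forall>\<^sub>F n in sequentially. prob {\<omega>\<in>space M. \<forall>j\<in>J. (\<Sum>i<n. q n j i * \<epsilon> i \<omega>) / sg n \<omega> \<in> A j} =
        prob {\<omega>\<in>space M. \<forall>j\<in>J. (z j \<le> \<bar>Z_tilde (X n) (Y n \<omega>) j\<bar>) = (j \<in> B)}"
      using eventually_gt_at_top[of K]
    proof eventually_elim
      case (elim n)
      have "Z_tilde (X n) (Y n \<omega>) j = (\<Sum>i<n. q n j i * \<epsilon> i \<omega>) / sg n \<omega>" if "j \<in> J" for j \<omega>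
      proof -
        have j: "j \<in> {1..K}" "j \<in> {k0+1..K}" using that J J1 by auto
        show ?thesis unfolding q(4)[OF elim j(1)] sum_Y[OF elim] q(5)[OF elim j(2)] by simp
      qed
      then have "((\<Sum>i<n. q n j i * \<epsilon> i \<omega>) / sg n \<omega> \<in> A j) = ((z j \<le> \<bar>Z_tilde (X n) (Y n \<omega>) j\<bar>) = (j \<in> B))" if "j \<in> J" for j \<omega>
        using that by (auto simp: A_def)
      then show ?case by simp
    qed
  qed
qed

end

section \<open>Limits of the selection probabilities\<close>

text \<open>\<open>z\<close> holds the real values of the extended-real thresholds at
  \<open>1..K\<close> together with their exact normal tail masses, so that the limits can be
  derived without returning to \<open>zq\<close>.\<close>

locale selection_model = linear_model +
  fixes \<alpha> z :: "nat \<Rightarrow> real"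
  assumes \<alpha>: "\<And>j. j \<in> {1..K} \<Longrightarrow> 0 < \<alpha> j \<and> \<alpha> j < 1" "\<alpha> (Suc K) = 0"
    and thr_z: "\<And>j. j \<in> {1..K} \<Longrightarrow> thr \<alpha> j = ereal (z j)"
    and z: "\<And>j. j \<in> {1..K} \<Longrightarrow> measure std_normal_distribution {w. z j \<le> \<bar>w\<bar>} = \<alpha> j"
      "\<And>j. j \<in> {1..K} \<Longrightarrow> measure std_normal_distribution {w. \<bar>w\<bar> < z j} = 1 - \<alpha> j"
begin

abbreviation Zt :: "nat \<Rightarrow> nat \<Rightarrow> 'a \<Rightarrow> real" where "Zt n j \<omega> \<equiv> Z_tilde (X n) (Y n \<omega>) j"

lemma dim_X: "K < n \<Longrightarrow> dim_col (X n) = K"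
  using Xdim[of n] by simp

lemma not_rejected_event: "K < n \<Longrightarrow> {\<omega>\<in>space M. \<bar>Zt n j \<omega>\<bar> < z j} \<in> events"
proof -
  assume "K < n"
  note [measurable] = Z_tilde_measurable[OF this]
  show ?thesis by measurable
qed

lemma rejection_set_event: "K < n \<Longrightarrow> finite J \<Longrightarrow> {\<omega>\<in>space M. \<forall>j\<in>J. (z j \<le> \<bar>Zt n j \<omega>\<bar>) = (j \<in> B)} \<in> events"
proof -
  assume "K < n" and J: "finite J"
  note [measurable] = Z_tilde_measurable[OF this(1)]
  have "countable J" using J by (rule countable_finite)
  then show ?thesis by measurable
qed

lemma k_B_event:
  assumes "K < n" "k \<in> {1..K}"
  shows "{\<omega>\<in>space M. k_B \<alpha> (X n) (Y n \<omega>) = k} = {\<omega>\<in>space M. z k \<le> \<bar>Zt n k \<omega>\<bar> \<and> (\<forall>j\<in>{k+1..K}. \<bar>Zt n j \<omega>\<bar> < z j)}"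
proof -
  have "k_B \<alpha> (X n) (Y n \<omega>) = k \<longleftrightarrow> z k \<le> \<bar>Zt n k \<omega>\<bar> \<and> (\<forall>j\<in>{k+1..K}. \<bar>Zt n j \<omega>\<bar> < z j)" for \<omega>
    using assms k_B_eq_iff[OF dim_X[OF assms(1)], of k \<alpha>] by (auto simp: thr_z)
  then show ?thesis by simp
qed

text \<open>Selecting \<open>k < k0\<close> needs a failure to reject at \<open>k0\<close>, whose
  probability vanishes. For \<open>k = k0\<close> the rejection at \<open>k0\<close> is
  asymptotically certain, so only the absence of rejections beyond \<open>k0\<close> counts. For
  \<open>k > k0\<close> the event is exactly a pattern on \<open>{k..K}\<close> that rejects at
  \<open>k\<close> alone.\<close>

lemma k_B_limit:
  assumes k: "k \<in> {1..K}"
  shows "(\<lambda>n. prob {\<omega>\<in>space M. k_B \<alpha> (X n) (Y n \<omega>) = k}) \<longlonglongrightarrow>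
    (if k < k0 then 0 else if k = k0 then (\<Prod>j\<in>{k0+1..K}. 1 - \<alpha> j) else \<alpha> k * (\<Prod>j\<in>{k+1..K}. 1 - \<alpha> j))"
proof -
  consider "k < k0" | "k = k0" | "k > k0" by linarith
  then show ?thesis
  proof cases
    case 1
    have "(\<lambda>n. prob {\<omega>\<in>space M. k_B \<alpha> (X n) (Y n \<omega>) = k}) \<longlonglongrightarrow> 0"
    proof (rule prob_tendsto_0_mono[OF _ Z_tilde_k0_diverges[of "z k0"]])
      show "\<forall>\<^sub>F n in sequentially. {\<omega>\<in>space M. k_B \<alpha> (X n) (Y n \<omega>) = k} \<subseteq> {\<omega>\<in>space M. \<bar>Zt n k0 \<omega>\<bar> < z k0} \<and> {\<omega>\<in>space M. \<bar>Zt n k0 \<omega>\<bar> < z k0} \<in> events"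
        using eventually_gt_at_top[of K]
        by eventually_elim (use 1 k0 k in \<open>auto simp: k_B_event not_rejected_event\<close>)
    qed
    then show ?thesis using 1 by simp
  next
    case 2
    have "(\<lambda>n. prob {\<omega>\<in>space M. k_B \<alpha> (X n) (Y n \<omega>) = k}) \<longlonglongrightarrow> (\<Prod>j\<in>{k0+1..K}. if j \<in> {} then \<alpha> j else 1 - \<alpha> j)"
    proof (rule prob_tendsto_approx[OF _ Z_tilde_k0_diverges[of "z k0"] rejection_set_limit[OF order_refl z]])
      show "\<forall>\<^sub>F n in sequentially. {\<omega>\<in>space M. k_B \<alpha> (X n) (Y n \<omega>) = k} \<in> events \<and>
          {\<omega>\<in>space M. \<forall>j\<in>{k0+1..K}. (z j \<le> \<bar>Zt n j \<omega>\<bar>) = (j \<in> {})} \<in> events \<and>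
          {\<omega>\<in>space M. \<bar>Zt n k0 \<omega>\<bar> < z k0} \<in> events \<and>
          {\<omega>\<in>space M. k_B \<alpha> (X n) (Y n \<omega>) = k} \<subseteq> {\<omega>\<in>space M. \<forall>j\<in>{k0+1..K}. (z j \<le> \<bar>Zt n j \<omega>\<bar>) = (j \<in> {})} \<union> {\<omega>\<in>space M. \<bar>Zt n k0 \<omega>\<bar> < z k0} \<and>
          {\<omega>\<in>space M. \<forall>j\<in>{k0+1..K}. (z j \<le> \<bar>Zt n j \<omega>\<bar>) = (j \<in> {})} \<subseteq> {\<omega>\<in>space M. k_B \<alpha> (X n) (Y n \<omega>) = k} \<union> {\<omega>\<in>space M. \<bar>Zt n k0 \<omega>\<bar> < z k0}"
        using eventually_gt_at_top[of K]
      proof eventually_elim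
        case (elim n)
        note [measurable] = Z_tilde_measurable[OF elim]
        have "{\<omega>\<in>space M. k_B \<alpha> (X n) (Y n \<omega>) = k} \<in> events"
          unfolding k_B_event[OF elim k] by measurable
        then show ?case
          using rejection_set_event[OF elim, of "{k0+1..K}" "{}"] not_rejected_event[OF elim]
          unfolding k_B_event[OF elim k] using 2 by (auto simp: not_le)
      qed
    qed
    then show ?thesis using 2 by simp
  next
    case 3
    have "(\<lambda>n. prob {\<omega>\<in>space M. \<forall>j\<in>{k..K}. (z j \<le> \<bar>Zt n j \<omega>\<bar>) = (j \<in> {k})}) \<longlonglongrightarrow> (\<Prod>j\<in>{k..K}. if j \<in> {k} then \<alpha> j else 1 - \<alpha> j)"
      by (rule rejection_set_limit[OF _ z]) (use 3 in auto)
    moreover have "(\<Prod>j\<in>{k..K}. if j \<in> {k} then \<alpha> j else 1 - \<alpha> j) = \<alpha> k * (\<Prod>j\<in>{k+1..K}. 1 - \<alpha> j)"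
    proof -
      have "{k..K} = insert k {k+1..K}" using k by auto
      then have "(\<Prod>j\<in>{k..K}. if j \<in> {k} then \<alpha> j else 1 - \<alpha> j) = \<alpha> k * (\<Prod>j\<in>{k+1..K}. if j \<in> {k} then \<alpha> j else 1 - \<alpha> j)" by simp
      also have "(\<Prod>j\<in>{k+1..K}. if j \<in> {k} then \<alpha> j else 1 - \<alpha> j) = (\<Prod>j\<in>{k+1..K}. 1 - \<alpha> j)"
        by (rule prod.cong) auto
      finally show ?thesis .
    qed
    moreover have "\<forall>\<^sub>F n in sequentially. prob {\<omega>\<in>space M. \<forall>j\<in>{k..K}. (z j \<le> \<bar>Zt n j \<omega>\<bar>) = (j \<in> {k})} = prob {\<omega>\<in>space M. k_B \<alpha> (X n) (Y n \<omega>) = k}"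
      using eventually_gt_at_top[of K]
    proof eventually_elim
      case (elim n)
      have "(\<forall>j\<in>{k..K}. (z j \<le> \<bar>Zt n j \<omega>\<bar>) = (j \<in> {k})) \<longleftrightarrow> z k \<le> \<bar>Zt n k \<omega>\<bar> \<and> (\<forall>j\<in>{k+1..K}. \<bar>Zt n j \<omega>\<bar> < z j)" for \<omega>
      proof -
        have "{k..K} = insert k {k+1..K}" using k by auto
        then show ?thesis by (auto simp: not_le)
      qed
      then show ?case unfolding k_B_event[OF elim k] by simp
    qed
    ultimately show ?thesis using 3 by (simp add: Lim_transform_eventually)
  qed
qed

section \<open>Orthonormal designs: forward selection and counting of rejections\<close>

context
  assumes I: "\<And>n. K < n \<Longrightarrow> (1 / real n) \<cdot>\<^sub>m (transpose_mat (X n) * X n) = 1\<^sub>m K"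
begin

text \<open>Off this event, whose probability vanishes, the first \<open>k0\<close> tests all
  reject, so both remaining estimators depend on the null positions alone.\<close>

definition missed :: "nat \<Rightarrow> 'a set" where
  "missed n = {\<omega>\<in>space M. \<exists>j\<in>{1..k0}. \<bar>Zt n j \<omega>\<bar> < z j}"

lemma missed_eq: "missed n = (\<Union>j\<in>{1..k0}. {\<omega>\<in>space M. \<bar>Zt n j \<omega>\<bar> < z j})"
  by (auto simp: missed_def)

lemma missed_event: "K < n \<Longrightarrow> missed n \<in> events"
  unfolding missed_eq using not_rejected_event by (intro sets.finite_UN) auto

lemma missed_limit: "(\<lambda>n. prob (missed n)) \<longlonglongrightarrow> 0"
proof (rule tendsto_sandwich[OF _ _ tendsto_const])
  show "\<forall>\<^sub>F n in sequentially. prob (missed n) \<le> (\<Sum>j\<in>{1..k0}. prob {\<omega>\<in>space M. \<bar>Zt n j \<omega>\<bar> < z j})"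
    using eventually_gt_at_top[of K]
  proof eventually_elim
    case (elim n)
    show ?case unfolding missed_eq
      by (rule measure_UNION_le) (use not_rejected_event[OF elim] in auto)
  qed
  have "(\<lambda>n. \<Sum>j\<in>{1..k0}. prob {\<omega>\<in>space M. \<bar>Zt n j \<omega>\<bar> < z j}) \<longlonglongrightarrow> (\<Sum>j\<in>{1..k0}. 0)"
    by (intro tendsto_sum Z_tilde_diverges_orthonormal I)
  then show "(\<lambda>n. \<Sum>j\<in>{1..k0}. prob {\<omega>\<in>space M. \<bar>Zt n j \<omega>\<bar> < z j}) \<longlonglongrightarrow> 0" by simp
qed simp

lemma k_F_event:
  assumes "K < n" "k \<in> {1..K}"
  shows "{\<omega>\<in>space M. k_F \<alpha> (X n) (Y n \<omega>) = k} =
    {\<omega>\<in>space M. (k < K \<longrightarrow> \<bar>Zt n (k+1) \<omega>\<bar> < z (k+1)) \<and> (\<forall>j\<in>{1..k}. z j \<le> \<bar>Zt n j \<omega>\<bar>)}"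
proof -
  \<comment> \<open>At \<open>k = K\<close> the next threshold is infinite and imposes no
    condition.\<close>
  have "ereal x < thr \<alpha> (k+1) \<longleftrightarrow> (k < K \<longrightarrow> x < z (k+1))" for x
  proof (cases "k < K")
    case True
    then show ?thesis using thr_z[of "k+1"] by simp
  next
    case False
    then have "k = K" using assms by simp
    then show ?thesis using \<alpha>(2) by (simp add: thr_def zq_def)
  qed
  moreover have "(\<forall>j\<in>{1..k}. thr \<alpha> j \<le> ereal \<bar>Zt n j \<omega>\<bar>) \<longleftrightarrow> (\<forall>j\<in>{1..k}. z j \<le> \<bar>Zt n j \<omega>\<bar>)" for \<omega>
    using assms by (intro ball_cong refl) (simp add: thr_z)
  ultimately show ?thesis
    using assms k_F_eq_iff[OF dim_X[OF assms(1)], of k \<alpha>] \<alpha>(2) by simp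
qed

text \<open>Off \<open>missed\<close>, selecting \<open>k \<ge> k0\<close> means rejecting at the
  null positions up to \<open>k\<close> and not at \<open>k + 1\<close>. For \<open>k = k0\<close>
  the product over rejected positions is empty, so one formula covers \<open>k = k0\<close> and
  \<open>k > k0\<close>.\<close>

lemma k_F_limit:
  assumes k: "k \<in> {1..K}"
  shows "(\<lambda>n. prob {\<omega>\<in>space M. k_F \<alpha> (X n) (Y n \<omega>) = k}) \<longlonglongrightarrow>
    (if k < k0 then 0 else if k = k0 then 1 - \<alpha> (k0 + 1) else (1 - \<alpha> (k + 1)) * (\<Prod>j\<in>{k0+1..k}. \<alpha> j))"
proof (cases "k < k0")
  case True
  have "(\<lambda>n. prob {\<omega>\<in>space M. k_F \<alpha> (X n) (Y n \<omega>) = k}) \<longlonglongrightarrow> 0"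
  proof (rule prob_tendsto_0_mono[OF _ missed_limit])
    show "\<forall>\<^sub>F n in sequentially. {\<omega>\<in>space M. k_F \<alpha> (X n) (Y n \<omega>) = k} \<subseteq> missed n \<and> missed n \<in> events"
      using eventually_gt_at_top[of K]
    proof eventually_elim
      case (elim n)
      have "{\<omega>\<in>space M. k_F \<alpha> (X n) (Y n \<omega>) = k} \<subseteq> missed n"
        unfolding k_F_event[OF elim k] missed_def using True k0 by auto
      then show ?case using missed_event[OF elim] by simp
    qed
  qed
  then show ?thesis using True by simp
next
  case False
  \<comment> \<open>Position \<open>k + 1\<close> is cut off at \<open>K\<close>, since no statistic
    beyond \<open>K\<close> is random.\<close>
  define J where "J = {k0+1..min (k+1) K}"
  define B where "B = {k0+1..k}"
  have J: "J \<subseteq> {k0+1..K}" by (auto simp: J_def)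
  have "(\<lambda>n. prob {\<omega>\<in>space M. k_F \<alpha> (X n) (Y n \<omega>) = k}) \<longlonglongrightarrow> (\<Prod>j\<in>J. if j \<in> B then \<alpha> j else 1 - \<alpha> j)"
  proof (rule prob_tendsto_approx[OF _ missed_limit rejection_set_limit[where B=B, OF J z]])
    show "\<forall>\<^sub>F n in sequentially. {\<omega>\<in>space M. k_F \<alpha> (X n) (Y n \<omega>) = k} \<in> events \<and>
        {\<omega>\<in>space M. \<forall>j\<in>J. (z j \<le> \<bar>Zt n j \<omega>\<bar>) = (j \<in> B)} \<in> events \<and> missed n \<in> events \<and>
        {\<omega>\<in>space M. k_F \<alpha> (X n) (Y n \<omega>) = k} \<subseteq> {\<omega>\<in>space M. \<forall>j\<in>J. (z j \<le> \<bar>Zt n j \<omega>\<bar>) = (j \<in> B)} \<union> missed n \<and>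
        {\<omega>\<in>space M. \<forall>j\<in>J. (z j \<le> \<bar>Zt n j \<omega>\<bar>) = (j \<in> B)} \<subseteq> {\<omega>\<in>space M. k_F \<alpha> (X n) (Y n \<omega>) = k} \<union> missed n"
      using eventually_gt_at_top[of K]
    proof eventually_elim
      case (elim n)
      note [measurable] = Z_tilde_measurable[OF elim]
      have 1: "{\<omega>\<in>space M. k_F \<alpha> (X n) (Y n \<omega>) = k} \<in> events"
        unfolding k_F_event[OF elim k] by measurable
      have 2: "{\<omega>\<in>space M. \<forall>j\<in>J. (z j \<le> \<bar>Zt n j \<omega>\<bar>) = (j \<in> B)} \<in> events"
        by (rule rejection_set_event[OF elim]) (simp add: J_def)
      have 3: "{\<omega>\<in>space M. k_F \<alpha> (X n) (Y n \<omega>) = k} \<subseteq> {\<omega>\<in>space M. \<forall>j\<in>J. (z j \<le> \<bar>Zt n j \<omega>\<bar>) = (j \<in> B)} \<union> missed n"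
      proof
        fix \<omega> assume "\<omega> \<in> {\<omega>\<in>space M. k_F \<alpha> (X n) (Y n \<omega>) = k}"
        then have \<omega>: "\<omega> \<in> space M" "k < K \<Longrightarrow> \<bar>Zt n (k+1) \<omega>\<bar> < z (k+1)" "\<And>j. j \<in> {1..k} \<Longrightarrow> z j \<le> \<bar>Zt n j \<omega>\<bar>"
          unfolding k_F_event[OF elim k] by auto
        have "(z j \<le> \<bar>Zt n j \<omega>\<bar>) = (j \<in> B)" if j: "j \<in> J" for j
        proof (cases "j \<le> k")
          case True
          then show ?thesis using \<omega>(3)[of j] j by (auto simp: J_def B_def)
        next
          case False
          then have "j = k + 1" "k < K" using j by (auto simp: J_def)
          then show ?thesis using \<omega>(2) by (auto simp: B_def)
        qed
        then show "\<omega> \<in> {\<omega>\<in>space M. \<forall>j\<in>J. (z j \<le> \<bar>Zt n j \<omega>\<bar>) = (j \<in> B)} \<union> missed n" using \<omega>(1) by simp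
      qed
      have 4: "{\<omega>\<in>space M. \<forall>j\<in>J. (z j \<le> \<bar>Zt n j \<omega>\<bar>) = (j \<in> B)} \<subseteq> {\<omega>\<in>space M. k_F \<alpha> (X n) (Y n \<omega>) = k} \<union> missed n"
      proof
        fix \<omega> assume "\<omega> \<in> {\<omega>\<in>space M. \<forall>j\<in>J. (z j \<le> \<bar>Zt n j \<omega>\<bar>) = (j \<in> B)}"
        then have \<omega>: "\<omega> \<in> space M" "\<And>j. j \<in> J \<Longrightarrow> (z j \<le> \<bar>Zt n j \<omega>\<bar>) = (j \<in> B)" by auto
        show "\<omega> \<in> {\<omega>\<in>space M. k_F \<alpha> (X n) (Y n \<omega>) = k} \<union> missed n"
        proof (cases "\<omega> \<in> missed n")
          case nm: False
          have "\<bar>Zt n (k+1) \<omega>\<bar> < z (k+1)" if "k < K"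
            using \<omega>(2)[of "k+1"] that False by (auto simp: J_def B_def)
          moreover have "z j \<le> \<bar>Zt n j \<omega>\<bar>" if j: "j \<in> {1..k}" for j
          proof (cases "j \<le> k0")
            case True
            then show ?thesis using nm \<omega>(1) j by (auto simp: missed_def not_less)
          next
            case False
            then show ?thesis using \<omega>(2)[of j] j k by (auto simp: J_def B_def)
          qed
          ultimately show ?thesis unfolding k_F_event[OF elim k] using \<omega>(1) by auto
        qed simp
      qed
      show ?case using 1 2 missed_event[OF elim] 3 4 by blast
    qed
  qed
  moreover have "(\<Prod>j\<in>J. if j \<in> B then \<alpha> j else 1 - \<alpha> j) = (1 - \<alpha> (k + 1)) * (\<Prod>j\<in>{k0+1..k}. \<alpha> j)"
  proof (cases "k < K")
    case True
    then have "J = insert (k+1) {k0+1..k}" using False by (auto simp: J_def)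
    then have "(\<Prod>j\<in>J. if j \<in> B then \<alpha> j else 1 - \<alpha> j) = (1 - \<alpha> (k + 1)) * (\<Prod>j\<in>{k0+1..k}. if j \<in> B then \<alpha> j else 1 - \<alpha> j)"
      by (simp add: B_def)
    also have "(\<Prod>j\<in>{k0+1..k}. if j \<in> B then \<alpha> j else 1 - \<alpha> j) = (\<Prod>j\<in>{k0+1..k}. \<alpha> j)"
      by (rule prod.cong) (auto simp: B_def)
    finally show ?thesis .
  next
    case nK: False
    then have kK: "k = K" using k by simp
    have "(\<Prod>j\<in>J. if j \<in> B then \<alpha> j else 1 - \<alpha> j) = (\<Prod>j\<in>{k0+1..k}. \<alpha> j)"
      by (rule prod.cong) (auto simp: B_def J_def kK)
    \<comment> \<open>Position \<open>K + 1\<close> is absent from \<open>J\<close>; the factor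
      \<open>1 - \<alpha> (K + 1)\<close> equals 1 and restores the common formula.\<close>
    then show ?thesis using \<alpha>(2) kK by simp
  qed
  ultimately show ?thesis using False by auto
qed

lemma k_O_event:
  assumes n: "K < n"
  shows "{\<omega>\<in>space M. k_O \<alpha> (X n) (Y n \<omega>) = k} = {\<omega>\<in>space M. card {j\<in>{1..K}. z j \<le> \<bar>Zt n j \<omega>\<bar>} = k}"
proof -
  have n0: "n > 0" using n by simp
  have "{j \<in> {1..K}. thr \<alpha> j \<le> ereal \<bar>Z_hat (X n) (Y n \<omega>) j\<bar>} = {j\<in>{1..K}. z j \<le> \<bar>Zt n j \<omega>\<bar>}" for \<omega>
    using Z_orthonormal(2)[OF Xdim[OF n] n0 I[OF n] Y_carrier[OF n]] by (auto simp: thr_z)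
  then show ?thesis by (simp add: k_O_def dim_X[OF n])
qed

text \<open>Off \<open>missed\<close> the count is \<open>k0\<close> plus the size of the set
  \<open>R n\<close> of rejected null positions. Splitting by the value \<open>B\<close> of that set
  gives finitely many disjoint patterns, each with a product limit; the limits add up to the point
  probability of the Bernoulli sum.\<close>

lemma k_O_limit:
  assumes k: "k \<in> {1..K}"
  shows "(\<lambda>n. prob {\<omega>\<in>space M. k_O \<alpha> (X n) (Y n \<omega>) = k}) \<longlonglongrightarrow>
    (if k < k0 then 0 else measure_pmf.prob (Pi_pmf {k0+1..K} False (\<lambda>j. bernoulli_pmf (\<alpha> j)))
                  {b. (\<Sum>j\<in>{k0+1..K}. if b j then 1 else 0 :: nat) = k - k0})"
proof -
  define J where "J = {k0+1..K}"
  define R where "R n \<omega> = {j\<in>J. z j \<le> \<bar>Zt n j \<omega>\<bar>}" for n \<omega>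
  have finR: "finite (R n \<omega>)" for n \<omega> by (simp add: R_def J_def)
  have split: "card {j\<in>{1..K}. z j \<le> \<bar>Zt n j \<omega>\<bar>} = k0 + card (R n \<omega>)" if "\<omega> \<in> space M" "\<omega> \<notin> missed n" for n \<omega>
  proof -
    have "{j\<in>{1..K}. z j \<le> \<bar>Zt n j \<omega>\<bar>} = {1..k0} \<union> R n \<omega>"
      using that k0 by (auto simp: missed_def R_def J_def)
    also have "card \<dots> = card {1..k0} + card (R n \<omega>)"
      by (rule card_Un_disjoint) (auto simp: finR, auto simp: R_def J_def)
    finally show ?thesis by simp
  qed
  show ?thesis
  proof (cases "k < k0")
    case True
    have "(\<lambda>n. prob {\<omega>\<in>space M. k_O \<alpha> (X n) (Y n \<omega>) = k}) \<longlonglongrightarrow> 0"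
    proof (rule prob_tendsto_0_mono[OF _ missed_limit])
      show "\<forall>\<^sub>F n in sequentially. {\<omega>\<in>space M. k_O \<alpha> (X n) (Y n \<omega>) = k} \<subseteq> missed n \<and> missed n \<in> events"
        using eventually_gt_at_top[of K]
      proof eventually_elim
        case (elim n)
        show ?case unfolding k_O_event[OF elim] using missed_event[OF elim] split[of _ n] True by force
      qed
    qed
    then show ?thesis using True by simp
  next
    case False
    let ?F = "{B. B \<subseteq> J \<and> card B = k - k0}"
    have finF: "finite ?F" by (rule finite_subset[of _ "Pow J"]) (auto simp: J_def)
    let ?E = "\<lambda>n B. {\<omega>\<in>space M. \<forall>j\<in>J. (z j \<le> \<bar>Zt n j \<omega>\<bar>) = (j \<in> B)}"
    have R_eq: "(\<forall>j\<in>J. (z j \<le> \<bar>Zt n j \<omega>\<bar>) = (j \<in> B)) \<longleftrightarrow> R n \<omega> = B" if "B \<subseteq> J" for n \<omega> B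
      using that by (auto simp: R_def)
    have un: "{\<omega>\<in>space M. card (R n \<omega>) = k - k0} = (\<Union>B\<in>?F. ?E n B)" for n
    proof -
      have "R n \<omega> \<subseteq> J" for \<omega> by (auto simp: R_def)
      then have "{\<omega>\<in>space M. card (R n \<omega>) = k - k0} = (\<Union>B\<in>?F. {\<omega>\<in>space M. R n \<omega> = B})" by auto
      also have "\<dots> = (\<Union>B\<in>?F. ?E n B)" using R_eq by (intro SUP_cong refl) auto
      finally show ?thesis .
    qed
    have E_event: "?E n B \<in> events" if "K < n" for n B
      by (rule rejection_set_event[OF that]) (simp add: J_def)
    have card_event: "{\<omega>\<in>space M. card (R n \<omega>) = k - k0} \<in> events" if "K < n" for n
      unfolding un using E_event[OF that] finF by (intro sets.finite_UN) auto
    have prob_eq: "prob {\<omega>\<in>space M. card (R n \<omega>) = k - k0} = (\<Sum>B\<in>?F. prob (?E n B))" if n: "K < n" for n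
      unfolding un
    proof (rule finite_measure_finite_Union[OF finF])
      show "?E n ` ?F \<subseteq> events" using E_event[OF n] by auto
      show "disjoint_family_on (?E n) ?F" unfolding disjoint_family_on_def using R_eq by auto
    qed
    have "(\<lambda>n. \<Sum>B\<in>?F. prob (?E n B)) \<longlonglongrightarrow> (\<Sum>B\<in>?F. \<Prod>j\<in>J. if j \<in> B then \<alpha> j else 1 - \<alpha> j)"
      by (intro tendsto_sum rejection_set_limit z) (auto simp: J_def)
    then have L: "(\<lambda>n. prob {\<omega>\<in>space M. card (R n \<omega>) = k - k0}) \<longlonglongrightarrow> (\<Sum>B\<in>?F. \<Prod>j\<in>J. if j \<in> B then \<alpha> j else 1 - \<alpha> j)"
      by (rule Lim_transform_eventually)
        (use eventually_gt_at_top[of K] in \<open>eventually_elim, simp add: prob_eq\<close>)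
    have "(\<lambda>n. prob {\<omega>\<in>space M. k_O \<alpha> (X n) (Y n \<omega>) = k}) \<longlonglongrightarrow> (\<Sum>B\<in>?F. \<Prod>j\<in>J. if j \<in> B then \<alpha> j else 1 - \<alpha> j)"
    proof (rule prob_tendsto_approx[OF _ missed_limit L])
      show "\<forall>\<^sub>F n in sequentially. {\<omega>\<in>space M. k_O \<alpha> (X n) (Y n \<omega>) = k} \<in> events \<and>
        {\<omega>\<in>space M. card (R n \<omega>) = k - k0} \<in> events \<and> missed n \<in> events \<and>
        {\<omega>\<in>space M. k_O \<alpha> (X n) (Y n \<omega>) = k} \<subseteq> {\<omega>\<in>space M. card (R n \<omega>) = k - k0} \<union> missed n \<and>
        {\<omega>\<in>space M. card (R n \<omega>) = k - k0} \<subseteq> {\<omega>\<in>space M. k_O \<alpha> (X n) (Y n \<omega>) = k} \<union> missed n"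
        using eventually_gt_at_top[of K]
      proof eventually_elim
        case (elim n)
        note [measurable] = Z_tilde_measurable[OF elim]
        have "{\<omega>\<in>space M. k_O \<alpha> (X n) (Y n \<omega>) = k} \<in> events"
        proof -
          have "(\<lambda>\<omega>. card {j\<in>{1..K}. z j \<le> \<bar>Zt n j \<omega>\<bar>}) \<in> measurable M (count_space UNIV)"
          proof -
            have "card {j\<in>{1..K}. z j \<le> \<bar>Zt n j \<omega>\<bar>} = (\<Sum>j\<in>{1..K}. if z j \<le> \<bar>Zt n j \<omega>\<bar> then 1 else 0)" for \<omega>
              by (simp add: sum.If_cases Int_def)
            then show ?thesis by simp
          qed
          from measurable_sets[OF this, of "{k}"] show ?thesis
            unfolding k_O_event[OF elim] by (simp add: vimage_def Int_def conj_commute)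
        qed
        then show ?case
          using card_event[OF elim] missed_event[OF elim] split[of _ n] False unfolding k_O_event[OF elim] by force
      qed
    qed
    also have "(\<Sum>B\<in>?F. \<Prod>j\<in>J. if j \<in> B then \<alpha> j else 1 - \<alpha> j) = measure_pmf.prob (Pi_pmf J False (\<lambda>j. bernoulli_pmf (\<alpha> j)))
                  {b. (\<Sum>j\<in>J. if b j then 1 else 0 :: nat) = k - k0}"
    proof (rule prob_Pi_bernoulli_count[symmetric])
      show "0 \<le> \<alpha> j \<and> \<alpha> j \<le> 1" if "j \<in> J" for j using \<alpha>(1)[of j] that by (auto simp: J_def)
    qed (simp add: J_def)
    finally show ?thesis using False by (simp add: J_def)
  qed
qed

end

end

theorem theorem8:
  fixes M :: "'a measure" and K k0 :: nat and \<beta>0 :: "real vec" and X :: "nat \<Rightarrow> real mat"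
    and \<Sigma>0 :: "real mat" and \<epsilon> :: "nat \<Rightarrow> 'a \<Rightarrow> real" and \<sigma>0 Mb :: real
    and \<alpha> :: "nat \<Rightarrow> real" and Y :: "nat \<Rightarrow> 'a \<Rightarrow> real vec"
  assumes K: "K \<ge> 1" and k0: "1 \<le> k0" "k0 \<le> K"
    and beta0: "\<beta>0 \<in> carrier_vec K" "\<forall>j<k0. vec_index \<beta>0 j \<noteq> 0" "\<forall>j. k0 \<le> j \<and> j < K \<longrightarrow> vec_index \<beta>0 j = 0"
    and Xdim: "\<forall>n>K. X n \<in> carrier_mat n K"
    and X_i: "\<forall>n>K. \<forall>k<K. (\<Sum>i<n. index_mat (X n) (i,k)) = 0 \<and> (\<Sum>i<n. (index_mat (X n) (i,k))\<^sup>2) = real n"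
    and X_ii: "(\<lambda>n. Max ((\<lambda>i. sqrt (\<Sum>k<K. (index_mat (X n) (i,k))\<^sup>2)) ` {..<n}) / sqrt (real n)) \<longlonglongrightarrow> 0"
    and X_iii: "\<forall>n>K. pos_def_mat (transpose_mat (X n) * X n)"
    and X_iv: "\<Sigma>0 \<in> carrier_mat K K" "pos_def_mat \<Sigma>0"
      "\<forall>i<K. \<forall>j<K. (\<lambda>n. index_mat ((1 / real n) \<cdot>\<^sub>m (transpose_mat (X n) * X n)) (i,j))
                      \<longlonglongrightarrow> index_mat \<Sigma>0 (i,j)"
    and P: "prob_space M"
    and eps_rv: "\<forall>i. \<epsilon> i \<in> borel_measurable M"
    and eps_indep: "prob_space.indep_vars M (\<lambda>_. borel) \<epsilon> UNIV"
    and eps_mom: "\<forall>i. integrable M (\<lambda>\<omega>. (\<epsilon> i \<omega>) ^ 4)" "\<forall>i. integral\<^sup>L M (\<epsilon> i) = 0"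
      "\<forall>i. integral\<^sup>L M (\<lambda>\<omega>. (\<epsilon> i \<omega>)\<^sup>2) = \<sigma>0\<^sup>2" "\<sigma>0 > 0"
      "\<forall>i. integral\<^sup>L M (\<lambda>\<omega>. (\<epsilon> i \<omega>) ^ 4) \<le> Mb"
    and Y: "\<forall>n \<omega>. Y n \<omega> = X n *\<^sub>v \<beta>0 + vec n (\<lambda>i. \<epsilon> i \<omega>)"
    and alpha: "\<forall>k\<in>{1..K}. 0 < \<alpha> k \<and> \<alpha> k < 1" "\<alpha> (Suc K) = 0"
  shows
   "(\<forall>k\<in>{1..K}.
      (\<lambda>n. measure M {\<omega> \<in> space M. k_B \<alpha> (X n) (Y n \<omega>) = k}) \<longlonglongrightarrow>
        (if k < k0 then 0
         else if k = k0 then (\<Prod>j\<in>{k0+1..K}. 1 - \<alpha> j)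
         else \<alpha> k * (\<Prod>j\<in>{k+1..K}. 1 - \<alpha> j)))
    \<and>
    ((\<forall>n>K. (1 / real n) \<cdot>\<^sub>m (transpose_mat (X n) * X n) = 1\<^sub>m K) \<and> \<Sigma>0 = 1\<^sub>m K \<longrightarrow>
      (\<forall>k\<in>{1..K}.
        (\<lambda>n. measure M {\<omega> \<in> space M. k_F \<alpha> (X n) (Y n \<omega>) = k}) \<longlonglongrightarrow>
          (if k < k0 then 0
           else if k = k0 then 1 - \<alpha> (k0 + 1)
           else (1 - \<alpha> (k + 1)) * (\<Prod>j\<in>{k0+1..k}. \<alpha> j)))
      \<and>
      (\<forall>k\<in>{1..K}.
        (\<lambda>n. measure M {\<omega> \<in> space M. k_O \<alpha> (X n) (Y n \<omega>) = k}) \<longlonglongrightarrow>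
          (if k < k0 then 0
           else measure_pmf.prob (Pi_pmf {k0+1..K} False (\<lambda>j. bernoulli_pmf (\<alpha> j)))
                  {b. (\<Sum>j\<in>{k0+1..K}. if b j then 1 else 0 :: nat) = k - k0})))"
  proof -
  \<comment> \<open>The levels lie strictly between 0 and 1, so every threshold at
    \<open>1..K\<close> is a real number; these numbers instantiate \<open>z\<close> of the
    locale.\<close>
  have "\<exists>z. \<forall>j\<in>{1..K}. thr \<alpha> j = ereal (z j) \<and> measure std_normal_distribution {w. z j \<le> \<bar>w\<bar>} = \<alpha> j \<and>
      measure std_normal_distribution {w. \<bar>w\<bar> < z j} = 1 - \<alpha> j"
  proof (rule bchoice, rule ballI)
    fix j assume j: "j \<in> {1..K}"
    obtain x where "zq (\<alpha> j / 2) = ereal x" "measure std_normal_distribution {w. x \<le> \<bar>w\<bar>} = \<alpha> j"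
      "measure std_normal_distribution {w. \<bar>w\<bar> < x} = 1 - \<alpha> j"
      using zq_half[of "\<alpha> j"] alpha(1) j by blast
    then show "\<exists>x. thr \<alpha> j = ereal x \<and> measure std_normal_distribution {w. x \<le> \<bar>w\<bar>} = \<alpha> j \<and>
        measure std_normal_distribution {w. \<bar>w\<bar> < x} = 1 - \<alpha> j"
      using j by (auto simp: thr_def)
  qed
  then obtain z where z: "\<And>j. j \<in> {1..K} \<Longrightarrow> thr \<alpha> j = ereal (z j)"
    "\<And>j. j \<in> {1..K} \<Longrightarrow> measure std_normal_distribution {w. z j \<le> \<bar>w\<bar>} = \<alpha> j"
    "\<And>j. j \<in> {1..K} \<Longrightarrow> measure std_normal_distribution {w. \<bar>w\<bar> < z j} = 1 - \<alpha> j"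
    by blast
  interpret prob_space M by fact
  interpret selection_model M K k0 \<beta>0 X \<Sigma>0 \<epsilon> \<sigma>0 Mb Y \<alpha> z
    by unfold_locales (use assms z in auto)
  show ?thesis
    using k_B_limit k_F_limit k_O_limit by blast
qed

end
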